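(* Under the standing setup below, if $\varepsilon_0>0$ is sufficiently small, there exist $\eta\in(0,1)$ and $C>0$ such that for every $f\in V_1$, $Pf\in V_1$ and $$\|Pf\|_{V_1}\le\eta\|f\|_{V_1}+C\|f\|_{L^1}.$$
   Context: Standing setup. Fix an integer $k\ge2$ and reals $L>0$, $\beta>0$. Let $\Phi_0:(-L-\beta,L+\beta)^k\to\mathbb R$ be $C^2$. For $n\ge1$ let $\gamma_n$ be the Lebesgue volume of the unit ball of $\mathbb R^n$. For $\sigma>1$, $Y>0$ put $\eta_0(\sigma,Y)=\sigma^{-1/2}+\frac{4}{\sqrt\sigma-1}\,Y\,\frac{\gamma_{k-1}}{\gamma_k}$ and let $S_k(Y)>1$ be the value of $\sigma$ with $\eta_0(\sigma,Y)=1$. Fix $\sigma>S_k(k+2)$ and constants $C_1,C_2>1$, and assume: $\gamma^{-2}=C_1\sigma$; for all $x\in(-L-\beta,L+\beta)^k$, $(\partial_1\Phi_0(x))^2\ge C_1^{k-1}C_2\sigma^k$ and $(\partial_j\Phi_0(x))^2\le\frac{(C_1-1)(C_2-1)}{k-1}\sigma$ for $2\le j\le k$. Let $\Gamma(x)=(\gamma^{-(j-1)}x_j)_{j=1}^k$; $\Omega=\prod_{j=1}^k[-\gamma^{j-1}L,\gamma^{j-1}L]$; $\Omega_0=\Gamma^{-1}((-L,L)^k)$; $U_j^\theta=\{x\in\Omega_0:(2j-1)L<\theta+\Phi_0(\Gamma x)<(2j+1)L\}$; $T_\theta:\Omega\to\Omega$ defined a.e. by $T_\theta(u)=(u_2/\gamma,\dots,u_k/\gamma,\gamma^{k-1}(\Phi_0(\Gamma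 u)+\theta-2jL))$ on $U_j^\theta$. $P_\theta$ is the Perron–Frobenius operator of $T_\theta$ on $L^1(\Omega,m)$ ($m$ Lebesgue): $\int_AP_\theta f\,dm=\int_{T_\theta^{-1}(A)}f\,dm$. $H$ is a probability density on $\mathbb R$ and $Pf=\int_{\mathbb R}H(\theta)P_\theta f\,d\theta$. For $f\in L^1(\mathbb R^k)$ and non-null Borel $A$, $\operatorname{osc}(f,A)=\operatorname{ess\,sup}_{x,y\in A}|f(x)-f(y)|$. Given $\varepsilon_0>0$: $|f|_1=\sup_{0<\varepsilon<\varepsilon_0}\varepsilon^{-1}\int_{\mathbb R^k}\operatorname{osc}(f,B(x,\varepsilon))\,dx$, $V_1=\{f\in L^1(\mathbb R^k):\operatorname{supp}f\subset\Omega,\ |f|_1<\infty\}$, $\|f\|_{V_1}=\|f\|_{L^1}+|f|_1$; functions on $\Omega$ are extended by $0$. *)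

theory Defs
  imports "HOL-Analysis.Analysis" "HOL-Probability.Essential_Supremum"
begin

text \<open>Coordinates.  R^k is modelled as real^'n with k = CARD('n); a bijection
  e from {1..k} onto the index type fixes the order of the coordinates,
  so that the j-th coordinate of x is x $ e j.\<close>

definition mkv :: "(nat \<Rightarrow> 'n::finite) \<Rightarrow> (nat \<Rightarrow> real) \<Rightarrow> real^'n" where
  "mkv e F = (\<chi> i. F (the_inv_into {1..CARD('n)} e i))"

definition C2_on :: "('a::real_normed_vector \<Rightarrow> real) \<Rightarrow> 'a set \<Rightarrow> bool" where
  "C2_on f U \<longleftrightarrow> (\<exists>(f' :: 'a \<Rightarrow> ('a \<Rightarrow>\<^sub>L real)) (f'' :: 'a \<Rightarrow> ('a \<Rightarrow>\<^sub>L ('a \<Rightarrow>\<^sub>L real))).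
      (\<forall>x\<in>U. (f has_derivative blinfun_apply (f' x)) (at x)) \<and>
      (\<forall>x\<in>U. (f' has_derivative blinfun_apply (f'' x)) (at x)) \<and>
      continuous_on U f'')"

definition pderiv_coord :: "(nat \<Rightarrow> 'n::finite) \<Rightarrow> (real^'n \<Rightarrow> real) \<Rightarrow> nat \<Rightarrow> real^'n \<Rightarrow> real" where
  "pderiv_coord e f j x = frechet_derivative f (at x) (axis (e j) 1)"

definition eta0 :: "nat \<Rightarrow> real \<Rightarrow> real \<Rightarrow> real" where
  "eta0 k \<sigma> Y = \<sigma> powr (-1/2) + 4 / (sqrt \<sigma> - 1) * Y *
      (unit_ball_vol (real (k - 1)) / unit_ball_vol (real k))"

definition S_k :: "nat \<Rightarrow> real \<Rightarrow> real" where
  "S_k k Y = (THE \<sigma>. \<sigma> > 1 \<and> eta0 k \<sigma> Y = 1)"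

definition Gam :: "(nat \<Rightarrow> 'n::finite) \<Rightarrow> real \<Rightarrow> real^'n \<Rightarrow> real^'n" where
  "Gam e \<gamma> x = mkv e (\<lambda>j. (1/\<gamma>)^(j - 1) * x $ e j)"

definition OmegaS :: "(nat \<Rightarrow> 'n::finite) \<Rightarrow> real \<Rightarrow> real \<Rightarrow> (real^'n) set" where
  "OmegaS e \<gamma> L = {u. \<forall>j\<in>{1..CARD('n)}. \<bar>u $ e j\<bar> \<le> \<gamma>^(j - 1) * L}"

definition Omega0 :: "(nat \<Rightarrow> 'n::finite) \<Rightarrow> real \<Rightarrow> real \<Rightarrow> (real^'n) set" where
  "Omega0 e \<gamma> L = {u. \<forall>j\<in>{1..CARD('n)}. -L < Gam e \<gamma> u $ e j \<and> Gam e \<gamma> u $ e j < L}"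

definition Uset :: "(nat \<Rightarrow> 'n::finite) \<Rightarrow> real \<Rightarrow> real \<Rightarrow> (real^'n \<Rightarrow> real) \<Rightarrow> real \<Rightarrow> int \<Rightarrow> (real^'n) set" where
  "Uset e \<gamma> L \<Phi> \<theta> j = {x \<in> Omega0 e \<gamma> L.
      (2 * real_of_int j - 1) * L < \<theta> + \<Phi> (Gam e \<gamma> x) \<and> \<theta> + \<Phi> (Gam e \<gamma> x) < (2 * real_of_int j + 1) * L}"

definition Tbr :: "(nat \<Rightarrow> 'n::finite) \<Rightarrow> real \<Rightarrow> real \<Rightarrow> (real^'n \<Rightarrow> real) \<Rightarrow> real \<Rightarrow> int \<Rightarrow> real^'n \<Rightarrow> real^'n" where
  "Tbr e \<gamma> L \<Phi> \<theta> j u = mkv e (\<lambda>i. if i < CARD('n) then u $ e (i + 1) / \<gamma>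
      else \<gamma>^(CARD('n) - 1) * (\<Phi> (Gam e \<gamma> u) + \<theta> - 2 * real_of_int j * L))"

text \<open>T_theta^{-1}(A) (T_theta is defined a.e., namely on the union of the U_j^theta).\<close>
definition Tpre :: "(nat \<Rightarrow> 'n::finite) \<Rightarrow> real \<Rightarrow> real \<Rightarrow> (real^'n \<Rightarrow> real) \<Rightarrow> real \<Rightarrow> (real^'n) set \<Rightarrow> (real^'n) set" where
  "Tpre e \<gamma> L \<Phi> \<theta> A = {u. \<exists>j. u \<in> Uset e \<gamma> L \<Phi> \<theta> j \<and> Tbr e \<gamma> L \<Phi> \<theta> j u \<in> A}"

text \<open>g is (a version of) P f = int H(theta) P_theta f dtheta, extended by 0 outside Omega;
  characterised by duality: for every Borel A in Omega,
  int_A P f = int H(theta) (int_A P_theta f) dtheta = int H(theta) (int_{T_theta^{-1} A} f) dtheta.\<close>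
definition is_Pf :: "(nat \<Rightarrow> 'n::finite) \<Rightarrow> real \<Rightarrow> real \<Rightarrow> (real^'n \<Rightarrow> real) \<Rightarrow> (real \<Rightarrow> real)
    \<Rightarrow> (real^'n \<Rightarrow> real) \<Rightarrow> (real^'n \<Rightarrow> real) \<Rightarrow> bool" where
  "is_Pf e \<gamma> L \<Phi> H f g \<longleftrightarrow>
     g \<in> borel_measurable lborel \<and> integrable lborel g \<and>
     (\<forall>x. x \<notin> OmegaS e \<gamma> L \<longrightarrow> g x = 0) \<and>
     (\<forall>A \<in> sets lborel. A \<subseteq> OmegaS e \<gamma> L \<longrightarrow>
        integrable lborel (\<lambda>\<theta>. H \<theta> * (\<integral>u \<in> Tpre e \<gamma> L \<Phi> \<theta> A. f u \<partial>lborel)) \<and>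
        (\<integral>x \<in> A. g x \<partial>lborel) =
          (\<integral>\<theta>. H \<theta> * (\<integral>u \<in> Tpre e \<gamma> L \<Phi> \<theta> A. f u \<partial>lborel) \<partial>lborel))"

definition osc :: "('a::euclidean_space \<Rightarrow> real) \<Rightarrow> 'a set \<Rightarrow> ereal" where
  "osc f A = esssup (restrict_space (lborel \<Otimes>\<^sub>M lborel) (A \<times> A))
                    (\<lambda>(x, y). ereal \<bar>f x - f y\<bar>)"

definition semi1 :: "real \<Rightarrow> ('a::euclidean_space \<Rightarrow> real) \<Rightarrow> ennreal" where
  "semi1 \<epsilon>0 f = (SUP \<epsilon> \<in> {0<..<\<epsilon>0}.
       ennreal (1 / \<epsilon>) * (\<integral>\<^sup>+ x. e2ennreal (osc f (ball x \<epsilon>)) \<partial>lborel))"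

definition L1norm :: "('a::euclidean_space \<Rightarrow> real) \<Rightarrow> real" where
  "L1norm f = (\<integral>x. \<bar>f x\<bar> \<partial>lborel)"

definition V1 :: "real \<Rightarrow> ('a::euclidean_space) set \<Rightarrow> ('a \<Rightarrow> real) \<Rightarrow> bool" where
  "V1 \<epsilon>0 \<Omega> f \<longleftrightarrow> f \<in> borel_measurable lborel \<and> integrable lborel f \<and>
      (AE x in lborel. x \<notin> \<Omega> \<longrightarrow> f x = 0) \<and> semi1 \<epsilon>0 f < \<infinity>"

definition normV1 :: "real \<Rightarrow> ('a::euclidean_space \<Rightarrow> real) \<Rightarrow> ennreal" where
  "normV1 \<epsilon>0 f = ennreal (L1norm f) + semi1 \<epsilon>0 f"

end

theory Submission
  imports Defs
begin

text \<open>
  All branches of the maps are translates, along the last coordinate, of one expanding map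
  \<open>F u = (u\<^sub>2/\<gamma>, \<dots>, u\<^sub>k/\<gamma>, \<gamma>\<^sup>k\<^sup>-\<^sup>1 \<Phi>\<^sub>0(\<Gamma> u))\<close>.  Writing \<open>h\<close> for the image density
  \<open>(f / \<bar>\<partial>\<^sub>1\<Phi>\<^sub>0 \<circ> \<Gamma>\<bar>) \<circ> F\<^sup>-\<^sup>1\<close> and \<open>e\<^sub>k\<close> for the last basis vector, \<open>P f\<close> is therefore
  \<open>x \<mapsto> \<integral> h (x + t e\<^sub>k) d\<mu>(t)\<close>, restricted to the strip \<open>\<bar>x\<^sub>k\<bar> < \<gamma>\<^sup>k\<^sup>-\<^sup>1 L\<close>, where \<open>\<mu>\<close> is the
  image of \<open>H d\<theta> \<otimes> counting\<close> under \<open>(\<theta>, j) \<mapsto> (2 j L - \<theta>) \<gamma>\<^sup>k\<^sup>-\<^sup>1\<close> and gives mass at most one to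
  every open interval of the width of the strip.

  \<open>F\<close> stretches distances by at least \<open>\<surd>\<sigma>\<close> on the whole enlarged box, because its last coordinate is
  scalar and the mean value theorem applies to it.  Hence the oscillation of \<open>h\<close> at scale \<open>\<epsilon>\<close> is that
  of \<open>f\<close> at scale \<open>\<sigma>\<^sup>-\<^sup>1\<^sup>/\<^sup>2 \<epsilon>\<close>, up to a distortion factor \<open>1 + O(\<epsilon>)\<close>.  The faces of the box cost nothing
  extra, since \<open>f\<close> is extended by zero; only the two hyperplanes bounding the strip create new
  discontinuities.  Near them the supremum of \<open>\<bar>h\<bar>\<close> on an \<open>\<epsilon>\<close>-ball is estimated by averaging
  \<open>\<bar>h\<bar> + osc h\<close> (at a scale comparable to \<open>\<surd>\<sigma> \<epsilon>\<^sub>0\<close>) along a segment transversal to the hyperplanes.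
  With \<open>s = \<sigma>\<^sup>-\<^sup>1\<^sup>/\<^sup>2\<close> the resulting contraction constant is at most \<open>s + 8 s / (1 - s)\<close>, which is less
  than one because \<open>(k + 2) \<gamma>\<^sub>k\<^sub>-\<^sub>1 / \<gamma>\<^sub>k \<ge> 2\<close>.
\<close>

section \<open>Essential oscillation over balls\<close>

text \<open>Estimating branch by branch would charge a boundary term to each branch. Integrating all
  translates against \<mu> first charges only the \<mu>-mass of an interval, whatever the number of
  branches or the density H. The 8 arises as follows. Averaging over a segment of half-length r
  costs 4 \<epsilon> / r, and the oscillation of h at scale r + \<epsilon> is controlled by f only
  if s (r + \<epsilon>) < \<epsilon>0. For \<epsilon> near \<epsilon>0 this limits r to about
  \<epsilon>0 (1 - s) / s, so the cost is 4 s / (1 - s) at best. The remaining factor 2 is slack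
  that absorbs the distortion and the strict bound on the scale. It is affordable because 4 (k + 2)
  times the ratio of ball volumes is at least 8, so s + 8 s / (1 - s) is at most \<open>eta0\<close>
  at \<sigma>. The margin \<beta> leaves room for balls that overlap the edge of the image of
  \<Omega>. Oscillations are essential ones, so each pointwise estimate fails on a null set
  depending on the ball, the shift or the other point. Much of the work consists in exchanging these
  null sets by Fubini.\<close>

definition eosc :: "('a::euclidean_space \<Rightarrow> real) \<Rightarrow> 'a set \<Rightarrow> ennreal" where
  "eosc f A = e2ennreal (osc f A)"

text \<open>\<open>e2ennreal\<close> clips negative values to 0 and otherwise inverts
  \<open>enn2ereal\<close>, so the two are adjoint without a sign condition. This carries upper
  bounds between \<open>esssup\<close> and \<open>eosc\<close>.\<close>

lemma e2ennreal_le_iff: "e2ennreal a \<le> c \<longleftrightarrow> a \<le> enn2ereal c"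
proof
  assume "e2ennreal a \<le> c"
  then have "enn2ereal (e2ennreal a) \<le> enn2ereal c"
    by (simp add: less_eq_ennreal.rep_eq)
  then show "a \<le> enn2ereal c"
    by (cases "0 \<le> a") (auto simp: enn2ereal_e2ennreal intro: order_trans[OF _ enn2ereal_nonneg])
next
  assume "a \<le> enn2ereal c"
  then have "e2ennreal a \<le> e2ennreal (enn2ereal c)"
    by (rule e2ennreal_mono)
  then show "e2ennreal a \<le> c" by simp
qed

lemma ennreal_abs_le_iff: "ereal \<bar>d\<bar> \<le> enn2ereal c \<longleftrightarrow> ennreal \<bar>d\<bar> \<le> c"
  by (simp add: less_eq_ennreal.rep_eq)

lemma sigma_finite_lborel_pair: "sigma_finite_measure (lborel \<Otimes>\<^sub>M lborel)"
  by (simp add: lborel_prod lborel.sigma_finite_measure_axioms)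

text \<open>The working form of \<open>eosc\<close>: a bound on an essential supremum is an
  almost-everywhere bound, and Fubini splits the null set of pairs into nested quantifiers.\<close>

lemma eosc_le_iff:
  fixes f :: "'a::euclidean_space \<Rightarrow> real"
  assumes [measurable]: "f \<in> borel_measurable borel" "A \<in> sets borel"
  shows "eosc f A \<le> c \<longleftrightarrow>
    (AE x in lborel. AE y in lborel. x \<in> A \<longrightarrow> y \<in> A \<longrightarrow> ennreal \<bar>f x - f y\<bar> \<le> c)"
proof -
  let ?M = "lborel \<Otimes>\<^sub>M lborel :: ('a \<times> 'a) measure"
  let ?R = "restrict_space ?M (A \<times> A)"
  let ?g = "\<lambda>(x, y). ereal \<bar>f x - f y\<bar>"
  have m: "?g \<in> borel_measurable ?R"
    by (intro measurable_restrict_space1) measurable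
  have AA: "A \<times> A \<inter> space ?M \<in> sets ?M"
    by auto
  have S: "{z \<in> space ?M. fst z \<in> A \<longrightarrow> snd z \<in> A \<longrightarrow> ennreal \<bar>f (fst z) - f (snd z)\<bar> \<le> c} \<in> sets ?M"
    by measurable
  have "eosc f A \<le> c \<longleftrightarrow> esssup ?R ?g \<le> enn2ereal c"
    by (simp add: eosc_def osc_def e2ennreal_le_iff)
  also have "\<dots> \<longleftrightarrow> (AE z in ?R. ?g z \<le> enn2ereal c)"
    using esssup_I[OF m] esssup_AE[of ?g ?R]
    by (auto elim!: eventually_mono intro: order_trans)
  also have "\<dots> \<longleftrightarrow> (AE z in ?M. z \<in> A \<times> A \<longrightarrow> ?g z \<le> enn2ereal c)"
    by (rule AE_restrict_space_iff[OF AA])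
  also have "\<dots> \<longleftrightarrow> (AE z in ?M. fst z \<in> A \<longrightarrow> snd z \<in> A \<longrightarrow> ennreal \<bar>f (fst z) - f (snd z)\<bar> \<le> c)"
    by (intro AE_cong) (auto simp: ennreal_abs_le_iff)
  also have "\<dots> \<longleftrightarrow> (AE x in lborel. AE y in lborel. x \<in> A \<longrightarrow> y \<in> A \<longrightarrow> ennreal \<bar>f x - f y\<bar> \<le> c)"
    using lborel_pair.AE_pair_iff[OF S] by simp
  finally show ?thesis .
qed

lemma eosc_AE:
  fixes f :: "'a::euclidean_space \<Rightarrow> real"
  assumes "f \<in> borel_measurable borel" "A \<in> sets borel"
  shows "AE x in lborel. AE y in lborel. x \<in> A \<longrightarrow> y \<in> A \<longrightarrow> ennreal \<bar>f x - f y\<bar> \<le> eosc f A"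
  using eosc_le_iff[OF assms, of "eosc f A"] by simp

lemma eosc_mono:
  fixes f :: "'a::euclidean_space \<Rightarrow> real"
  assumes f: "f \<in> borel_measurable borel" and A: "A \<in> sets borel" and B: "B \<in> sets borel" and "A \<subseteq> B"
  shows "eosc f A \<le> eosc f B"
proof -
  have "AE x in lborel. AE y in lborel. x \<in> A \<longrightarrow> y \<in> A \<longrightarrow> ennreal \<bar>f x - f y\<bar> \<le> eosc f B"
    using eosc_AE[OF f B] by eventually_elim (elim eventually_mono, use \<open>A \<subseteq> B\<close> in blast)
  then show ?thesis
    using eosc_le_iff[OF f A] by blast
qed

lemma eosc_cong_AE:
  fixes f g :: "'a::euclidean_space \<Rightarrow> real"
  assumes f: "f \<in> borel_measurable borel" and g: "g \<in> borel_measurable borel"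
    and A: "A \<in> sets borel" and eq: "AE x in lborel. f x = g x"
  shows "eosc f A = eosc g A"
proof -
  have *: "eosc f A \<le> eosc g A"
    if f: "f \<in> borel_measurable borel" and g: "g \<in> borel_measurable borel"
      and eq: "AE x in lborel. f x = g x" for f g :: "'a \<Rightarrow> real"
  proof -
    have "AE x in lborel. AE y in lborel. x \<in> A \<longrightarrow> y \<in> A \<longrightarrow> ennreal \<bar>f x - f y\<bar> \<le> eosc g A"
      using eosc_AE[OF g A] eq
    proof eventually_elim
      case (elim x)
      from elim(1) eq show ?case
        by eventually_elim (use elim in auto)
    qed
    then show ?thesis
      using eosc_le_iff[OF f A] by blast
  qed
  show ?thesis
    using *[OF f g eq] *[OF g f] eq by (auto intro!: antisym simp: eq_commute)
qed

text \<open>A sublevel set is the zero set of a double integral of the indicator of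
  \<open>W\<close>. Since \<open>W\<close> is measurable jointly in the centre and the two points,
  Tonelli gives measurability in the centre.\<close>

lemma borel_measurable_eosc_ball [measurable]:
  fixes f :: "'a::euclidean_space \<Rightarrow> real"
  assumes [measurable]: "f \<in> borel_measurable borel"
  shows "(\<lambda>x. eosc f (ball x r)) \<in> borel_measurable borel"
proof (rule borel_measurableI_le)
  fix c :: ennreal
  define W where "W = {p :: 'a \<times> 'a \<times> 'a. dist (fst p) (fst (snd p)) < r \<and> dist (fst p) (snd (snd p)) < r
      \<and> \<not> ennreal \<bar>f (fst (snd p)) - f (snd (snd p))\<bar> \<le> c}"
  have W_eq: "W = {p \<in> space (borel \<Otimes>\<^sub>M borel \<Otimes>\<^sub>M borel). dist (fst p) (fst (snd p)) < r
      \<and> dist (fst p) (snd (snd p)) < r \<and> \<not> ennreal \<bar>f (fst (snd p)) - f (snd (snd p))\<bar> \<le> c}"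
    by (auto simp: W_def space_pair_measure)
  have [measurable]: "W \<in> sets (borel \<Otimes>\<^sub>M borel \<Otimes>\<^sub>M borel)"
    unfolding W_eq by measurable
  have eq: "eosc f (ball x r) \<le> c \<longleftrightarrow> (\<integral>\<^sup>+y. \<integral>\<^sup>+z. indicator W (x, y, z) \<partial>lborel \<partial>lborel) = 0" for x
  proof -
    have m: "(\<lambda>z. indicator W (x, y, z) :: ennreal) \<in> borel_measurable lborel" for y
      by measurable
    have m2: "(\<lambda>y. \<integral>\<^sup>+z. indicator W (x, y, z) \<partial>lborel) \<in> borel_measurable lborel"
      by measurable
    have "eosc f (ball x r) \<le> c \<longleftrightarrow> (AE y in lborel. AE z in lborel. (x, y, z) \<notin> W)"
      by (subst eosc_le_iff) (auto simp: W_def dist_commute intro!: AE_cong)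
    also have "\<dots> \<longleftrightarrow> (AE y in lborel. (\<integral>\<^sup>+z. indicator W (x, y, z) \<partial>lborel) = 0)"
      unfolding nn_integral_0_iff_AE[OF m] by (simp add: indicator_eq_0_iff)
    also have "\<dots> \<longleftrightarrow> (\<integral>\<^sup>+y. \<integral>\<^sup>+z. indicator W (x, y, z) \<partial>lborel \<partial>lborel) = 0"
      unfolding nn_integral_0_iff_AE[OF m2] ..
    finally show ?thesis .
  qed
  show "{x \<in> space borel. eosc f (ball x r) \<le> c} \<in> sets borel"
    unfolding eq by measurable
qed

text \<open>The null set of \<open>eosc_AE\<close> depends on the ball, and here the ball moves with
  x. Balls with centres in a countable dense set and rational radii share one null set, and one of
  them contains both points and lies inside the given ball.\<close>

lemma AE_AE_le_eosc_ball:
  fixes f :: "'a::euclidean_space \<Rightarrow> real"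
  assumes f: "f \<in> borel_measurable borel"
  shows "AE x in lborel. AE y in lborel. dist x y < r \<longrightarrow> ennreal \<bar>f x - f y\<bar> \<le> eosc f (ball x r)"
proof -
  obtain Q :: "'a set" where Q: "countable Q" "\<And>X. open X \<Longrightarrow> X \<noteq> {} \<Longrightarrow> \<exists>d\<in>Q. d \<in> X"
    using countable_dense_setE by blast
  define I where "I = Q \<times> (\<rat> :: real set)"
  have I: "countable I"
    using Q(1) countable_rat by (auto simp: I_def)
  have "AE x in lborel. \<forall>(q, d)\<in>I. AE y in lborel. x \<in> ball q d \<longrightarrow> y \<in> ball q d \<longrightarrow>
      ennreal \<bar>f x - f y\<bar> \<le> eosc f (ball q d)"
    by (subst AE_ball_countable[OF I], unfold split_beta) (intro ballI eosc_AE f, simp)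
  then show ?thesis
  proof eventually_elim
    case (elim x)
    then have "AE y in lborel. \<forall>(q, d)\<in>I. x \<in> ball q d \<longrightarrow> y \<in> ball q d \<longrightarrow>
      ennreal \<bar>f x - f y\<bar> \<le> eosc f (ball q d)"
      by (subst AE_ball_countable[OF I]) auto
    then show ?case
    proof eventually_elim
      case (elim y)
      show ?case
      proof
        assume xy: "dist x y < r"
        \<comment> \<open>A quarter of the gap: the centre is off by less than \<eta> and the radius
          is below dist x y + 2 \<eta>, so the rational ball stays within dist x y + 3 \<eta> < r of
          x.\<close>
        define \<eta> where "\<eta> = (r - dist x y) / 4"
        have \<eta>: "\<eta> > 0" using xy by (simp add: \<eta>_def)
        obtain q where q: "q \<in> Q" "dist x q < \<eta>"
          using Q(2)[of "ball x \<eta>"] \<eta> by auto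
        obtain d where d: "d \<in> \<rat>" "dist x y + \<eta> < d" "d < dist x y + 2 * \<eta>"
          using Rats_dense_in_real[of "dist x y + \<eta>" "dist x y + 2 * \<eta>"] \<eta> by auto
        have "x \<in> ball q d" "y \<in> ball q d"
          using q d \<eta> dist_triangle[of q y x] zero_le_dist[of x y]
          by (simp_all add: dist_commute del: zero_le_dist)
        then have "ennreal \<bar>f x - f y\<bar> \<le> eosc f (ball q d)"
          using elim q(1) d(1) by (auto simp: I_def)
        also have "\<dots> \<le> eosc f (ball x r)"
        proof (intro eosc_mono f)
          show "ball q d \<subseteq> ball x r"
          proof
            fix w assume "w \<in> ball q d"
            then show "w \<in> ball x r"
              using q d xy dist_triangle[of x w q] by (auto simp: \<eta>_def field_simps)
          qed
        qed auto
        finally show "ennreal \<bar>f x - f y\<bar> \<le> eosc f (ball x r)" .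
      qed
    qed
  qed
qed

lemma AE_AE_abs_le_eosc_ball:
  fixes f :: "'a::euclidean_space \<Rightarrow> real"
  assumes f: "f \<in> borel_measurable borel"
  shows "AE x in lborel. AE y in lborel. dist x y < r \<longrightarrow> ennreal \<bar>f y\<bar> \<le> ennreal \<bar>f x\<bar> + eosc f (ball x r)"
  using AE_AE_le_eosc_ball[OF f, of r]
proof eventually_elim
  case (elim x)
  then show ?case
  proof eventually_elim
    case (elim y)
    have "ennreal \<bar>f y\<bar> \<le> ennreal \<bar>f x\<bar> + ennreal \<bar>f x - f y\<bar>"
      by (subst ennreal_plus[symmetric]) (auto simp del: ennreal_plus intro!: ennreal_leI)
    with elim show ?case
      by (auto intro: order_trans add_left_mono)
  qed
qed

section \<open>Translations and averages along a direction\<close>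

text \<open>With both points in one variable, a single use of Fubini exchanges them with a third
  variable, the shift.\<close>

lemma eosc_le_iff_pair:
  fixes f :: "'a::euclidean_space \<Rightarrow> real"
  assumes [measurable]: "f \<in> borel_measurable borel" "A \<in> sets borel"
  shows "eosc f A \<le> c \<longleftrightarrow> (AE p in lborel \<Otimes>\<^sub>M lborel. fst p \<in> A \<longrightarrow> snd p \<in> A \<longrightarrow> ennreal \<bar>f (fst p) - f (snd p)\<bar> \<le> c)"
proof -
  have S: "{z \<in> space (lborel \<Otimes>\<^sub>M lborel). fst z \<in> A \<longrightarrow> snd z \<in> A \<longrightarrow> ennreal \<bar>f (fst z) - f (snd z)\<bar> \<le> c}
      \<in> sets (lborel \<Otimes>\<^sub>M lborel)"
    by measurable
  show ?thesis
    unfolding eosc_le_iff[OF assms] lborel_pair.AE_pair_iff[OF S] ..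
qed

lemma nn_integral_lborel_shift:
  fixes f :: "'a::euclidean_space \<Rightarrow> ennreal"
  assumes [measurable]: "f \<in> borel_measurable borel"
  shows "(\<integral>\<^sup>+x. f (x + v) \<partial>lborel) = (\<integral>\<^sup>+x. f x \<partial>lborel)"
proof -
  have "(\<integral>\<^sup>+x. f x \<partial>lborel) = (\<integral>\<^sup>+x. f x \<partial>distr lborel borel ((+) v))"
    by (simp add: lborel_distr_plus)
  also have "\<dots> = (\<integral>\<^sup>+x. f (x + v) \<partial>lborel)"
    by (subst nn_integral_distr) (auto simp: add.commute)
  finally show ?thesis ..
qed

text \<open>Exchanging almost-everywhere quantifiers needs measurable predicates. A property is
  therefore replaced by the complement of a Borel null set on which alone it may fail.\<close>

lemma AE_lborelE:
  fixes P :: "'a::euclidean_space \<Rightarrow> bool"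
  assumes "AE x in lborel. P x"
  obtains N where "N \<in> sets borel" "AE x in lborel. x \<notin> N" "\<And>x. x \<notin> N \<Longrightarrow> P x"
proof -
  from assms obtain N where N: "{x \<in> space lborel. \<not> P x} \<subseteq> N" "emeasure lborel N = 0" "N \<in> sets lborel"
    by (rule AE_E)
  moreover from N have "AE x in lborel. x \<notin> N"
    by (intro AE_not_in) (auto simp: null_sets_def)
  ultimately show ?thesis
    using that[of N] by auto
qed

lemma AE_lborel_shift:
  fixes P :: "'a::euclidean_space \<Rightarrow> bool"
  assumes "AE x in lborel. P x"
  shows "AE x in lborel. P (x + v)"
proof -
  have "AE x in distr lborel borel ((+) v). P x"
    unfolding lborel_distr_plus by (rule assms)
  then have "AE x in lborel. P (v + x)"
    by (rule AE_distrD[rotated]) simp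
  then show ?thesis by (simp add: add.commute)
qed

text \<open>For each fixed t this is translation invariance, and Tonelli does the rest. It moves a
  shift from the argument of the function onto the cut-off, where it becomes a \<mu>-mass.\<close>

lemma nn_integral_shear:
  fixes K :: "'a::euclidean_space \<times> real \<Rightarrow> ennreal"
  assumes "sigma_finite_measure \<mu>" and [measurable_cong]: "sets \<mu> = sets borel"
    and [measurable]: "K \<in> borel_measurable (borel \<Otimes>\<^sub>M borel)"
  shows "(\<integral>\<^sup>+x. \<integral>\<^sup>+t. K (x, t) \<partial>\<mu> \<partial>lborel) = (\<integral>\<^sup>+x. \<integral>\<^sup>+t. K (x - t *\<^sub>R e, t) \<partial>\<mu> \<partial>lborel)"
proof -
  interpret sigma_finite_measure \<mu> by fact
  interpret pair_sigma_finite lborel \<mu> ..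
  have m: "(\<lambda>(x, t). K (x - t *\<^sub>R e, t)) \<in> borel_measurable (lborel \<Otimes>\<^sub>M \<mu>)"
    by measurable
  have mK: "K \<in> borel_measurable (lborel \<Otimes>\<^sub>M \<mu>)" by measurable
  have "(\<integral>\<^sup>+x. \<integral>\<^sup>+t. K (x, t) \<partial>\<mu> \<partial>lborel) = (\<integral>\<^sup>+t. \<integral>\<^sup>+x. K (x, t) \<partial>lborel \<partial>\<mu>)"
    by (rule Fubini[OF mK, symmetric])
  also have "\<dots> = (\<integral>\<^sup>+t. \<integral>\<^sup>+x. K (x - t *\<^sub>R e, t) \<partial>lborel \<partial>\<mu>)"
  proof (rule nn_integral_cong)
    fix t
    show "(\<integral>\<^sup>+x. K (x, t) \<partial>lborel) = (\<integral>\<^sup>+x. K (x - t *\<^sub>R e, t) \<partial>lborel)"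
      using nn_integral_lborel_shift[of "\<lambda>x. K (x, t)" "- (t *\<^sub>R e)"] by simp
  qed
  also have "\<dots> = (\<integral>\<^sup>+x. \<integral>\<^sup>+t. K (x - t *\<^sub>R e, t) \<partial>\<mu> \<partial>lborel)"
    using Fubini[OF m] by simp
  finally show ?thesis .
qed

section \<open>Averages over segments and folding onto a strip\<close>

lemma emeasure_two_slabs:
  fixes a b \<epsilon> :: real
  assumes "0 < \<epsilon>"
  shows "emeasure lborel {s. \<bar>\<bar>a - s\<bar> - b\<bar> < \<epsilon>} \<le> ennreal (4 * \<epsilon>)"
proof -
  have "emeasure lborel {s. \<bar>\<bar>a - s\<bar> - b\<bar> < \<epsilon>} \<le> emeasure lborel ({a - b - \<epsilon><..<a - b + \<epsilon>} \<union> {a + b - \<epsilon><..<a + b + \<epsilon>})"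
    by (intro emeasure_mono) (auto simp: abs_if split: if_splits)
  also have "\<dots> \<le> emeasure lborel {a - b - \<epsilon><..<a - b + \<epsilon>} + emeasure lborel {a + b - \<epsilon><..<a + b + \<epsilon>}"
    by (intro emeasure_subadditive) auto
  also have "\<dots> = ennreal (4 * \<epsilon>)"
    using assms by (simp add: ennreal_plus[symmetric] del: ennreal_plus)
  finally show ?thesis .
qed

text \<open>Every point z of the segment is within r + \<epsilon> of w, so |h w| is at most |h z|
  plus the oscillation around z. The left side does not depend on z, hence it is also at most the
  mean over the segment. This replaces a supremum by an integrable quantity.\<close>

lemma AE_abs_le_segment_average:
  fixes h :: "'a::euclidean_space \<Rightarrow> real"
  assumes [measurable]: "h \<in> borel_measurable borel" and e: "norm e = 1" and r: "0 < r"
  shows "AE x in lborel. AE w in lborel. dist x w < \<epsilon> \<longrightarrow> ennreal \<bar>h w\<bar> \<le>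
     (\<integral>\<^sup>+t. indicator {-r<..<r} t * (ennreal \<bar>h (x + t *\<^sub>R e)\<bar> + eosc h (ball (x + t *\<^sub>R e) (r + \<epsilon>))) \<partial>lborel) / ennreal (2 * r)"
proof -
  define G where "G z = ennreal \<bar>h z\<bar> + eosc h (ball z (r + \<epsilon>))" for z
  have [measurable]: "G \<in> borel_measurable borel"
    unfolding G_def by measurable
  have "AE z in lborel. AE w in lborel. dist z w < r + \<epsilon> \<longrightarrow> ennreal \<bar>h w\<bar> \<le> G z"
    unfolding G_def by (rule AE_AE_abs_le_eosc_ball) measurable
  then obtain N where N [measurable]: "N \<in> sets borel" and N_AE: "AE z in lborel. z \<notin> N" and
    NG: "\<And>z. z \<notin> N \<Longrightarrow> AE w in lborel. dist z w < r + \<epsilon> \<longrightarrow> ennreal \<bar>h w\<bar> \<le> G z"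
    by (rule AE_lborelE) blast
  \<comment> \<open>A segment may be a null set, so its points cannot be assumed good for a given x.
    Translating N by each fixed t and exchanging the quantifiers makes almost all of the segment
    good for almost every x.\<close>
  from N_AE have "AE t in lborel. AE x in lborel. x + t *\<^sub>R e \<notin> N"
    by (rule AE_I2[OF AE_lborel_shift])
  then have "AE x in lborel. AE t in lborel. x + t *\<^sub>R e \<notin> N"
    by (rule lborel_pair.AE_commute[THEN iffD2, rotated]) measurable
  then show ?thesis
  proof eventually_elim
    case (elim x)
    have "AE t in lborel. AE w in lborel. t \<in> {-r<..<r} \<longrightarrow> dist x w < \<epsilon> \<longrightarrow> ennreal \<bar>h w\<bar> \<le> G (x + t *\<^sub>R e)"
      using elim
    proof eventually_elim
      case (elim t)
      from NG[OF elim] show ?case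
      proof eventually_elim
        case (elim w)
        show ?case
        proof (intro impI)
          assume t: "t \<in> {-r<..<r}" and w: "dist x w < \<epsilon>"
          have "dist (x + t *\<^sub>R e) w \<le> dist (x + t *\<^sub>R e) x + dist x w"
            by (rule dist_triangle)
          also have "\<dots> < r + \<epsilon>"
            using t w e by (auto simp: dist_norm abs_if)
          finally show "ennreal \<bar>h w\<bar> \<le> G (x + t *\<^sub>R e)" using elim by simp
        qed
      qed
    qed
    then have "AE w in lborel. AE t in lborel. t \<in> {-r<..<r} \<longrightarrow> dist x w < \<epsilon> \<longrightarrow> ennreal \<bar>h w\<bar> \<le> G (x + t *\<^sub>R e)"
      by (rule lborel_pair.AE_commute[THEN iffD2, rotated]) measurable
    then show ?case
    proof eventually_elim
      case (elim w)
      show ?case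
      proof
        assume w: "dist x w < \<epsilon>"
        have "ennreal \<bar>h w\<bar> * ennreal (2 * r) = (\<integral>\<^sup>+t. indicator {-r<..<r} t * ennreal \<bar>h w\<bar> \<partial>lborel)"
          using r by (subst nn_integral_multc) (auto simp: mult.commute)
        also have "\<dots> \<le> (\<integral>\<^sup>+t. indicator {-r<..<r} t * G (x + t *\<^sub>R e) \<partial>lborel)"
          using elim w by (intro nn_integral_mono_AE) (auto elim!: eventually_mono simp: indicator_def)
        finally have "ennreal \<bar>h w\<bar> * ennreal (2 * r) / ennreal (2 * r) \<le> (\<integral>\<^sup>+t. indicator {-r<..<r} t * G (x + t *\<^sub>R e) \<partial>lborel) / ennreal (2 * r)"
          by (rule divide_right_mono_ennreal)
        then show "ennreal \<bar>h w\<bar> \<le> (\<integral>\<^sup>+t. indicator {-r<..<r} t *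
            (ennreal \<bar>h (x + t *\<^sub>R e)\<bar> + eosc h (ball (x + t *\<^sub>R e) (r + \<epsilon>))) \<partial>lborel) / ennreal (2 * r)"
          using r by (simp add: G_def ennreal_mult_divide_eq)
      qed
    qed
  qed
qed


text \<open>After the shear the inner integral is |h x| times the \<mu>-mass of the shifts that
  bring x into the strip, and that mass is at most one.\<close>

lemma
  fixes h :: "'a::euclidean_space \<Rightarrow> real"
  assumes "sigma_finite_measure \<mu>" and [measurable_cong]: "sets \<mu> = sets borel"
    and C: "\<And>a. emeasure \<mu> {t. \<bar>a - t\<bar> < b} \<le> 1" and e: "norm e = 1"
    and h: "integrable lborel h"
  shows nn_integral_fold_le: "(\<integral>\<^sup>+x. \<integral>\<^sup>+t. (if \<bar>x \<bullet> e\<bar> < b then ennreal \<bar>h (x + t *\<^sub>R e)\<bar> else 0) \<partial>\<mu> \<partial>lborel) \<le> (\<integral>\<^sup>+x. ennreal \<bar>h x\<bar> \<partial>lborel)"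
    and AE_integrable_fold: "AE x in lborel. \<bar>x \<bullet> e\<bar> < b \<longrightarrow> integrable \<mu> (\<lambda>t. h (x + t *\<^sub>R e))"
proof -
  interpret sigma_finite_measure \<mu> by fact
  interpret pair_sigma_finite lborel \<mu> ..
  have [measurable]: "h \<in> borel_measurable borel"
    using h by auto
  have ee: "e \<bullet> e = 1"
    using e by (simp add: dot_square_norm)
  have "(\<integral>\<^sup>+x. \<integral>\<^sup>+t. (if \<bar>x \<bullet> e\<bar> < b then ennreal \<bar>h (x + t *\<^sub>R e)\<bar> else 0) \<partial>\<mu> \<partial>lborel)
     = (\<integral>\<^sup>+x. \<integral>\<^sup>+t. (\<lambda>(x, t). if \<bar>x \<bullet> e\<bar> < b then ennreal \<bar>h (x + t *\<^sub>R e)\<bar> else 0) (x, t) \<partial>\<mu> \<partial>lborel)"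
    by simp
  also have "\<dots> = (\<integral>\<^sup>+x. \<integral>\<^sup>+t. (\<lambda>(x, t). if \<bar>x \<bullet> e\<bar> < b then ennreal \<bar>h (x + t *\<^sub>R e)\<bar> else 0) (x - t *\<^sub>R e, t) \<partial>\<mu> \<partial>lborel)"
    by (rule nn_integral_shear[OF assms(1,2)]) measurable
  also have "\<dots> = (\<integral>\<^sup>+x. ennreal \<bar>h x\<bar> * emeasure \<mu> {t. \<bar>x \<bullet> e - t\<bar> < b} \<partial>lborel)"
  proof (rule nn_integral_cong)
    fix x
    have "(\<integral>\<^sup>+t. (\<lambda>(x, t). if \<bar>x \<bullet> e\<bar> < b then ennreal \<bar>h (x + t *\<^sub>R e)\<bar> else 0) (x - t *\<^sub>R e, t) \<partial>\<mu>)
       = (\<integral>\<^sup>+t. ennreal \<bar>h x\<bar> * indicator {t. \<bar>x \<bullet> e - t\<bar> < b} t \<partial>\<mu>)"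
      by (intro nn_integral_cong) (simp add: inner_diff_left ee indicator_def)
    then show "(\<integral>\<^sup>+t. (\<lambda>(x, t). if \<bar>x \<bullet> e\<bar> < b then ennreal \<bar>h (x + t *\<^sub>R e)\<bar> else 0) (x - t *\<^sub>R e, t) \<partial>\<mu>)
       = ennreal \<bar>h x\<bar> * emeasure \<mu> {t. \<bar>x \<bullet> e - t\<bar> < b}"
      by (simp add: nn_integral_cmult_indicator)
  qed
  also have "\<dots> \<le> (\<integral>\<^sup>+x. ennreal \<bar>h x\<bar> \<partial>lborel)"
    using mult_left_mono[OF C] by (intro nn_integral_mono) fastforce
  finally show *: "(\<integral>\<^sup>+x. \<integral>\<^sup>+t. (if \<bar>x \<bullet> e\<bar> < b then ennreal \<bar>h (x + t *\<^sub>R e)\<bar> else 0) \<partial>\<mu> \<partial>lborel) \<le> (\<integral>\<^sup>+x. ennreal \<bar>h x\<bar> \<partial>lborel)" .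
  have fin: "(\<integral>\<^sup>+x. ennreal \<bar>h x\<bar> \<partial>lborel) < \<infinity>"
    using h by (simp add: integrable_iff_bounded)
  have "AE x in lborel. (\<integral>\<^sup>+t. (if \<bar>x \<bullet> e\<bar> < b then ennreal \<bar>h (x + t *\<^sub>R e)\<bar> else 0) \<partial>\<mu>) \<noteq> \<infinity>"
    by (rule nn_integral_PInf_AE) (use * fin in \<open>auto simp: top_unique\<close>)
  then show "AE x in lborel. \<bar>x \<bullet> e\<bar> < b \<longrightarrow> integrable \<mu> (\<lambda>t. h (x + t *\<^sub>R e))"
  proof eventually_elim
    case (elim x)
    then show ?case
      by (auto simp: integrable_iff_bounded less_top)
  qed
qed

text \<open>Where the integrand is not integrable, the Bochner integral is 0 by default.
  \<open>AE_integrable_fold\<close> confines this to a null set of the strip.\<close>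

definition fold_strip :: "real measure \<Rightarrow> real \<Rightarrow> 'a::euclidean_space \<Rightarrow> ('a \<Rightarrow> real) \<Rightarrow> 'a \<Rightarrow> real" where
  "fold_strip \<mu> b e h x = (if \<bar>x \<bullet> e\<bar> < b then (\<integral>t. h (x + t *\<^sub>R e) \<partial>\<mu>) else 0)"

lemma borel_measurable_fold_strip:
  fixes h :: "'a::euclidean_space \<Rightarrow> real"
  assumes "sigma_finite_measure \<mu>" and setsM[measurable_cong]: "sets \<mu> = sets borel"
    and [measurable]: "h \<in> borel_measurable borel"
  shows "fold_strip \<mu> b e h \<in> borel_measurable borel"
proof -
  interpret sigma_finite_measure \<mu> by fact
  show ?thesis
    unfolding fold_strip_def by measurable
qed

text \<open>Along e the points w and w' differ from x by less than \<epsilon>. Away from the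
  hyperplanes they therefore lie both inside or both outside the strip, and only near the
  hyperplanes must each value be bounded separately, which gives the factor 2.\<close>

lemma slab_osc_bound:
  fixes h :: "'a::euclidean_space \<Rightarrow> real" and x w w' e :: 'a
  assumes e: "norm e = 1" and w: "dist x w < \<epsilon>" and w': "dist x w' < \<epsilon>"
    and q: "\<And>v. q v = (if \<bar>v \<bullet> e\<bar> < b then h v else 0)"
    and B: "ennreal \<bar>h w - h w'\<bar> \<le> B" and A: "ennreal \<bar>h w\<bar> \<le> A" "ennreal \<bar>h w'\<bar> \<le> A"
  shows "ennreal \<bar>q w - q w'\<bar> \<le> (if \<bar>x \<bullet> e\<bar> < b then B else 0) + 2 * (if \<bar>\<bar>x \<bullet> e\<bar> - b\<bar> < \<epsilon> then A else 0)"
proof -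
  have near: "\<bar>x \<bullet> e - v \<bullet> e\<bar> < \<epsilon>" if "dist x v < \<epsilon>" for v
    using that Cauchy_Schwarz_ineq2[of "x - v" e] e by (simp add: inner_diff_left dist_norm)
  consider "\<bar>\<bar>x \<bullet> e\<bar> - b\<bar> < \<epsilon>" | "\<bar>x \<bullet> e\<bar> \<le> b - \<epsilon>" "0 < \<epsilon>" | "b + \<epsilon> \<le> \<bar>x \<bullet> e\<bar>"
    using near[OF w] by linarith
  then show ?thesis
  proof cases
    case 1
    have "ennreal \<bar>q w - q w'\<bar> \<le> ennreal \<bar>h w\<bar> + ennreal \<bar>h w'\<bar>"
      unfolding q by (subst ennreal_plus[symmetric]) (auto simp del: ennreal_plus intro!: ennreal_leI)
    also have "\<dots> \<le> A + A" using A by (rule add_mono)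
    also have "\<dots> = 2 * (if \<bar>\<bar>x \<bullet> e\<bar> - b\<bar> < \<epsilon> then A else 0)" using 1 by (simp add: mult_2)
    also have "\<dots> \<le> (if \<bar>x \<bullet> e\<bar> < b then B else 0) + \<dots>" by simp
    finally show ?thesis .
  next
    case 2
    then have "q w = h w" "q w' = h w'"
      using near[OF w] near[OF w'] unfolding q by auto
    moreover have "(if \<bar>x \<bullet> e\<bar> < b then B else 0) = B" using 2 by auto
    ultimately show ?thesis using B by (auto intro: order_trans)
  next
    case 3
    then have "q w = 0" "q w' = 0"
      using near[OF w] near[OF w'] unfolding q by auto
    then show ?thesis by simp
  qed
qed

text \<open>The last summand comes from balls meeting the two hyperplanes \<open>\<bar>x \<bullet> e\<bar> = b\<close>: the points \<open>t\<close> of a segment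
  \<open>x + t e\<close>, \<open>\<bar>t\<bar> < r\<close>, lying within \<open>\<epsilon>\<close> of some translate of them by \<open>\<mu>\<close> have average mass at most
  \<open>4 \<epsilon> / 2 r\<close>.\<close>

lemma fold_strip_eosc:
  fixes h :: "'a::euclidean_space \<Rightarrow> real"
  assumes sf: "sigma_finite_measure \<mu>" and setsM[measurable_cong]: "sets \<mu> = sets borel"
    and C: "\<And>a. emeasure \<mu> {t. \<bar>a - t\<bar> < b} \<le> 1" and e: "norm e = 1"
    and h: "integrable lborel h"
    and \<epsilon>: "0 < \<epsilon>" and r: "0 < r" "r \<le> b"
  shows "(\<integral>\<^sup>+x. eosc (fold_strip \<mu> b e h) (ball x \<epsilon>) \<partial>lborel) \<le>
    (\<integral>\<^sup>+x. eosc h (ball x \<epsilon>) \<partial>lborel) +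
    ennreal (4 * \<epsilon> / r) * (\<integral>\<^sup>+x. ennreal \<bar>h x\<bar> + eosc h (ball x (r + \<epsilon>)) \<partial>lborel)"
proof -
  interpret sigma_finite_measure \<mu> by fact
  interpret X: pair_sigma_finite lborel \<mu> ..
  interpret LL: sigma_finite_measure "lborel \<Otimes>\<^sub>M lborel :: ('a \<times> 'a) measure"
    by (rule sigma_finite_lborel_pair)
  interpret Y: pair_sigma_finite \<mu> "lborel \<Otimes>\<^sub>M lborel :: ('a \<times> 'a) measure" ..
  have [measurable]: "h \<in> borel_measurable borel"
    using h by auto
  have ee: "e \<bullet> e = 1"
    using e by (simp add: dot_square_norm)
  define G where "G z = ennreal \<bar>h z\<bar> + eosc h (ball z (r + \<epsilon>))" for z
  have G[measurable]: "G \<in> borel_measurable borel"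
    unfolding G_def by measurable
  \<comment> \<open>The segment average that bounds |h| on the \<epsilon>-ball around x.\<close>
  define A where "A x = (\<integral>\<^sup>+t. indicator {-r<..<r} t * G (x + t *\<^sub>R e) \<partial>lborel) / ennreal (2 * r)" for x
  have A[measurable]: "A \<in> borel_measurable borel"
    unfolding A_def by measurable
  define Ob where "Ob z = eosc h (ball z \<epsilon>)" for z
  have Ob[measurable]: "Ob \<in> borel_measurable borel"
    unfolding Ob_def by measurable
  define g where "g = fold_strip \<mu> b e h"
  have g[measurable]: "g \<in> borel_measurable borel"
    unfolding g_def by (rule borel_measurable_fold_strip[OF sf setsM]) measurable
  define q where "q t w = (if \<bar>w \<bullet> e\<bar> < b then h (w + t *\<^sub>R e) else 0)" for t w
  have q[measurable]: "(\<lambda>p. q (fst p) (snd p)) \<in> borel_measurable (borel \<Otimes>\<^sub>M borel)"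
    unfolding q_def by measurable
  \<comment> \<open>Bound on the oscillation over the \<epsilon>-ball around x of the contribution
    \<open>q t\<close> of one shift t. The oscillation of the fold is at most its
    \<mu>-integral.\<close>
  define bd where "bd x t = (if \<bar>x \<bullet> e\<bar> < b then Ob (x + t *\<^sub>R e) else 0)
      + 2 * (if \<bar>\<bar>x \<bullet> e\<bar> - b\<bar> < \<epsilon> then A (x + t *\<^sub>R e) else 0)" for x t
  have bd[measurable]: "(\<lambda>p. bd (fst p) (snd p)) \<in> borel_measurable (borel \<Otimes>\<^sub>M borel)"
    unfolding bd_def by measurable

  have intq: "AE w in lborel. integrable \<mu> (\<lambda>t. q t w)"
    using AE_integrable_fold[OF sf setsM C e h]
  proof eventually_elim
    case (elim w)
    then show ?case by (cases "\<bar>w \<bullet> e\<bar> < b") (auto simp: q_def)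
  qed
  have g_eq: "g w = (\<integral>t. q t w \<partial>\<mu>)" for w
    by (simp add: g_def fold_strip_def q_def)

  have "AE x in lborel. AE w in lborel. dist x w < \<epsilon> \<longrightarrow> ennreal \<bar>h w\<bar> \<le> A x"
    unfolding A_def G_def by (rule AE_abs_le_segment_average[OF _ e r(1)]) measurable
  then obtain N where N[measurable]: "N \<in> sets borel" and N_AE: "AE z in lborel. z \<notin> N" and
    NA: "\<And>z. z \<notin> N \<Longrightarrow> AE w in lborel. dist z w < \<epsilon> \<longrightarrow> ennreal \<bar>h w\<bar> \<le> A z"
    by (rule AE_lborelE) blast
  have "AE t in \<mu>. AE x in lborel. x + t *\<^sub>R e \<notin> N"
    by (rule AE_I2[OF AE_lborel_shift[OF N_AE]])
  then have "AE x in lborel. AE t in \<mu>. x + t *\<^sub>R e \<notin> N"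
    by (rule X.AE_commute[THEN iffD2, rotated]) measurable
  then have osc_le: "AE x in lborel. eosc g (ball x \<epsilon>) \<le> (\<integral>\<^sup>+t. bd x t \<partial>\<mu>)"
  proof eventually_elim
    case (elim x)
    have "AE t in \<mu>. AE p in lborel \<Otimes>\<^sub>M lborel. dist x (fst p) < \<epsilon> \<longrightarrow> dist x (snd p) < \<epsilon> \<longrightarrow>
        ennreal \<bar>q t (fst p) - q t (snd p)\<bar> \<le> bd x t"
      using elim
    proof eventually_elim
      case (elim t)
      let ?z = "x + t *\<^sub>R e"
      have 1: "AE w in lborel. dist x w < \<epsilon> \<longrightarrow> ennreal \<bar>h (w + t *\<^sub>R e)\<bar> \<le> A ?z"
        using AE_lborel_shift[OF NA[OF elim], of "t *\<^sub>R e"] by simp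
      have "AE w in lborel. AE w' in lborel. w \<in> ball ?z \<epsilon> \<longrightarrow> w' \<in> ball ?z \<epsilon> \<longrightarrow> ennreal \<bar>h w - h w'\<bar> \<le> Ob ?z"
        unfolding Ob_def by (rule eosc_AE) auto
      then have "AE w in lborel. AE w' in lborel. w \<in> ball ?z \<epsilon> \<longrightarrow> w' + t *\<^sub>R e \<in> ball ?z \<epsilon> \<longrightarrow> ennreal \<bar>h w - h (w' + t *\<^sub>R e)\<bar> \<le> Ob ?z"
        by eventually_elim (rule AE_lborel_shift)
      from AE_lborel_shift[OF this, of "t *\<^sub>R e"] have 2: "AE w in lborel. AE w' in lborel. dist x w < \<epsilon> \<longrightarrow> dist x w' < \<epsilon> \<longrightarrow>
          ennreal \<bar>h (w + t *\<^sub>R e) - h (w' + t *\<^sub>R e)\<bar> \<le> Ob ?z"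
        by simp
      have "AE w in lborel. AE w' in lborel. dist x w < \<epsilon> \<longrightarrow> dist x w' < \<epsilon> \<longrightarrow>
        ennreal \<bar>q t w - q t w'\<bar> \<le> bd x t"
        using 1 2
      proof eventually_elim
        case (elim w)
        from 1 elim(2) show ?case
        proof eventually_elim
          case (elim w')
          show ?case
            unfolding bd_def
            by (intro impI slab_osc_bound[where h = "\<lambda>w. h (w + t *\<^sub>R e)"])
              (use e elim \<open>dist x w < \<epsilon> \<longrightarrow> ennreal \<bar>h (w + t *\<^sub>R e)\<bar> \<le> A ?z\<close> in \<open>auto simp: q_def\<close>)
        qed
      qed
      moreover have "{p \<in> space (lborel \<Otimes>\<^sub>M lborel). dist x (fst p) < \<epsilon> \<longrightarrow> dist x (snd p) < \<epsilon> \<longrightarrow>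
        ennreal \<bar>q t (fst p) - q t (snd p)\<bar> \<le> bd x t} \<in> sets (lborel \<Otimes>\<^sub>M lborel)"
        unfolding q_def by measurable
      ultimately show ?case
        by (rule lborel_pair.AE_pair_iff[THEN iffD1, rotated])
    qed
    \<comment> \<open>To integrate the bound over t, the exceptional set of pairs must not depend on
      t, so the quantifiers are exchanged.\<close>
    then have "AE p in lborel \<Otimes>\<^sub>M lborel. AE t in \<mu>. dist x (fst p) < \<epsilon> \<longrightarrow> dist x (snd p) < \<epsilon> \<longrightarrow>
        ennreal \<bar>q t (fst p) - q t (snd p)\<bar> \<le> bd x t"
    proof (rule Y.AE_commute[THEN iffD1, rotated])
      have [measurable]: "(\<lambda>z. q (fst z) (fst (snd z))) \<in> borel_measurable (\<mu> \<Otimes>\<^sub>M (lborel \<Otimes>\<^sub>M lborel))"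
        unfolding q_def by measurable
      have [measurable]: "(\<lambda>z. q (fst z) (snd (snd z))) \<in> borel_measurable (\<mu> \<Otimes>\<^sub>M (lborel \<Otimes>\<^sub>M lborel))"
        unfolding q_def by measurable
      have [measurable]: "bd x \<in> borel_measurable \<mu>"
        unfolding bd_def by measurable
      show "{z \<in> space (\<mu> \<Otimes>\<^sub>M (lborel \<Otimes>\<^sub>M lborel)). dist x (fst (snd z)) < \<epsilon> \<longrightarrow> dist x (snd (snd z)) < \<epsilon> \<longrightarrow>
        ennreal \<bar>q (fst z) (fst (snd z)) - q (fst z) (snd (snd z))\<bar> \<le> bd x (fst z)} \<in> sets (\<mu> \<Otimes>\<^sub>M (lborel \<Otimes>\<^sub>M lborel))"
        by measurable
    qed
    moreover have "AE p in lborel \<Otimes>\<^sub>M lborel. integrable \<mu> (\<lambda>t. q t (fst p)) \<and> integrable \<mu> (\<lambda>t. q t (snd p))"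
    proof -
      have "AE w in lborel. AE w' in lborel. integrable \<mu> (\<lambda>t. q t w) \<and> integrable \<mu> (\<lambda>t. q t w')"
        using intq by eventually_elim (use intq in \<open>auto elim: eventually_mono\<close>)
      moreover have "{p \<in> space (lborel \<Otimes>\<^sub>M lborel). integrable \<mu> (\<lambda>t. q t (fst p)) \<and> integrable \<mu> (\<lambda>t. q t (snd p))} \<in> sets (lborel \<Otimes>\<^sub>M lborel)"
        unfolding q_def by measurable
      ultimately show ?thesis
        by (rule lborel_pair.AE_pair_iff[THEN iffD1, rotated])
    qed
    ultimately have "AE p in lborel \<Otimes>\<^sub>M lborel. dist x (fst p) < \<epsilon> \<longrightarrow> dist x (snd p) < \<epsilon> \<longrightarrow>
        ennreal \<bar>g (fst p) - g (snd p)\<bar> \<le> (\<integral>\<^sup>+t. bd x t \<partial>\<mu>)"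
    proof eventually_elim
      case (elim p)
      show ?case
      proof (intro impI)
        assume p: "dist x (fst p) < \<epsilon>" "dist x (snd p) < \<epsilon>"
        have "g (fst p) - g (snd p) = (\<integral>t. q t (fst p) - q t (snd p) \<partial>\<mu>)"
          using elim by (simp add: g_eq)
        then have "ennreal \<bar>g (fst p) - g (snd p)\<bar> \<le> (\<integral>\<^sup>+t. ennreal \<bar>q t (fst p) - q t (snd p)\<bar> \<partial>\<mu>)"
          using integral_norm_bound_ennreal[of \<mu> "\<lambda>t. q t (fst p) - q t (snd p)"] elim by simp
        also have "\<dots> \<le> (\<integral>\<^sup>+t. bd x t \<partial>\<mu>)"
          using elim p by (intro nn_integral_mono_AE) auto
        finally show "ennreal \<bar>g (fst p) - g (snd p)\<bar> \<le> (\<integral>\<^sup>+t. bd x t \<partial>\<mu>)" .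
      qed
    qed
    then show ?case
      by (subst eosc_le_iff_pair) auto
  qed

  \<comment> \<open>Mass of the shifts that bring z within \<epsilon> of one of the two hyperplanes.
    It has no useful pointwise bound, since \<mu> may be concentrated; only its averages along e are
    small.\<close>
  define lam where "lam z = emeasure \<mu> {t. \<bar>\<bar>z \<bullet> e - t\<bar> - b\<bar> < \<epsilon>}" for z
  have lam_eq: "lam z = (\<integral>\<^sup>+t. indicator {p. \<bar>\<bar>fst p \<bullet> e - snd p\<bar> - b\<bar> < \<epsilon>} (z, t) \<partial>\<mu>)" for z
  proof -
    have "lam z = (\<integral>\<^sup>+t. indicator {t. \<bar>\<bar>z \<bullet> e - t\<bar> - b\<bar> < \<epsilon>} t \<partial>\<mu>)"
      unfolding lam_def by (rule nn_integral_indicator[symmetric]) measurable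
    then show ?thesis by (simp add: indicator_def)
  qed
  have [measurable]: "{p :: 'a \<times> real. \<bar>\<bar>fst p \<bullet> e - snd p\<bar> - b\<bar> < \<epsilon>} \<in> sets (borel \<Otimes>\<^sub>M borel)"
  proof -
    have "{p :: 'a \<times> real. \<bar>\<bar>fst p \<bullet> e - snd p\<bar> - b\<bar> < \<epsilon>} = {p \<in> space (borel \<Otimes>\<^sub>M borel). \<bar>\<bar>fst p \<bullet> e - snd p\<bar> - b\<bar> < \<epsilon>}"
      by (auto simp: space_pair_measure)
    also have "\<dots> \<in> sets (borel \<Otimes>\<^sub>M borel)" by measurable
    finally show ?thesis .
  qed
  have lam[measurable]: "lam \<in> borel_measurable borel"
    unfolding lam_eq[abs_def] by measurable

  have "(\<integral>\<^sup>+x. \<integral>\<^sup>+t. bd x t \<partial>\<mu> \<partial>lborel) = (\<integral>\<^sup>+x. \<integral>\<^sup>+t. (\<lambda>p. bd (fst p) (snd p)) (x, t) \<partial>\<mu> \<partial>lborel)"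
    by simp
  also have "\<dots> = (\<integral>\<^sup>+x. \<integral>\<^sup>+t. (\<lambda>p. bd (fst p) (snd p)) (x - t *\<^sub>R e, t) \<partial>\<mu> \<partial>lborel)"
    by (rule nn_integral_shear[OF sf setsM]) measurable
  also have "\<dots> = (\<integral>\<^sup>+x. Ob x * emeasure \<mu> {t. \<bar>x \<bullet> e - t\<bar> < b} + 2 * (A x * lam x) \<partial>lborel)"
  proof (rule nn_integral_cong)
    fix x
    have "(\<integral>\<^sup>+t. (\<lambda>p. bd (fst p) (snd p)) (x - t *\<^sub>R e, t) \<partial>\<mu>) =
       (\<integral>\<^sup>+t. Ob x * indicator {t. \<bar>x \<bullet> e - t\<bar> < b} t + 2 * (A x * indicator {t. \<bar>\<bar>x \<bullet> e - t\<bar> - b\<bar> < \<epsilon>} t) \<partial>\<mu>)"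
      by (intro nn_integral_cong) (simp add: bd_def inner_diff_left ee indicator_def)
    also have "\<dots> = Ob x * emeasure \<mu> {t. \<bar>x \<bullet> e - t\<bar> < b} + 2 * (A x * lam x)"
      by (simp add: nn_integral_add nn_integral_cmult nn_integral_cmult_indicator lam_def)
    finally show "(\<integral>\<^sup>+t. (\<lambda>p. bd (fst p) (snd p)) (x - t *\<^sub>R e, t) \<partial>\<mu>) = \<dots>" .
  qed
  also have "\<dots> \<le> (\<integral>\<^sup>+x. Ob x + 2 * (A x * lam x) \<partial>lborel)"
    using mult_left_mono[OF C] by (intro nn_integral_mono add_mono) fastforce+
  also have "\<dots> = (\<integral>\<^sup>+x. Ob x \<partial>lborel) + 2 * (\<integral>\<^sup>+x. A x * lam x \<partial>lborel)"
    by (simp add: nn_integral_add nn_integral_cmult)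
  finally have bd_int: "(\<integral>\<^sup>+x. \<integral>\<^sup>+t. bd x t \<partial>\<mu> \<partial>lborel) \<le> (\<integral>\<^sup>+x. Ob x \<partial>lborel) + 2 * (\<integral>\<^sup>+x. A x * lam x \<partial>lborel)" .

  \<comment> \<open>The shear exchanges the roles of the two measures: Lebesgue measure now sees the
    two slabs, of total length 4 \<epsilon>, and \<mu> sees an interval of half-width r, of mass at
    most one because r is at most b.\<close>
  have lam_avg: "(\<integral>\<^sup>+t. indicator {-r<..<r} t * lam (x - t *\<^sub>R e) \<partial>lborel) \<le> ennreal (4 * \<epsilon>)" for x
  proof -
    let ?I = "\<lambda>s. indicator {s. \<bar>\<bar>x \<bullet> e - s\<bar> - b\<bar> < \<epsilon>} s :: ennreal"
    interpret Z: pair_sigma_finite "lborel :: real measure" \<mu> ..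
    have "(\<integral>\<^sup>+t. indicator {-r<..<r} t * lam (x - t *\<^sub>R e) \<partial>lborel)
        = (\<integral>\<^sup>+s. \<integral>\<^sup>+t. (\<lambda>(s, t). indicator {-r<..<r} s * ?I (s + t)) (s, t) \<partial>\<mu> \<partial>lborel)"
    proof (rule nn_integral_cong)
      fix s
      have "indicator {-r<..<r} s * lam (x - s *\<^sub>R e) = (\<integral>\<^sup>+t. indicator {-r<..<r} s * indicator {p. \<bar>\<bar>fst p \<bullet> e - snd p\<bar> - b\<bar> < \<epsilon>} (x - s *\<^sub>R e, t) \<partial>\<mu>)"
        unfolding lam_eq by (rule nn_integral_cmult[symmetric]) measurable
      also have "\<dots> = (\<integral>\<^sup>+t. (\<lambda>(s, t). indicator {-r<..<r} s * ?I (s + t)) (s, t) \<partial>\<mu>)"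
        by (intro nn_integral_cong) (simp add: indicator_def inner_diff_left ee algebra_simps)
      finally show "indicator {-r<..<r} s * lam (x - s *\<^sub>R e) = \<dots>" .
    qed
    also have "\<dots> = (\<integral>\<^sup>+s. \<integral>\<^sup>+t. (\<lambda>(s, t). indicator {-r<..<r} s * ?I (s + t)) (s - t *\<^sub>R 1, t) \<partial>\<mu> \<partial>lborel)"
      by (rule nn_integral_shear[OF sf setsM]) measurable
    also have "\<dots> = (\<integral>\<^sup>+s. ?I s * emeasure \<mu> {t. \<bar>s - t\<bar> < r} \<partial>lborel)"
    proof (rule nn_integral_cong)
      fix s
      have "(\<integral>\<^sup>+t. (\<lambda>(s, t). indicator {-r<..<r} s * ?I (s + t)) (s - t *\<^sub>R 1, t) \<partial>\<mu>) = (\<integral>\<^sup>+t. ?I s * indicator {t. \<bar>s - t\<bar> < r} t \<partial>\<mu>)"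
        by (intro nn_integral_cong) (auto simp: indicator_def)
      then show "(\<integral>\<^sup>+t. (\<lambda>(s, t). indicator {-r<..<r} s * ?I (s + t)) (s - t *\<^sub>R 1, t) \<partial>\<mu>) = ?I s * emeasure \<mu> {t. \<bar>s - t\<bar> < r}"
        by (simp add: nn_integral_cmult_indicator)
    qed
    also have "\<dots> \<le> (\<integral>\<^sup>+s. ?I s \<partial>lborel)"
    proof (rule nn_integral_mono)
      fix s
      have "emeasure \<mu> {t. \<bar>s - t\<bar> < r} \<le> emeasure \<mu> {t. \<bar>s - t\<bar> < b}"
        using r by (intro emeasure_mono) auto
      also have "\<dots> \<le> 1" by (rule C)
      finally show "?I s * emeasure \<mu> {t. \<bar>s - t\<bar> < r} \<le> ?I s"
        using mult_left_mono[of _ 1 "?I s"] by simp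
    qed
    also have "\<dots> \<le> ennreal (4 * \<epsilon>)"
      using emeasure_two_slabs[OF \<epsilon>] by simp
    finally show ?thesis .
  qed

  \<comment> \<open>Multiplying by 2 r clears the denominator of \<open>A\<close>. Dividing by r
    alone then keeps the factor 2 that counts both points of a pair, which leaves 4 \<epsilon> /
    r.\<close>
  have scale: "I * ennreal c / ennreal r = ennreal (c / r) * I" if "0 \<le> c" for c I
  proof -
    have "ennreal (c / r) * I = I * (ennreal c / ennreal r)"
      using that r by (simp add: divide_ennreal mult.commute)
    then show ?thesis by (simp add: ennreal_times_divide)
  qed
  have "(\<integral>\<^sup>+x. A x * lam x \<partial>lborel) * ennreal (2 * r) = (\<integral>\<^sup>+x. A x * lam x * ennreal (2 * r) \<partial>lborel)"
    by (rule nn_integral_multc[symmetric]) measurable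
  also have "\<dots> = (\<integral>\<^sup>+x. \<integral>\<^sup>+t. (\<lambda>(x, t). indicator {-r<..<r} t * G (x + t *\<^sub>R e) * lam x) (x, t) \<partial>lborel \<partial>lborel)"
  proof (rule nn_integral_cong)
    fix x
    have "A x * ennreal (2 * r) = (\<integral>\<^sup>+t. indicator {-r<..<r} t * G (x + t *\<^sub>R e) \<partial>lborel)"
      unfolding A_def using r by (simp add: ennreal_divide_times ennreal_divide_self)
    then have "A x * lam x * ennreal (2 * r) = (\<integral>\<^sup>+t. indicator {-r<..<r} t * G (x + t *\<^sub>R e) \<partial>lborel) * lam x"
      by (metis mult.assoc mult.commute)
    also have "\<dots> = (\<integral>\<^sup>+t. indicator {-r<..<r} t * G (x + t *\<^sub>R e) * lam x \<partial>lborel)"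
      by (rule nn_integral_multc[symmetric]) measurable
    finally show "A x * lam x * ennreal (2 * r) = (\<integral>\<^sup>+t. (\<lambda>(x, t). indicator {-r<..<r} t * G (x + t *\<^sub>R e) * lam x) (x, t) \<partial>lborel)"
      by simp
  qed
  also have "\<dots> = (\<integral>\<^sup>+x. \<integral>\<^sup>+t. (\<lambda>(x, t). indicator {-r<..<r} t * G (x + t *\<^sub>R e) * lam x) (x - t *\<^sub>R e, t) \<partial>lborel \<partial>lborel)"
    by (rule nn_integral_shear[OF lborel.sigma_finite_measure_axioms sets_lborel]) measurable
  also have "\<dots> = (\<integral>\<^sup>+x. G x * (\<integral>\<^sup>+t. indicator {-r<..<r} t * lam (x - t *\<^sub>R e) \<partial>lborel) \<partial>lborel)"
    by (intro nn_integral_cong, subst nn_integral_cmult[symmetric]) (auto simp: mult_ac)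
  also have "\<dots> \<le> (\<integral>\<^sup>+x. G x * ennreal (4 * \<epsilon>) \<partial>lborel)"
    by (intro nn_integral_mono mult_left_mono lam_avg) auto
  also have "\<dots> = (\<integral>\<^sup>+x. G x \<partial>lborel) * ennreal (4 * \<epsilon>)"
    by (rule nn_integral_multc) measurable
  finally have "(\<integral>\<^sup>+x. A x * lam x \<partial>lborel) * ennreal (2 * r) / ennreal r \<le> (\<integral>\<^sup>+x. G x \<partial>lborel) * ennreal (4 * \<epsilon>) / ennreal r"
    by (rule divide_right_mono_ennreal)
  moreover have "(\<integral>\<^sup>+x. A x * lam x \<partial>lborel) * ennreal (2 * r) / ennreal r = 2 * (\<integral>\<^sup>+x. A x * lam x \<partial>lborel)"
    using scale[of "2 * r"] r by simp
  moreover have "(\<integral>\<^sup>+x. G x \<partial>lborel) * ennreal (4 * \<epsilon>) / ennreal r = ennreal (4 * \<epsilon> / r) * (\<integral>\<^sup>+x. G x \<partial>lborel)"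
    using scale[of "4 * \<epsilon>"] \<epsilon> by simp
  ultimately have "2 * (\<integral>\<^sup>+x. A x * lam x \<partial>lborel) \<le> ennreal (4 * \<epsilon> / r) * (\<integral>\<^sup>+x. G x \<partial>lborel)"
    by simp
  then have "(\<integral>\<^sup>+x. Ob x \<partial>lborel) + 2 * (\<integral>\<^sup>+x. A x * lam x \<partial>lborel)
      \<le> (\<integral>\<^sup>+x. Ob x \<partial>lborel) + ennreal (4 * \<epsilon> / r) * (\<integral>\<^sup>+x. G x \<partial>lborel)"
    by (rule add_left_mono)
  with bd_int have "(\<integral>\<^sup>+x. \<integral>\<^sup>+t. bd x t \<partial>\<mu> \<partial>lborel) \<le> \<dots>"
    by (rule order_trans)
  moreover have "(\<integral>\<^sup>+x. eosc g (ball x \<epsilon>) \<partial>lborel) \<le> (\<integral>\<^sup>+x. \<integral>\<^sup>+t. bd x t \<partial>\<mu> \<partial>lborel)"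
    by (rule nn_integral_mono_AE[OF osc_le])
  ultimately show ?thesis
    unfolding g_def Ob_def G_def by (rule order_trans[rotated])
qed

section \<open>Transfer of densities by an expanding map\<close>

text \<open>J plays the role of the absolute Jacobian of F. It is tied to F only through the
  integral formula \<open>cv\<close>, so no derivative of F occurs here.\<close>

locale expanding_chart =
  fixes K :: "'a::euclidean_space set" and F :: "'a \<Rightarrow> 'a" and J :: "'a \<Rightarrow> real" and s M c :: real
  assumes K_borel [measurable]: "K \<in> sets borel" and FK_borel [measurable]: "F ` K \<in> sets borel"
    and s_pos: "0 < s" and M_nonneg: "0 \<le> M" and c_pos: "0 < c"
    and expand: "\<And>u v. u \<in> K \<Longrightarrow> v \<in> K \<Longrightarrow> dist u v \<le> s * dist (F u) (F v)"
    and J_ge: "\<And>y. y \<in> K \<Longrightarrow> c \<le> J y"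
    and J_lip: "\<And>u v. u \<in> K \<Longrightarrow> v \<in> K \<Longrightarrow> \<bar>J u - J v\<bar> \<le> M * dist u v"
    and cv: "\<And>\<phi>. \<phi> \<in> borel_measurable borel \<Longrightarrow>
       (\<integral>\<^sup>+z. \<phi> z * indicator (F ` K) z \<partial>lborel) = (\<integral>\<^sup>+y. \<phi> (F y) * ennreal (J y) * indicator K y \<partial>lborel)"
begin

text \<open>The value 0 off the image is a default that makes G a Borel function on the whole
  space.\<close>

definition G where "G z = (if z \<in> F ` K then the_inv_into K F z else 0)"

text \<open>The density of the image under F of the signed measure with density f on K.\<close>

definition transfer :: "('a \<Rightarrow> real) \<Rightarrow> 'a \<Rightarrow> real" where
  "transfer f z = (if z \<in> F ` K then f (G z) / J (G z) else 0)"

lemma inj: "inj_on F K"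
proof (rule inj_onI)
  fix u v assume "u \<in> K" "v \<in> K" "F u = F v"
  then show "u = v" using expand[of u v] by simp
qed

lemma G_F [simp]: "y \<in> K \<Longrightarrow> G (F y) = y"
  by (simp add: G_def the_inv_into_f_f inj)

lemma F_G: "z \<in> F ` K \<Longrightarrow> F (G z) = z"
  by auto

lemma G_in: "z \<in> F ` K \<Longrightarrow> G z \<in> K"
  by auto

lemma J_pos: "y \<in> K \<Longrightarrow> 0 < J y"
  using J_ge c_pos by fastforce

text \<open>Read backwards, \<open>expand\<close> says that G is s-Lipschitz on the image of
  K.\<close>

lemma G_measurable [measurable]: "G \<in> borel_measurable borel"
proof -
  have "s-lipschitz_on (F ` K) G"
    using expand s_pos by (intro lipschitz_onI) (auto simp: mult.commute)
  then have "continuous_on (F ` K) G"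
    by (rule lipschitz_on_continuous_on)
  then have "(\<lambda>z. if z \<in> F ` K then G z else 0) \<in> borel_measurable borel"
    by (intro borel_measurable_continuous_on_if) auto
  also have "(\<lambda>z. if z \<in> F ` K then G z else 0) = G"
    by (auto simp: G_def)
  finally show ?thesis .
qed

lemma J_measurable [measurable]: "(\<lambda>y. if y \<in> K then J y else 1) \<in> borel_measurable borel"
proof -
  have "M-lipschitz_on K J"
    using J_lip M_nonneg by (intro lipschitz_onI) (auto simp: dist_real_def)
  then have "continuous_on K J"
    by (rule lipschitz_on_continuous_on)
  then show ?thesis
    by (intro borel_measurable_continuous_on_if) auto
qed

lemma transfer_measurable [measurable]:
  assumes [measurable]: "f \<in> borel_measurable borel"
  shows "transfer f \<in> borel_measurable borel"
proof -
  have "transfer f = (\<lambda>z. if z \<in> F ` K then f (G z) / (\<lambda>y. if y \<in> K then J y else 1) (G z) else 0)"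
    by (auto simp: transfer_def fun_eq_iff)
  also have "\<dots> \<in> borel_measurable borel"
    by measurable
  finally show ?thesis .
qed

text \<open>F maps null subsets of K to null sets: in \<open>cv\<close>, the indicator of such a set
  already vanishes almost everywhere on the side of K, whatever J is.\<close>

lemma AE_chart:
  assumes "AE y in lborel. Q y"
  shows "AE z in lborel. z \<in> F ` K \<longrightarrow> Q (G z)"
proof -
  obtain N where N[measurable]: "N \<in> sets borel" and N_AE: "AE y in lborel. y \<notin> N" and Q: "\<And>y. y \<notin> N \<Longrightarrow> Q y"
    using assms by (rule AE_lborelE) blast
  have "(\<integral>\<^sup>+z. indicator N (G z) * indicator (F ` K) z \<partial>lborel)
     = (\<integral>\<^sup>+y. indicator N (G (F y)) * ennreal (J y) * indicator K y \<partial>lborel)"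
    by (rule cv) measurable
  also have "\<dots> = (\<integral>\<^sup>+y. 0 \<partial>(lborel :: 'a measure))"
    using N_AE by (intro nn_integral_cong_AE) (auto elim!: eventually_mono simp: indicator_def)
  finally have "AE z in lborel. indicator N (G z) * indicator (F ` K) z = (0::ennreal)"
    by (intro nn_integral_0_iff_AE[THEN iffD1]) simp_all
  then show ?thesis
    by eventually_elim (use Q in \<open>auto simp: indicator_def split: if_splits\<close>)
qed

text \<open>\<open>ennreal\<close> clips negative values, and dividing by J > 0 preserves signs. The
  identity thus concerns positive parts, and applying it to -f as well yields the signed version
  \<open>integral_transfer\<close>.\<close>

lemma nn_integral_transfer:
  assumes [measurable]: "f \<in> borel_measurable borel" "B \<in> sets borel"
  shows "(\<integral>\<^sup>+z. ennreal (transfer f z * indicator B z) \<partial>lborel) = (\<integral>\<^sup>+y. ennreal (f y * indicator B (F y) * indicator K y) \<partial>lborel)"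
proof -
  have "(\<integral>\<^sup>+z. ennreal (transfer f z * indicator B z) \<partial>lborel) = (\<integral>\<^sup>+z. ennreal (transfer f z * indicator B z) * indicator (F ` K) z \<partial>lborel)"
    by (intro nn_integral_cong) (auto simp: transfer_def indicator_def)
  also have "\<dots> = (\<integral>\<^sup>+y. ennreal (transfer f (F y) * indicator B (F y)) * ennreal (J y) * indicator K y \<partial>lborel)"
    by (rule cv) measurable
  also have "\<dots> = (\<integral>\<^sup>+y. ennreal (f y * indicator B (F y) * indicator K y) \<partial>lborel)"
  proof (rule nn_integral_cong)
    fix y
    show "ennreal (transfer f (F y) * indicator B (F y)) * ennreal (J y) * indicator K y = ennreal (f y * indicator B (F y) * indicator K y)"
      using J_pos[of y] ennreal_mult''[of "J y" "f y / J y"] by (auto simp: transfer_def indicator_def)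
  qed
  finally show ?thesis .
qed

lemma transfer_abs: "\<bar>transfer f z\<bar> = transfer (\<lambda>y. \<bar>f y\<bar>) z"
  using J_pos[of "G z"] G_in[of z] by (auto simp: transfer_def abs_of_pos)

lemma nn_integral_abs_transfer:
  assumes [measurable]: "f \<in> borel_measurable borel"
  shows "(\<integral>\<^sup>+z. ennreal \<bar>transfer f z\<bar> \<partial>lborel) \<le> (\<integral>\<^sup>+y. ennreal \<bar>f y\<bar> \<partial>lborel)"
proof -
  have "(\<integral>\<^sup>+z. ennreal \<bar>transfer f z\<bar> \<partial>lborel) = (\<integral>\<^sup>+y. ennreal (\<bar>f y\<bar> * indicator UNIV (F y) * indicator K y) \<partial>lborel)"
    unfolding transfer_abs by (subst nn_integral_transfer[symmetric]) auto
  also have "\<dots> \<le> (\<integral>\<^sup>+y. ennreal \<bar>f y\<bar> \<partial>lborel)"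
    by (intro nn_integral_mono ennreal_leI) (auto simp: indicator_def)
  finally show ?thesis .
qed

lemma integrable_transfer:
  assumes "integrable lborel f"
  shows "integrable lborel (transfer f)"
proof -
  have [measurable]: "f \<in> borel_measurable borel" using assms by auto
  show ?thesis
    using nn_integral_abs_transfer[of f] assms
    by (auto simp: integrable_iff_bounded intro: le_less_trans)
qed

text \<open>The locale records no measurability of F, hence the assumption on the composed
  integrand.\<close>

lemma integral_transfer:
  assumes f: "integrable lborel f" and [measurable]: "B \<in> sets borel"
    and m: "(\<lambda>y. f y * indicator B (F y) * indicator K y) \<in> borel_measurable borel"
  shows "(\<integral>z. transfer f z * indicator B z \<partial>lborel) = (\<integral>y. f y * indicator B (F y) * indicator K y \<partial>lborel)"
proof -
  have [measurable]: "f \<in> borel_measurable borel" using f by auto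
  have 1: "integrable lborel (\<lambda>z. transfer f z * indicator B z)"
    using integrable_transfer[OF f] by (intro integrable_real_mult_indicator) auto
  have 2: "integrable lborel (\<lambda>y. f y * indicator B (F y) * indicator K y)"
    by (rule Bochner_Integration.integrable_bound[OF f]) (use m in \<open>auto simp: indicator_def\<close>)
  have neg: "- (transfer f z * indicator B z) = transfer (\<lambda>y. - f y) z * indicator B z" for z
    by (simp add: transfer_def)
  have "(\<integral>\<^sup>+z. ennreal (- (transfer f z * indicator B z)) \<partial>lborel) = (\<integral>\<^sup>+y. ennreal (- (f y * indicator B (F y) * indicator K y)) \<partial>lborel)"
    unfolding neg by (subst nn_integral_transfer) auto
  moreover have "(\<integral>\<^sup>+z. ennreal (transfer f z * indicator B z) \<partial>lborel) = (\<integral>\<^sup>+y. ennreal (f y * indicator B (F y) * indicator K y) \<partial>lborel)"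
    by (rule nn_integral_transfer) auto
  ultimately show ?thesis
    by (simp add: real_lebesgue_integral_def[OF 1] real_lebesgue_integral_def[OF 2])
qed

text \<open>Split the difference as (a - b) / J y1 + b (1 / J y1 - 1 / J y2). Both quotients are
  compared with 1 / J y, so that the Jacobian at the centre can be cancelled later; going through y
  twice gives the 2.\<close>

lemma distortion:
  assumes y: "y \<in> K" and y1: "y1 \<in> K" "dist y y1 \<le> d" and y2: "y2 \<in> K" "dist y y2 \<le> d"
  shows "\<bar>a / J y1 - b / J y2\<bar> \<le> (1 + M / c * d) / J y * \<bar>a - b\<bar> + 2 * (M / c * d) / J y * \<bar>b\<bar>"
proof -
  have *: "\<bar>1 / J v - 1 / J y\<bar> \<le> M / c * d / J y" if "v \<in> K" "dist y v \<le> d" for v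
  proof -
    have "\<bar>1 / J v - 1 / J y\<bar> = \<bar>J y - J v\<bar> / (J v * J y)"
      using J_pos[OF y] J_pos[OF that(1)] by (simp add: field_simps abs_mult)
    also have "\<dots> \<le> (M * d) / (c * J y)"
    proof (rule frac_le)
      show "\<bar>J y - J v\<bar> \<le> M * d"
        using J_lip[OF y that(1)] mult_left_mono[OF that(2) M_nonneg] by linarith
      show "c * J y \<le> J v * J y"
        using J_ge[OF that(1)] J_pos[OF y] by simp
      show "0 < c * J y" using c_pos J_pos[OF y] by simp
      show "0 \<le> M * d" using M_nonneg that zero_le_dist[of y v] by (simp del: zero_le_dist)
    qed
    also have "\<dots> = M / c * d / J y" by simp
    finally show ?thesis .
  qed
  have "a / J y1 - b / J y2 = (a - b) / J y1 + b * (1 / J y1 - 1 / J y2)"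
    by (simp add: diff_divide_distrib algebra_simps)
  then have "\<bar>a / J y1 - b / J y2\<bar> \<le> \<bar>(a - b) / J y1\<bar> + \<bar>b * (1 / J y1 - 1 / J y2)\<bar>"
    by linarith
  also have "\<bar>(a - b) / J y1\<bar> \<le> (1 + M / c * d) / J y * \<bar>a - b\<bar>"
  proof -
    have "1 / J y1 \<le> (1 + M / c * d) / J y"
      using *[OF y1] by (simp add: add_divide_distrib)
    then show ?thesis
      using mult_right_mono[of "1 / J y1" "(1 + M / c * d) / J y" "\<bar>a - b\<bar>"] J_pos[OF y1(1)]
      by (simp add: abs_of_pos)
  qed
  also have "\<bar>b * (1 / J y1 - 1 / J y2)\<bar> \<le> 2 * (M / c * d) / J y * \<bar>b\<bar>"
  proof -
    have "\<bar>1 / J y1 - 1 / J y2\<bar> \<le> 2 * (M / c * d) / J y"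
      using *[OF y1] *[OF y2] by linarith
    then show ?thesis
      using mult_left_mono[of "\<bar>1 / J y1 - 1 / J y2\<bar>" "2 * (M / c * d) / J y" "\<bar>b\<bar>"]
      by (simp add: abs_mult mult.commute)
  qed
  finally show ?thesis by simp
qed

text \<open>G maps the \<epsilon>-ball around F y into the ball of radius s \<epsilon> around y, and
  the Jacobian from \<open>cv\<close> cancels the 1 / J y of the density. By \<open>near\<close>, a
  ball either lies in the image of K or misses the image of the support, so the edge of the chart
  never contributes.\<close>

lemma transfer_eosc:
  assumes [measurable]: "f \<in> borel_measurable borel" and \<Omega>: "\<Omega> \<subseteq> K" and f0: "\<And>y. y \<notin> \<Omega> \<Longrightarrow> f y = 0"
    and \<epsilon>: "0 < \<epsilon>"
    and near: "\<And>x. ball x \<epsilon> \<inter> F ` \<Omega> \<noteq> {} \<Longrightarrow> ball x \<epsilon> \<subseteq> F ` K"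
  shows "(\<integral>\<^sup>+x. eosc (transfer f) (ball x \<epsilon>) \<partial>lborel) \<le>
    ennreal (1 + 3 * (M / c * (s * \<epsilon>))) * (\<integral>\<^sup>+y. eosc f (ball y (s * \<epsilon>)) \<partial>lborel)
    + ennreal (2 * (M / c * (s * \<epsilon>))) * (\<integral>\<^sup>+y. ennreal \<bar>f y\<bar> \<partial>lborel)"
proof -
  define \<kappa> where "\<kappa> = M / c * (s * \<epsilon>)"
  have \<kappa>: "0 \<le> \<kappa>" using M_nonneg c_pos s_pos \<epsilon> by (simp add: \<kappa>_def)
  define Of where "Of y = eosc f (ball y (s * \<epsilon>))" for y
  have [measurable]: "Of \<in> borel_measurable borel" unfolding Of_def by measurable
  define R where "R y = ennreal (1 + 3 * \<kappa>) * Of y + ennreal (2 * \<kappa>) * ennreal \<bar>f y\<bar>" for y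
  have zero: "eosc (transfer f) (ball x \<epsilon>) = 0" if "ball x \<epsilon> \<inter> F ` \<Omega> = {}" for x
  proof -
    have "transfer f z = 0" if "z \<in> ball x \<epsilon>" for z
    proof (cases "z \<in> F ` K")
      case True
      then have "G z \<notin> \<Omega>" using that \<open>ball x \<epsilon> \<inter> F ` \<Omega> = {}\<close> F_G[of z] by auto
      then show ?thesis by (simp add: transfer_def f0)
    qed (simp add: transfer_def)
    then have "eosc (transfer f) (ball x \<epsilon>) \<le> 0"
      by (subst eosc_le_iff) auto
    then show ?thesis by simp
  qed
  have main: "eosc (transfer f) (ball (F y) \<epsilon>) * ennreal (J y) \<le> R y"
    if y: "y \<in> K" and fy: "AE y' in lborel. dist y y' < s * \<epsilon> \<longrightarrow> ennreal \<bar>f y'\<bar> \<le> ennreal \<bar>f y\<bar> + Of y" for y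
  proof (cases "ball (F y) \<epsilon> \<inter> F ` \<Omega> = {}")
    case True
    then show ?thesis by (simp add: zero)
  next
    case False
    then have sub: "ball (F y) \<epsilon> \<subseteq> F ` K" by (rule near)
    define B where "B = ennreal (1 / J y) * R y"
    have G_near: "G z \<in> K" "dist y (G z) < s * \<epsilon>" if "z \<in> ball (F y) \<epsilon>" for z
    proof -
      show "G z \<in> K" using that sub G_in by blast
      have "dist y (G z) \<le> s * dist (F y) (F (G z))"
        using that sub G_in by (intro expand y) blast
      also have "\<dots> < s * \<epsilon>"
        using that sub F_G[of z] s_pos by auto
      finally show "dist y (G z) < s * \<epsilon>" .
    qed
    have "AE y1 in lborel. AE y2 in lborel. y1 \<in> ball y (s * \<epsilon>) \<longrightarrow> y2 \<in> ball y (s * \<epsilon>) \<longrightarrow> ennreal \<bar>f y1 - f y2\<bar> \<le> Of y"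
      unfolding Of_def by (rule eosc_AE) auto
    then have "AE z in lborel. z \<in> F ` K \<longrightarrow> (AE y2 in lborel. G z \<in> ball y (s * \<epsilon>) \<longrightarrow> y2 \<in> ball y (s * \<epsilon>) \<longrightarrow> ennreal \<bar>f (G z) - f y2\<bar> \<le> Of y)"
      by (rule AE_chart)
    then have "AE z in lborel. AE z' in lborel. z \<in> ball (F y) \<epsilon> \<longrightarrow> z' \<in> ball (F y) \<epsilon> \<longrightarrow> ennreal \<bar>transfer f z - transfer f z'\<bar> \<le> B"
    proof eventually_elim
      case (elim z)
      show ?case
      proof (cases "z \<in> ball (F y) \<epsilon>")
        case True
        then have zK: "z \<in> F ` K" using sub by blast
        have "AE z' in lborel. z' \<in> F ` K \<longrightarrow> (G z \<in> ball y (s * \<epsilon>) \<longrightarrow> G z' \<in> ball y (s * \<epsilon>) \<longrightarrow> ennreal \<bar>f (G z) - f (G z')\<bar> \<le> Of y)"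
          using elim zK by (intro AE_chart) auto
        moreover have "AE z' in lborel. z' \<in> F ` K \<longrightarrow> (dist y (G z') < s * \<epsilon> \<longrightarrow> ennreal \<bar>f (G z')\<bar> \<le> ennreal \<bar>f y\<bar> + Of y)"
          by (rule AE_chart[OF fy])
        ultimately show ?thesis
        proof eventually_elim
          case (elim z')
          show ?case
          proof (intro impI)
            assume z': "z' \<in> ball (F y) \<epsilon>"
            then have z'K: "z' \<in> F ` K" using sub by blast
            note n1 = G_near[OF True] and n2 = G_near[OF z']
            have Jy: "0 < J y" by (rule J_pos[OF y])
            have 1: "ennreal \<bar>f (G z) - f (G z')\<bar> \<le> Of y" using elim(1) z'K n1 n2 by simp
            have 2: "ennreal \<bar>f (G z')\<bar> \<le> ennreal \<bar>f y\<bar> + Of y" using elim(2) z'K n2 by simp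
            have "\<bar>transfer f z - transfer f z'\<bar> \<le> (1 + \<kappa>) / J y * \<bar>f (G z) - f (G z')\<bar> + 2 * \<kappa> / J y * \<bar>f (G z')\<bar>"
              using distortion[OF y n1(1) less_imp_le[OF n1(2)] n2(1) less_imp_le[OF n2(2)]] zK z'K
              by (simp add: transfer_def \<kappa>_def)
            then have "ennreal \<bar>transfer f z - transfer f z'\<bar> \<le> ennreal ((1 + \<kappa>) / J y * \<bar>f (G z) - f (G z')\<bar> + 2 * \<kappa> / J y * \<bar>f (G z')\<bar>)"
              by (rule ennreal_leI)
            also have "\<dots> = ennreal ((1 + \<kappa>) / J y) * ennreal \<bar>f (G z) - f (G z')\<bar> + ennreal (2 * \<kappa> / J y) * ennreal \<bar>f (G z')\<bar>"
              using \<kappa> Jy by (subst ennreal_plus) (simp_all add: ennreal_mult'' del: times_divide_eq_left)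
            \<comment> \<open>The value at G z' is traded for the value at the centre plus an
              oscillation, which makes the bound a function of y alone and turns 1 + \<kappa> into 1
              + 3 \<kappa>.\<close>
            also have "\<dots> \<le> ennreal ((1 + \<kappa>) / J y) * Of y + ennreal (2 * \<kappa> / J y) * (ennreal \<bar>f y\<bar> + Of y)"
              using 1 2 by (intro add_mono mult_left_mono) auto
            also have "\<dots> = (ennreal ((1 + \<kappa>) / J y) + ennreal (2 * \<kappa> / J y)) * Of y + ennreal (2 * \<kappa> / J y) * ennreal \<bar>f y\<bar>"
              by (simp add: algebra_simps)
            also have "ennreal ((1 + \<kappa>) / J y) + ennreal (2 * \<kappa> / J y) = ennreal (1 / J y) * ennreal (1 + 3 * \<kappa>)"
              using \<kappa> Jy by (simp add: ennreal_mult'[symmetric] ennreal_plus[symmetric] add_divide_distrib[symmetric] del: ennreal_plus)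
            also have "ennreal (2 * \<kappa> / J y) = ennreal (1 / J y) * ennreal (2 * \<kappa>)"
              using \<kappa> Jy by (simp add: ennreal_mult'[symmetric])
            finally show "ennreal \<bar>transfer f z - transfer f z'\<bar> \<le> B"
              by (simp add: B_def R_def algebra_simps)
          qed
        qed
      qed simp
    qed
    then have "eosc (transfer f) (ball (F y) \<epsilon>) \<le> B"
      by (subst eosc_le_iff) auto
    then have "eosc (transfer f) (ball (F y) \<epsilon>) * ennreal (J y) \<le> B * ennreal (J y)"
      by (rule mult_right_mono) simp
    also have "\<dots> = (ennreal (1 / J y) * ennreal (J y)) * R y"
      by (simp add: B_def mult_ac)
    also have "ennreal (1 / J y) * ennreal (J y) = 1"
      using J_pos[OF y] by (simp add: ennreal_mult'[symmetric])
    finally show ?thesis by simp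
  qed
  have "(\<integral>\<^sup>+x. eosc (transfer f) (ball x \<epsilon>) \<partial>lborel) = (\<integral>\<^sup>+x. eosc (transfer f) (ball x \<epsilon>) * indicator (F ` K) x \<partial>lborel)"
  proof (rule nn_integral_cong)
    fix x
    show "eosc (transfer f) (ball x \<epsilon>) = eosc (transfer f) (ball x \<epsilon>) * indicator (F ` K) x"
    proof (cases "x \<in> F ` K")
      case False
      \<comment> \<open>A ball contains its centre, so a ball centred off the image of K is not
        contained in that image, and \<open>near\<close> forces it to miss the support.\<close>
      then have "ball x \<epsilon> \<inter> F ` \<Omega> = {}"
        using near[of x] centre_in_ball[of x \<epsilon>] \<epsilon> by blast
      then show ?thesis by (simp add: zero)
    qed simp
  qed
  also have "\<dots> = (\<integral>\<^sup>+y. eosc (transfer f) (ball (F y) \<epsilon>) * ennreal (J y) * indicator K y \<partial>lborel)"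
    by (rule cv) measurable
  also have "\<dots> \<le> (\<integral>\<^sup>+y. R y \<partial>lborel)"
  proof (rule nn_integral_mono_AE)
    have "AE y in lborel. AE y' in lborel. dist y y' < s * \<epsilon> \<longrightarrow> ennreal \<bar>f y'\<bar> \<le> ennreal \<bar>f y\<bar> + Of y"
      unfolding Of_def by (rule AE_AE_abs_le_eosc_ball) auto
    then show "AE y in lborel. eosc (transfer f) (ball (F y) \<epsilon>) * ennreal (J y) * indicator K y \<le> R y"
    proof eventually_elim
      case (elim y)
      then show ?case using main[of y] by (cases "y \<in> K") auto
    qed
  qed
  also have "\<dots> = ennreal (1 + 3 * \<kappa>) * (\<integral>\<^sup>+y. Of y \<partial>lborel) + ennreal (2 * \<kappa>) * (\<integral>\<^sup>+y. ennreal \<bar>f y\<bar> \<partial>lborel)"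
    unfolding R_def by (simp add: nn_integral_add nn_integral_cmult)
  finally show ?thesis
    unfolding Of_def \<kappa>_def .
qed

end

section \<open>Change of variables along fibres\<close>

lemma nn_integral_substitution_pos:
  fixes f :: "real \<Rightarrow> ennreal" and g :: "real \<Rightarrow> real"
  assumes f: "f \<in> borel_measurable borel" and ab: "a < b"
    and g: "\<And>x. x \<in> {a..b} \<Longrightarrow> (g has_real_derivative g' x) (at x)"
    and g': "continuous_on {a..b} g'" and pos: "\<And>x. x \<in> {a..b} \<Longrightarrow> 0 < g' x"
  shows "(\<integral>\<^sup>+x. f x * indicator (g ` {a..b}) x \<partial>lborel) = (\<integral>\<^sup>+x. f (g x) * ennreal \<bar>g' x\<bar> * indicator {a..b} x \<partial>lborel)"
proof -
  have cont: "continuous_on {a..b} g"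
    using g by (rule has_real_derivative_imp_continuous_on)
  have mono: "g x \<le> g y" if "x \<in> {a..b}" "y \<in> {a..b}" "x \<le> y" for x y
  proof (rule DERIV_nonneg_imp_nondecreasing[OF that(3)])
    fix t assume "x \<le> t" "t \<le> y"
    then have "t \<in> {a..b}" using that by auto
    then show "\<exists>d. (g has_real_derivative d) (at t) \<and> 0 \<le> d"
      using g pos by (blast intro: less_imp_le)
  qed
  have img: "g ` {a..b} = {g a..g b}"
  proof
    show "g ` {a..b} \<subseteq> {g a..g b}" using mono ab by auto
    show "{g a..g b} \<subseteq> g ` {a..b}"
    proof
      fix y assume "y \<in> {g a..g b}"
      then show "y \<in> g ` {a..b}" using IVT'[of g a y b] cont ab by auto
    qed
  qed
  have "(\<integral>\<^sup>+x. f x * indicator (g ` {a..b}) x \<partial>lborel) = (\<integral>\<^sup>+x. f (g x) * ennreal (g' x) * indicator {a..b} x \<partial>lborel)"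
    unfolding img by (rule nn_integral_substitution_aux) (use assms in \<open>auto intro: less_imp_le\<close>)
  also have "\<dots> = (\<integral>\<^sup>+x. f (g x) * ennreal \<bar>g' x\<bar> * indicator {a..b} x \<partial>lborel)"
    using pos by (intro nn_integral_cong) (auto simp: indicator_def abs_of_pos)
  finally show ?thesis .
qed

text \<open>A continuous derivative without zeros has constant sign on an interval. The decreasing
  case is the increasing one for -g after a reflection.\<close>

lemma nn_integral_substitution_nonzero:
  fixes f :: "real \<Rightarrow> ennreal" and g :: "real \<Rightarrow> real"
  assumes f[measurable]: "f \<in> borel_measurable borel" and ab: "a < b"
    and g: "\<And>x. x \<in> {a..b} \<Longrightarrow> (g has_real_derivative g' x) (at x)"
    and g': "continuous_on {a..b} g'" and nz: "\<And>x. x \<in> {a..b} \<Longrightarrow> g' x \<noteq> 0"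
  shows "(\<integral>\<^sup>+x. f x * indicator (g ` {a..b}) x \<partial>lborel) = (\<integral>\<^sup>+x. f (g x) * ennreal \<bar>g' x\<bar> * indicator {a..b} x \<partial>lborel)"
proof -
  have conn: "connected (g' ` {a..b})"
    using g' by (rule connected_continuous_image) simp
  consider "\<And>x. x \<in> {a..b} \<Longrightarrow> 0 < g' x" | "\<And>x. x \<in> {a..b} \<Longrightarrow> g' x < 0"
  proof (cases "0 < g' a")
    case True
    have "0 < g' x" if "x \<in> {a..b}" for x
      using connectedD_interval[OF conn, of "g' x" "g' a" 0] that nz True ab
      by (smt (verit) atLeastAtMost_iff image_iff)
    then show ?thesis using that by blast
  next
    case False
    have "g' x < 0" if "x \<in> {a..b}" for x
      using connectedD_interval[OF conn, of "g' a" "g' x" 0] that nz False ab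
      by (smt (verit) atLeastAtMost_iff image_iff)
    then show ?thesis using that by blast
  qed
  then show ?thesis
  proof cases
    case 1
    show ?thesis by (rule nn_integral_substitution_pos) (use assms 1 in auto)
  next
    case 2
    have [measurable]: "g ` {a..b} \<in> sets borel"
      by (intro borel_compact compact_continuous_image has_real_derivative_imp_continuous_on[OF g]) auto
    have "(\<integral>\<^sup>+x. f x * indicator (g ` {a..b}) x \<partial>lborel) = (\<integral>\<^sup>+x. f (- x) * indicator (g ` {a..b}) (- x) \<partial>lborel)"
      using nn_integral_real_affine[of "\<lambda>x. f x * indicator (g ` {a..b}) x" "-1" 0] by simp
    also have "\<dots> = (\<integral>\<^sup>+x. f (- x) * indicator ((\<lambda>x. - g x) ` {a..b}) x \<partial>lborel)"
    proof -
      have "- x \<in> g ` {a..b} \<longleftrightarrow> x \<in> (\<lambda>x. - g x) ` {a..b}" for x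
        by (auto simp: image_iff) (metis add.inverse_inverse atLeastAtMost_iff)+
      then show ?thesis by (simp add: indicator_def)
    qed
    also have "\<dots> = (\<integral>\<^sup>+x. f (- (- g x)) * ennreal \<bar>- g' x\<bar> * indicator {a..b} x \<partial>lborel)"
      by (rule nn_integral_substitution_pos[where g'="\<lambda>x. - g' x"])
         (use ab g g' 2 in \<open>auto intro!: DERIV_minus continuous_on_minus\<close>)
    finally show ?thesis by simp
  qed
qed

text \<open>Fubini along lines parallel to e without splitting the space as a product: the slab 0 <
  u \<bullet> e < 1 has thickness one, so after a shear every point is counted with weight
  one.\<close>

lemma nn_integral_fibres:
  fixes Q :: "'a::euclidean_space \<Rightarrow> ennreal"
  assumes [measurable]: "Q \<in> borel_measurable borel" and e: "norm e = 1"
  shows "(\<integral>\<^sup>+u. Q u \<partial>lborel) = (\<integral>\<^sup>+u. indicator {u. 0 < u \<bullet> e \<and> u \<bullet> e < 1} u * (\<integral>\<^sup>+t. Q (u + t *\<^sub>R e) \<partial>lborel) \<partial>lborel)"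
proof -
  have ee: "e \<bullet> e = 1" using e by (simp add: dot_square_norm)
  let ?I = "indicator {u. 0 < u \<bullet> e \<and> u \<bullet> e < 1} :: 'a \<Rightarrow> ennreal"
  have "(\<integral>\<^sup>+u. ?I u * (\<integral>\<^sup>+t. Q (u + t *\<^sub>R e) \<partial>lborel) \<partial>lborel) = (\<integral>\<^sup>+u. \<integral>\<^sup>+t. (\<lambda>(u, t). ?I u * Q (u + t *\<^sub>R e)) (u, t) \<partial>lborel \<partial>lborel)"
    by (simp add: nn_integral_cmult)
  also have "\<dots> = (\<integral>\<^sup>+u. \<integral>\<^sup>+t. (\<lambda>(u, t). ?I u * Q (u + t *\<^sub>R e)) (u - t *\<^sub>R e, t) \<partial>lborel \<partial>lborel)"
    by (rule nn_integral_shear[OF lborel.sigma_finite_measure_axioms sets_lborel]) measurable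
  also have "\<dots> = (\<integral>\<^sup>+u. Q u \<partial>lborel)"
  proof (rule nn_integral_cong)
    fix u
    have "(\<integral>\<^sup>+t. (\<lambda>(u, t). ?I u * Q (u + t *\<^sub>R e)) (u - t *\<^sub>R e, t) \<partial>lborel) = (\<integral>\<^sup>+t. Q u * indicator {u \<bullet> e - 1<..<u \<bullet> e} t \<partial>lborel)"
      by (intro nn_integral_cong) (auto simp: inner_diff_left ee indicator_def)
    then show "(\<integral>\<^sup>+t. (\<lambda>(u, t). ?I u * Q (u + t *\<^sub>R e)) (u - t *\<^sub>R e, t) \<partial>lborel) = Q u"
      by (simp add: nn_integral_cmult_indicator)
  qed
  finally show ?thesis ..
qed

text \<open>S replaces the component along e by \<psi>, so it maps every line parallel to e into
  itself. One-dimensional substitution on each line, where K leaves a nondegenerate interval, gives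
  the whole formula.\<close>

lemma nn_integral_graph_shear:
  fixes K :: "'a::euclidean_space set" and \<psi> p :: "'a \<Rightarrow> real" and e :: 'a
  defines "S \<equiv> \<lambda>u. u + (\<psi> u - u \<bullet> e) *\<^sub>R e"
  assumes e: "norm e = 1" and K: "compact K"
    and fibre: "\<And>u. u \<in> K \<Longrightarrow> \<exists>a b. a < b \<and> {t. u + t *\<^sub>R e \<in> K} = {a..b}"
    and \<psi>: "continuous_on K \<psi>" and p: "continuous_on K p" and nz: "\<And>u. u \<in> K \<Longrightarrow> p u \<noteq> 0"
    and der: "\<And>u. u \<in> K \<Longrightarrow> ((\<lambda>t. \<psi> (u + t *\<^sub>R e)) has_real_derivative p u) (at 0)"
    and [measurable]: "\<phi> \<in> borel_measurable borel"
  shows "(\<integral>\<^sup>+v. \<phi> v * indicator (S ` K) v \<partial>lborel) = (\<integral>\<^sup>+u. \<phi> (S u) * ennreal \<bar>p u\<bar> * indicator K u \<partial>lborel)"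
proof -
  have ee: "e \<bullet> e = 1" using e by (simp add: dot_square_norm)
  have KB[measurable]: "K \<in> sets borel" using K by (rule borel_compact)
  have Scont: "continuous_on K S"
    unfolding S_def by (intro continuous_intros \<psi>)
  have [measurable]: "S ` K \<in> sets borel"
    by (intro borel_compact compact_continuous_image Scont K)
  have [measurable]: "(\<lambda>u. if u \<in> K then S u else 0) \<in> borel_measurable borel"
    by (intro borel_measurable_continuous_on_if Scont) auto
  have [measurable]: "(\<lambda>u. if u \<in> K then p u else 0) \<in> borel_measurable borel"
    by (intro borel_measurable_continuous_on_if p) auto
  have meas: "(\<lambda>u. \<phi> (S u) * ennreal \<bar>p u\<bar> * indicator K u) \<in> borel_measurable borel"
  proof -
    have "(\<lambda>u. \<phi> ((\<lambda>u. if u \<in> K then S u else 0) u) * ennreal \<bar>(\<lambda>u. if u \<in> K then p u else 0) u\<bar> * indicator K u) \<in> borel_measurable borel"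
      by measurable
    also have "(\<lambda>u. \<phi> ((\<lambda>u. if u \<in> K then S u else 0) u) * ennreal \<bar>(\<lambda>u. if u \<in> K then p u else 0) u\<bar> * indicator K u)
       = (\<lambda>u. \<phi> (S u) * ennreal \<bar>p u\<bar> * indicator K u)"
      by (auto simp: fun_eq_iff indicator_def)
    finally show ?thesis .
  qed
  have fib: "(\<integral>\<^sup>+t. \<phi> (u + t *\<^sub>R e) * indicator (S ` K) (u + t *\<^sub>R e) \<partial>lborel)
     = (\<integral>\<^sup>+t. \<phi> (S (u + t *\<^sub>R e)) * ennreal \<bar>p (u + t *\<^sub>R e)\<bar> * indicator K (u + t *\<^sub>R e) \<partial>lborel)" for u
  proof -
    define g where "g t = \<psi> (u + t *\<^sub>R e) - u \<bullet> e" for t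
    have Sg: "S (u + t *\<^sub>R e) = u + g t *\<^sub>R e" for t
      by (simp add: S_def g_def inner_add_left ee algebra_simps)
    \<comment> \<open>A point of the line that is hit by S comes from the same line, so the image of
      K meets the line exactly in the image of the one-dimensional map g.\<close>
    have inS: "u + t *\<^sub>R e \<in> S ` K \<longleftrightarrow> t \<in> g ` {t. u + t *\<^sub>R e \<in> K}" for t
    proof
      assume "u + t *\<^sub>R e \<in> S ` K"
      then obtain w where w: "w \<in> K" "u + t *\<^sub>R e = S w" by auto
      then have "w = u + (t - (\<psi> w - w \<bullet> e)) *\<^sub>R e"
        by (simp add: S_def algebra_simps)
      then obtain t' where t': "w = u + t' *\<^sub>R e" by blast
      have "u + t *\<^sub>R e = u + g t' *\<^sub>R e" using w t' Sg by simp
      then have "t = g t'" using e by auto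
      then show "t \<in> g ` {t. u + t *\<^sub>R e \<in> K}" using w t' by auto
    next
      assume "t \<in> g ` {t. u + t *\<^sub>R e \<in> K}"
      then show "u + t *\<^sub>R e \<in> S ` K" by (auto simp: Sg[symmetric])
    qed
    show ?thesis
    proof (cases "{t. u + t *\<^sub>R e \<in> K} = {}")
      case True
      then show ?thesis using inS by simp
    next
      case False
      then obtain t0 where t0: "u + t0 *\<^sub>R e \<in> K" by auto
      obtain a0 b0 where ab0: "a0 < b0" "{t. u + t0 *\<^sub>R e + t *\<^sub>R e \<in> K} = {a0..b0}"
        using fibre[OF t0] by blast
      define a b where "a = a0 + t0" and "b = b0 + t0"
      have ab: "a < b" using ab0 by (simp add: a_def b_def)
      have inK: "u + t *\<^sub>R e \<in> K \<longleftrightarrow> t \<in> {a..b}" for t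
      proof -
        have "u + t *\<^sub>R e = u + t0 *\<^sub>R e + (t - t0) *\<^sub>R e" by (simp add: algebra_simps)
        then have "u + t *\<^sub>R e \<in> K \<longleftrightarrow> t - t0 \<in> {a0..b0}"
          by (subst ab0(2)[symmetric]) (simp only: mem_Collect_eq)
        then show ?thesis by (auto simp: a_def b_def)
      qed
      have m\<phi>: "(\<lambda>t. \<phi> (u + t *\<^sub>R e)) \<in> borel_measurable borel" by measurable
      have "(\<integral>\<^sup>+t. \<phi> (u + t *\<^sub>R e) * indicator (g ` {a..b}) t \<partial>lborel)
        = (\<integral>\<^sup>+t. \<phi> (u + g t *\<^sub>R e) * ennreal \<bar>p (u + t *\<^sub>R e)\<bar> * indicator {a..b} t \<partial>lborel)"
      proof (rule nn_integral_substitution_nonzero[where f="\<lambda>t. \<phi> (u + t *\<^sub>R e)" and g=g and g'="\<lambda>t. p (u + t *\<^sub>R e)", OF m\<phi> ab])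
        show "(g has_real_derivative p (u + x *\<^sub>R e)) (at x)" if "x \<in> {a..b}" for x
        proof -
          have "((\<lambda>t. \<psi> (u + x *\<^sub>R e + t *\<^sub>R e)) has_real_derivative p (u + x *\<^sub>R e)) (at 0)"
            using that by (intro der) (simp only: inK)
          then have "((\<lambda>t. \<psi> (u + (x + t) *\<^sub>R e)) has_real_derivative p (u + x *\<^sub>R e)) (at 0)"
            by (simp add: scaleR_add_left add.assoc)
          then have "((\<lambda>t. \<psi> (u + t *\<^sub>R e)) has_real_derivative p (u + x *\<^sub>R e)) (at x)"
            using DERIV_shift[of "\<lambda>t. \<psi> (u + t *\<^sub>R e)" "p (u + x *\<^sub>R e)" 0 x]
            by (simp add: add.commute)
          then show ?thesis
            unfolding g_def by (auto intro!: derivative_eq_intros)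
        qed
        show "continuous_on {a..b} (\<lambda>t. p (u + t *\<^sub>R e))"
          by (rule continuous_on_compose2[OF p]) (auto intro!: continuous_intros simp only: inK image_subset_iff)
        show "p (u + x *\<^sub>R e) \<noteq> 0" if "x \<in> {a..b}" for x
          using that by (intro nz) (simp only: inK)
      qed
      then show ?thesis
        unfolding indicator_def inS inK Sg Collect_mem_eq .
    qed
  qed
  have "(\<integral>\<^sup>+v. \<phi> v * indicator (S ` K) v \<partial>lborel) = (\<integral>\<^sup>+u. indicator {u. 0 < u \<bullet> e \<and> u \<bullet> e < 1} u *
      (\<integral>\<^sup>+t. \<phi> (u + t *\<^sub>R e) * indicator (S ` K) (u + t *\<^sub>R e) \<partial>lborel) \<partial>lborel)"
    by (rule nn_integral_fibres[OF _ e]) measurable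
  also have "\<dots> = (\<integral>\<^sup>+u. \<phi> (S u) * ennreal \<bar>p u\<bar> * indicator K u \<partial>lborel)"
    unfolding fib by (rule nn_integral_fibres[OF meas e, symmetric])
  finally show ?thesis .
qed

section \<open>The delay map\<close>

text \<open>Of the threshold on \<sigma>, the geometry keeps only the consequence \<sigma> >
  1.\<close>

locale delay_map =
  fixes e :: "nat \<Rightarrow> 'n::finite"
    and L \<beta> \<sigma> C1 C2 \<gamma> :: real
    and \<Phi>0 :: "real^'n \<Rightarrow> real"
  assumes e_bij: "bij_betw e {1..CARD('n)} UNIV"
    and k_ge: "CARD('n) \<ge> 2"
    and L_pos: "L > 0" and \<beta>_pos: "\<beta> > 0"
    and \<Phi>0_C2: "C2_on \<Phi>0 {x. \<forall>i. -L-\<beta> < x $ i \<and> x $ i < L+\<beta>}"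
    and \<sigma>_gt: "\<sigma> > 1"
    and C1_gt: "C1 > 1" and C2_gt: "C2 > 1"
    and \<gamma>_pos: "\<gamma> > 0" and \<gamma>_def: "1 / \<gamma>^2 = C1 * \<sigma>"
    and d1: "\<And>x. (\<forall>i. -L-\<beta> < x $ i \<and> x $ i < L+\<beta>) \<Longrightarrow>
               (pderiv_coord e \<Phi>0 1 x)^2 \<ge> C1^(CARD('n) - 1) * C2 * \<sigma>^CARD('n)"
    and dj: "\<And>x j. (\<forall>i. -L-\<beta> < x $ i \<and> x $ i < L+\<beta>) \<Longrightarrow> 2 \<le> j \<Longrightarrow> j \<le> CARD('n) \<Longrightarrow>
               (pderiv_coord e \<Phi>0 j x)^2 \<le> (C1 - 1) * (C2 - 1) / real (CARD('n) - 1) * \<sigma>"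
begin

definition \<omega> where "\<omega> = \<gamma> ^ (CARD('n) - 1)"

definition Cube where "Cube = {x :: real^'n. \<forall>i. -L-\<beta> < x $ i \<and> x $ i < L+\<beta>}"

definition \<psi> where "\<psi> u = \<Phi>0 (Gam e \<gamma> u)"

definition F where "F = Tbr e \<gamma> L \<Phi>0 0 0"

definition ax where "ax j = (axis (e j) 1 :: real^'n)"

definition D where "D = {u. Gam e \<gamma> u \<in> Cube}"

text \<open>Half of the margin \<beta> is used: K is compact, contains a neighbourhood of \<Omega>,
  and lies inside the domain D on which \<psi> is differentiable.\<close>

definition K where "K = {u. \<forall>j\<in>{1..CARD('n)}. \<bar>u $ e j\<bar> \<le> \<gamma> ^ (j - 1) * (L + \<beta> / 2)}"

text \<open>|p| is the Jacobian of F: the powers of \<gamma> from the first k - 1 coordinates cancel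
  against \<omega>.\<close>

definition p where "p u = pderiv_coord e \<Phi>0 1 (Gam e \<gamma> u)"

lemma \<omega>_pos: "0 < \<omega>"
  using \<gamma>_pos by (simp add: \<omega>_def)

lemma \<gamma>_le: "\<gamma> \<le> 1"
proof -
  have "1 * 1 \<le> C1 * \<sigma>" using C1_gt \<sigma>_gt by (intro mult_mono) auto
  then have "1 \<le> 1 / \<gamma>^2" using \<gamma>_def by simp
  then have "\<gamma>^2 \<le> 1" using \<gamma>_pos by (simp add: field_simps)
  then show ?thesis using \<gamma>_pos by (simp add: power_le_one_iff)
qed

lemma e_inj: "i \<in> {1..CARD('n)} \<Longrightarrow> j \<in> {1..CARD('n)} \<Longrightarrow> e i = e j \<longleftrightarrow> i = j"
  by (rule inj_on_eq_iff[OF bij_betw_imp_inj_on[OF e_bij]])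

lemma e_cases: obtains j where "j \<in> {1..CARD('n)}" "i = e j"
proof -
  have "i \<in> e ` {1..CARD('n)}" using e_bij by (simp add: bij_betw_def)
  then show ?thesis using that by blast
qed

lemma all_coords: "(\<forall>i. P i) \<longleftrightarrow> (\<forall>j\<in>{1..CARD('n)}. P (e j))"
proof (intro iffI allI)
  fix i assume *: "\<forall>j\<in>{1..CARD('n)}. P (e j)"
  obtain j where "j \<in> {1..CARD('n)}" "i = e j" by (rule e_cases)
  with * show "P i" by blast
qed blast

lemma vec_eqI: "(\<And>j. j \<in> {1..CARD('n)} \<Longrightarrow> x $ e j = y $ e j) \<Longrightarrow> x = y"
  by (simp add: vec_eq_iff all_coords[of "\<lambda>i. x $ i = y $ i"])

lemma sum_coords: "(\<Sum>i\<in>UNIV. g i) = (\<Sum>j\<in>{1..CARD('n)}. g (e j))"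
  by (rule sum.reindex_bij_betw[OF e_bij, symmetric])

lemma prod_coords: "(\<Prod>i\<in>UNIV. g i) = (\<Prod>j\<in>{1..CARD('n)}. g (e j))"
  by (rule prod.reindex_bij_betw[OF e_bij, symmetric])

lemma mkv_nth [simp]: "j \<in> {1..CARD('n)} \<Longrightarrow> mkv e f $ e j = f j"
  unfolding mkv_def by (simp only: vec_lambda_beta the_inv_into_f_f[OF bij_betw_imp_inj_on[OF e_bij]])

lemma Gam_nth [simp]: "j \<in> {1..CARD('n)} \<Longrightarrow> Gam e \<gamma> u $ e j = (1 / \<gamma>) ^ (j - 1) * u $ e j"
  by (simp add: Gam_def)

lemma ax_nth: "i \<in> {1..CARD('n)} \<Longrightarrow> j \<in> {1..CARD('n)} \<Longrightarrow> ax i $ e j = (if i = j then 1 else 0)"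
  unfolding ax_def axis_def by (simp only: vec_lambda_beta e_inj eq_commute[of j i])

lemma inner_ax [simp]: "x \<bullet> ax j = x $ e j"
  unfolding ax_def inner_axis by simp

lemma norm_ax [simp]: "norm (ax j) = 1"
  by (simp add: ax_def)

lemma Gam_linear: "linear (Gam e \<gamma>)"
proof (rule linearI)
  show "Gam e \<gamma> (x + y) = Gam e \<gamma> x + Gam e \<gamma> y" for x y
    by (rule vec_eqI) (simp add: distrib_left)
  show "Gam e \<gamma> (c *\<^sub>R x) = c *\<^sub>R Gam e \<gamma> x" for c x
    by (rule vec_eqI) (simp only: Gam_nth vector_scaleR_component real_scaleR_def mult.left_commute)
qed

lemma Gam_bounded_linear: "bounded_linear (Gam e \<gamma>)"
  using Gam_linear by (rule linear_conv_bounded_linear[THEN iffD1])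

lemma Gam_ax1 [simp]: "Gam e \<gamma> (ax 1) = ax 1"
proof (rule vec_eqI)
  fix j assume "j \<in> {1..CARD('n)}"
  then show "Gam e \<gamma> (ax 1) $ e j = ax 1 $ e j" by (cases "j = 1") (simp_all add: ax_nth)
qed

lemma vec_expand: "x = (\<Sum>j\<in>{1..CARD('n)}. x $ e j *\<^sub>R ax j)"
proof (rule vec_eqI)
  fix i assume i: "i \<in> {1..CARD('n)}"
  have "(\<Sum>j\<in>{1..CARD('n)}. x $ e j *\<^sub>R ax j) $ e i = (\<Sum>j\<in>{1..CARD('n)}. if j = i then x $ e j else 0)"
    using i by (simp add: ax_nth if_distrib cong: if_cong)
  then show "x $ e i = (\<Sum>j\<in>{1..CARD('n)}. x $ e j *\<^sub>R ax j) $ e i"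
    using i by simp
qed

lemma F_nth_less: "1 \<le> j \<Longrightarrow> j < CARD('n) \<Longrightarrow> F u $ e j = u $ e (Suc j) / \<gamma>"
  by (simp add: F_def Tbr_def)

lemma F_nth_last: "F u $ e CARD('n) = \<omega> * \<psi> u"
  using k_ge by (simp add: F_def Tbr_def \<omega>_def \<psi>_def)

lemma Tbr_eq: "Tbr e \<gamma> L \<Phi>0 \<theta> j u = F u + ((\<theta> - 2 * real_of_int j * L) * \<omega>) *\<^sub>R ax CARD('n)"
proof (rule vec_eqI)
  fix i assume i: "i \<in> {1..CARD('n)}"
  then show "Tbr e \<gamma> L \<Phi>0 \<theta> j u $ e i = (F u + ((\<theta> - 2 * real_of_int j * L) * \<omega>) *\<^sub>R ax CARD('n)) $ e i"
    by (cases "i < CARD('n)") (auto simp: F_nth_less F_nth_last ax_nth Tbr_def \<omega>_def \<psi>_def algebra_simps)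
qed

lemma K_iff: "u \<in> K \<longleftrightarrow> (\<forall>i. \<bar>Gam e \<gamma> u $ i\<bar> \<le> L + \<beta> / 2)"
proof -
  have "\<bar>u $ e j\<bar> \<le> \<gamma> ^ (j - 1) * (L + \<beta> / 2) \<longleftrightarrow> \<bar>Gam e \<gamma> u $ e j\<bar> \<le> L + \<beta> / 2" if "j \<in> {1..CARD('n)}" for j
  proof -
    have "\<bar>Gam e \<gamma> u $ e j\<bar> = \<bar>u $ e j\<bar> / \<gamma> ^ (j - 1)"
      using that \<gamma>_pos by (simp add: abs_mult power_divide)
    then show ?thesis using \<gamma>_pos by (simp add: pos_divide_le_eq mult.commute)
  qed
  then show ?thesis
    unfolding K_def all_coords[of "\<lambda>i. \<bar>Gam e \<gamma> u $ i\<bar> \<le> L + \<beta> / 2"] by simp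
qed

lemma K_sub: "K \<subseteq> D"
proof
  fix u assume "u \<in> K"
  then have u: "\<bar>Gam e \<gamma> u $ i\<bar> \<le> L + \<beta> / 2" for i by (simp add: K_iff)
  have "- L - \<beta> < Gam e \<gamma> u $ i \<and> Gam e \<gamma> u $ i < L + \<beta>" for i
    using u[of i] \<beta>_pos by (simp add: abs_le_iff)
  then show "u \<in> D" by (simp add: D_def Cube_def)
qed

lemma Omega_sub_K: "OmegaS e \<gamma> L \<subseteq> interior K"
proof -
  let ?U = "{u :: real^'n. \<forall>j\<in>{1..CARD('n)}. \<bar>u $ e j\<bar> < \<gamma> ^ (j - 1) * (L + \<beta> / 2)}"
  have "?U = (\<Inter>j\<in>{1..CARD('n)}. {u. \<bar>u $ e j\<bar> < \<gamma> ^ (j - 1) * (L + \<beta> / 2)})" by auto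
  moreover have "open \<dots>"
    by (intro open_INT ballI open_Collect_less continuous_intros) auto
  ultimately have "open ?U" by simp
  moreover have "?U \<subseteq> K" by (auto simp: K_def intro: less_imp_le)
  ultimately have "?U \<subseteq> interior K" by (rule interior_maximal[rotated])
  moreover have "OmegaS e \<gamma> L \<subseteq> ?U"
  proof
    fix u assume u: "u \<in> OmegaS e \<gamma> L"
    show "u \<in> ?U"
    proof (intro CollectI ballI)
      fix j assume "j \<in> {1..CARD('n)}"
      then have "\<bar>u $ e j\<bar> \<le> \<gamma> ^ (j - 1) * L" using u by (simp add: OmegaS_def)
      also have "\<dots> < \<gamma> ^ (j - 1) * (L + \<beta> / 2)" using \<gamma>_pos \<beta>_pos by simp
      finally show "\<bar>u $ e j\<bar> < \<gamma> ^ (j - 1) * (L + \<beta> / 2)" .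
    qed
  qed
  ultimately show ?thesis by blast
qed

lemma K_eq_cbox: "K = cbox (- mkv e (\<lambda>j. \<gamma> ^ (j - 1) * (L + \<beta> / 2))) (mkv e (\<lambda>j. \<gamma> ^ (j - 1) * (L + \<beta> / 2)))"
proof (rule set_eqI)
  fix u :: "real^'n"
  let ?c = "mkv e (\<lambda>j. \<gamma> ^ (j - 1) * (L + \<beta> / 2))"
  show "u \<in> K \<longleftrightarrow> u \<in> cbox (- ?c) ?c"
    unfolding K_def mem_box_cart all_coords[of "\<lambda>i. (- ?c) $ i \<le> u $ i \<and> u $ i \<le> ?c $ i"]
    by (auto simp: abs_le_iff)
qed

lemma compact_K: "compact K" and convex_K: "convex K"
  unfolding K_eq_cbox by simp_all

lemma OmegaS_eq_cbox: "OmegaS e \<gamma> L = cbox (- mkv e (\<lambda>j. \<gamma> ^ (j - 1) * L)) (mkv e (\<lambda>j. \<gamma> ^ (j - 1) * L))"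
proof (rule set_eqI)
  fix u :: "real^'n"
  let ?c = "mkv e (\<lambda>j. \<gamma> ^ (j - 1) * L)"
  show "u \<in> OmegaS e \<gamma> L \<longleftrightarrow> u \<in> cbox (- ?c) ?c"
    unfolding OmegaS_def mem_box_cart all_coords[of "\<lambda>i. (- ?c) $ i \<le> u $ i \<and> u $ i \<le> ?c $ i"]
    by (auto simp: abs_le_iff)
qed

lemma compact_Omega: "compact (OmegaS e \<gamma> L)"
  by (simp add: OmegaS_eq_cbox)

lemma convex_D: "convex D"
proof -
  have "Cube = box (\<chi> i. - L - \<beta>) (\<chi> i. L + \<beta>)"
    by (auto simp: Cube_def mem_box_cart)
  then have "convex Cube" by simp
  then have "convex (Gam e \<gamma> -` Cube)"
    by (rule convex_linear_vimage[OF Gam_linear])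
  then show ?thesis by (simp add: D_def vimage_def)
qed

definition is_dPhi :: "(real^'n \<Rightarrow> ((real^'n) \<Rightarrow>\<^sub>L real)) \<Rightarrow> bool" where
  "is_dPhi f' \<longleftrightarrow> (\<exists>f'' :: real^'n \<Rightarrow> ((real^'n) \<Rightarrow>\<^sub>L ((real^'n) \<Rightarrow>\<^sub>L real)).
      (\<forall>x\<in>Cube. (\<Phi>0 has_derivative blinfun_apply (f' x)) (at x)) \<and>
      (\<forall>x\<in>Cube. (f' has_derivative blinfun_apply (f'' x)) (at x)) \<and> continuous_on Cube f'')"

text \<open>\<open>C2_on\<close> asserts only that derivative fields exist; one is chosen, and its
  values are constrained on the cube alone.\<close>

definition dPhi where "dPhi = (SOME f'. is_dPhi f')"

lemma dPhi: "is_dPhi dPhi"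
  unfolding dPhi_def
proof (rule someI_ex[of is_dPhi])
  show "\<exists>f'. is_dPhi f'"
    using \<Phi>0_C2 unfolding C2_on_def is_dPhi_def Cube_def .
qed

lemma Phi_deriv:
  assumes "x \<in> Cube"
  shows "(\<Phi>0 has_derivative blinfun_apply (dPhi x)) (at x)"
proof -
  from dPhi have "\<forall>x\<in>Cube. (\<Phi>0 has_derivative blinfun_apply (dPhi x)) (at x)"
    unfolding is_dPhi_def by (elim exE conjE)
  then show ?thesis using assms by (rule bspec)
qed

lemma pderiv_eq: "x \<in> Cube \<Longrightarrow> pderiv_coord e \<Phi>0 j x = dPhi x (ax j)"
  by (simp add: pderiv_coord_def ax_def frechet_derivative_at[OF Phi_deriv, symmetric])

lemma psi_deriv: "u \<in> D \<Longrightarrow> (\<psi> has_derivative (\<lambda>w. dPhi (Gam e \<gamma> u) (Gam e \<gamma> w))) (at u)"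
  unfolding \<psi>_def D_def
  by (rule has_derivative_compose[OF bounded_linear_imp_has_derivative[OF Gam_bounded_linear] Phi_deriv]) simp

lemma p_eq: "u \<in> D \<Longrightarrow> p u = dPhi (Gam e \<gamma> u) (ax 1)"
  by (simp add: p_def D_def pderiv_eq)

lemma psi_cont: "continuous_on D \<psi>"
  by (intro continuous_at_imp_continuous_on ballI) (rule has_derivative_continuous[OF psi_deriv])

lemma psi_mvt:
  assumes u: "u \<in> D" and v: "v \<in> D"
  shows "\<exists>\<xi>\<in>D. \<psi> u - \<psi> v = dPhi (Gam e \<gamma> \<xi>) (Gam e \<gamma> (u - v))"
proof -
  have inD: "v + t *\<^sub>R (u - v) \<in> D" if "0 \<le> t" "t \<le> 1" for t
    using convexD_alt[OF convex_D v u that] by (simp add: algebra_simps)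
  have "\<exists>t\<in>{0<..<1}. \<psi> (v + 1 *\<^sub>R (u - v)) - \<psi> (v + 0 *\<^sub>R (u - v)) =
     (\<lambda>s. dPhi (Gam e \<gamma> (v + t *\<^sub>R (u - v))) (Gam e \<gamma> (s *\<^sub>R (u - v)))) (1 - 0)"
  proof (rule mvt_simple)
    fix t :: real assume t: "0 \<le> t" "t \<le> 1"
    have "((\<lambda>t. v + t *\<^sub>R (u - v)) has_derivative (\<lambda>s. s *\<^sub>R (u - v))) (at t within {0..1})"
      by (auto intro!: derivative_eq_intros)
    then show "((\<lambda>t. \<psi> (v + t *\<^sub>R (u - v))) has_derivative
       (\<lambda>s. dPhi (Gam e \<gamma> (v + t *\<^sub>R (u - v))) (Gam e \<gamma> (s *\<^sub>R (u - v))))) (at t within {0..1})"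
      using psi_deriv[OF inD[OF t]] by (rule has_derivative_compose)
  qed simp
  then obtain t where t: "t \<in> {0<..<1}" and eq: "\<psi> (v + 1 *\<^sub>R (u - v)) - \<psi> (v + 0 *\<^sub>R (u - v)) =
     dPhi (Gam e \<gamma> (v + t *\<^sub>R (u - v))) (Gam e \<gamma> ((1 - 0) *\<^sub>R (u - v)))" by blast
  show ?thesis
    using eq inD[of t] t by (intro bexI[of _ "v + t *\<^sub>R (u - v)"]) auto
qed

end

text \<open>Weighted Young inequality: the difference of the two sides is a square over C (C - 1).
  With C = C2 the weights match the two hypotheses on the partial derivatives.\<close>

lemma square_sum_lower_bound:
  fixes x r C :: real
  assumes "C > 1"
  shows "x\<^sup>2 / C - r\<^sup>2 / (C - 1) \<le> (x + r)\<^sup>2"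
proof -
  have "0 \<le> ((C - 1) * x + C * r)\<^sup>2 / (C * (C - 1))"
    using assms by simp
  also have "\<dots> = (x + r)\<^sup>2 - (x\<^sup>2 / C - r\<^sup>2 / (C - 1))"
    using assms by (simp add: field_simps power2_eq_square)
  finally show ?thesis by simp
qed

section \<open>Expansion, and regularity of the first partial derivative\<close>

context delay_map
begin

lemma omega_sq: "\<omega>\<^sup>2 * (C1 * \<sigma>) ^ (CARD('n) - 1) = 1"
proof -
  have "\<gamma>\<^sup>2 * (C1 * \<sigma>) = 1"
    unfolding \<gamma>_def[symmetric] using \<gamma>_pos by simp
  moreover have "\<omega>\<^sup>2 * (C1 * \<sigma>) ^ (CARD('n) - 1) = (\<gamma>\<^sup>2 * (C1 * \<sigma>)) ^ (CARD('n) - 1)"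
    by (simp add: \<omega>_def power_mult_distrib power_commutes power_mult[symmetric] mult.commute)
  ultimately show ?thesis by simp
qed

lemma dist_sq: "(dist x y)\<^sup>2 = (\<Sum>j\<in>{1..CARD('n)}. (x $ e j - y $ e j)\<^sup>2)"
proof -
  have "(dist x y)\<^sup>2 = (\<Sum>i\<in>UNIV. (x $ i - y $ i)\<^sup>2)"
    unfolding dist_norm power2_norm_eq_inner inner_vec_def by (simp add: power2_eq_square)
  then show ?thesis by (simp only: sum_coords)
qed

text \<open>With Q the squared distance in coordinates 2 to k, the first k - 1 coordinates of F
  contribute C1 \<sigma> Q. The last contributes at least \<sigma> w1^2 - (C1 - 1) \<sigma> Q, so
  the loss leaves exactly \<sigma> (w1^2 + Q).\<close>

lemma expansion:
  assumes u: "u \<in> D" and v: "v \<in> D"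
  shows "\<sigma> * (dist u v)\<^sup>2 \<le> (dist (F u) (F v))\<^sup>2"
proof -
  define w where "w j = u $ e j - v $ e j" for j
  obtain \<xi> where \<xi>: "\<xi> \<in> D" and mv: "\<psi> u - \<psi> v = dPhi (Gam e \<gamma> \<xi>) (Gam e \<gamma> (u - v))"
    using psi_mvt[OF u v] by blast
  define z where "z = Gam e \<gamma> \<xi>"
  have z: "z \<in> Cube" using \<xi> by (simp add: D_def z_def)
  define a where "a j = \<omega> * (1 / \<gamma>) ^ (j - 1) * dPhi z (ax j)" for j
  define Q where "Q = (\<Sum>j\<in>{2..CARD('n)}. (w j)\<^sup>2)"
  have split1: "{1..CARD('n)} = insert 1 {2..CARD('n)}" using k_ge by auto
  have splitk: "{1..CARD('n)} = insert CARD('n) {1..CARD('n) - 1}" using k_ge by auto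
  have "\<omega> * (\<psi> u - \<psi> v) = \<omega> * dPhi z (\<Sum>j\<in>{1..CARD('n)}. Gam e \<gamma> (u - v) $ e j *\<^sub>R ax j)"
    unfolding mv z_def vec_expand[symmetric] ..
  also have "\<dots> = (\<Sum>j\<in>{1..CARD('n)}. \<omega> * (Gam e \<gamma> (u - v) $ e j * dPhi z (ax j)))"
    by (simp add: blinfun.sum_right blinfun.scaleR_right sum_distrib_left del: Gam_nth)
  also have "\<dots> = (\<Sum>j\<in>{1..CARD('n)}. a j * w j)"
    by (intro sum.cong refl) (simp add: a_def w_def mult.assoc mult.left_commute)
  also have "\<dots> = a 1 * w 1 + (\<Sum>j\<in>{2..CARD('n)}. a j * w j)"
    unfolding split1 by simp
  finally have last: "\<omega> * (\<psi> u - \<psi> v) = a 1 * w 1 + (\<Sum>j\<in>{2..CARD('n)}. a j * w j)" .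
  have a1: "C2 * \<sigma> \<le> (a 1)\<^sup>2"
  proof -
    have "C2 * \<sigma> = (\<omega>\<^sup>2 * (C1 * \<sigma>) ^ (CARD('n) - 1)) * (C2 * \<sigma>)"
      unfolding omega_sq by simp
    also have "\<dots> = \<omega>\<^sup>2 * (C1 ^ (CARD('n) - 1) * C2 * (\<sigma> ^ (CARD('n) - 1) * \<sigma>))"
      by (simp add: power_mult_distrib)
    also have "\<sigma> ^ (CARD('n) - 1) * \<sigma> = \<sigma> ^ CARD('n)"
      using k_ge by (metis One_nat_def Suc_pred' mult.commute not_numeral_le_zero not_gr_zero power_Suc)
    also have "\<omega>\<^sup>2 * (C1 ^ (CARD('n) - 1) * C2 * \<sigma> ^ CARD('n)) \<le> \<omega>\<^sup>2 * (dPhi z (ax 1))\<^sup>2"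
      using d1[of z] z pderiv_eq[OF z, of 1] by (intro mult_left_mono) (auto simp: Cube_def)
    also have "\<dots> = (a 1)\<^sup>2"
      by (simp add: a_def power_mult_distrib)
    finally show ?thesis .
  qed
  \<comment> \<open>The scaling factor equals \<gamma> to the power k - j, which is at most
    1.\<close>
  have aj: "(a j)\<^sup>2 \<le> (C1 - 1) * (C2 - 1) / real (CARD('n) - 1) * \<sigma>" if j: "j \<in> {2..CARD('n)}" for j
  proof -
    have "\<omega> * (1 / \<gamma>) ^ (j - 1) = \<gamma> ^ (CARD('n) - 1 - (j - 1))"
      using j \<gamma>_pos by (simp add: \<omega>_def power_diff power_divide)
    also have "\<dots> \<le> 1" using \<gamma>_pos \<gamma>_le by (simp add: power_le_one)
    finally have le1: "\<omega> * (1 / \<gamma>) ^ (j - 1) \<le> 1" .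
    have "0 \<le> \<omega> * (1 / \<gamma>) ^ (j - 1)" using \<omega>_pos \<gamma>_pos by simp
    then have "(\<omega> * (1 / \<gamma>) ^ (j - 1))\<^sup>2 \<le> 1"
      using le1 by (simp add: power_le_one)
    then have "(\<omega> * (1 / \<gamma>) ^ (j - 1))\<^sup>2 * (dPhi z (ax j))\<^sup>2 \<le> 1 * (dPhi z (ax j))\<^sup>2"
      by (intro mult_right_mono) auto
    then have "(a j)\<^sup>2 \<le> (dPhi z (ax j))\<^sup>2"
      by (simp add: a_def power_mult_distrib)
    also have "\<dots> \<le> (C1 - 1) * (C2 - 1) / real (CARD('n) - 1) * \<sigma>"
      using dj[of z j] z j pderiv_eq[OF z, of j] by (auto simp: Cube_def)
    finally show ?thesis .
  qed
  \<comment> \<open>Cauchy-Schwarz over k - 1 terms consumes the divisor k - 1 in the hypothesis on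
    the partial derivatives.\<close>
  have r: "(\<Sum>j\<in>{2..CARD('n)}. a j * w j)\<^sup>2 \<le> (C1 - 1) * (C2 - 1) * \<sigma> * Q"
  proof -
    have "(\<Sum>j\<in>{2..CARD('n)}. a j * w j)\<^sup>2 \<le> (\<Sum>j\<in>{2..CARD('n)}. (a j)\<^sup>2) * Q"
      unfolding Q_def by (rule Cauchy_Schwarz_ineq_sum)
    also have "(\<Sum>j\<in>{2..CARD('n)}. (a j)\<^sup>2) \<le> real (card {2..CARD('n)}) * ((C1 - 1) * (C2 - 1) / real (CARD('n) - 1) * \<sigma>)"
      by (rule sum_bounded_above) (rule aj)
    also have "\<dots> = (C1 - 1) * (C2 - 1) * \<sigma>"
      using k_ge by simp
    finally show ?thesis
      by (simp add: Q_def mult_right_mono sum_nonneg)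
  qed
  have "(dist (F u) (F v))\<^sup>2 = (\<Sum>j\<in>{1..CARD('n) - 1}. (F u $ e j - F v $ e j)\<^sup>2) + (\<omega> * (\<psi> u - \<psi> v))\<^sup>2"
    unfolding dist_sq splitk using k_ge by (subst sum.insert) (auto simp: F_nth_last right_diff_distrib)
  also have "(\<Sum>j\<in>{1..CARD('n) - 1}. (F u $ e j - F v $ e j)\<^sup>2) = (\<Sum>j\<in>{1..CARD('n) - 1}. C1 * \<sigma> * (w (Suc j))\<^sup>2)"
  proof (intro sum.cong refl)
    fix j assume j: "j \<in> {1..CARD('n) - 1}"
    then have "F u $ e j - F v $ e j = w (Suc j) / \<gamma>"
      using k_ge by (subst (1 2) F_nth_less) (auto simp: w_def diff_divide_distrib)
    then show "(F u $ e j - F v $ e j)\<^sup>2 = C1 * \<sigma> * (w (Suc j))\<^sup>2"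
      by (simp add: \<gamma>_def[symmetric] power_divide)
  qed
  also have "\<dots> = C1 * \<sigma> * Q"
  proof -
    have "(\<Sum>j\<in>{1..CARD('n) - 1}. (w (Suc j))\<^sup>2) = Q"
      unfolding Q_def
      by (rule sum.reindex_bij_witness[of _ "\<lambda>j. j - 1" Suc]) (use k_ge in auto)
    then show ?thesis by (simp add: sum_distrib_left[symmetric])
  qed
  finally have dF: "(dist (F u) (F v))\<^sup>2 = C1 * \<sigma> * Q + (a 1 * w 1 + (\<Sum>j\<in>{2..CARD('n)}. a j * w j))\<^sup>2"
    unfolding last .
  have du: "(dist u v)\<^sup>2 = (w 1)\<^sup>2 + Q"
    unfolding dist_sq split1 Q_def w_def by simp
  have "\<sigma> * (w 1)\<^sup>2 \<le> (a 1 * w 1)\<^sup>2 / C2"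
    using mult_right_mono[OF a1, of "(w 1)\<^sup>2"] C2_gt by (simp add: power_mult_distrib field_simps)
  moreover have "(\<Sum>j\<in>{2..CARD('n)}. a j * w j)\<^sup>2 / (C2 - 1) \<le> (C1 - 1) * \<sigma> * Q"
    using r C2_gt by (simp add: pos_divide_le_eq mult_ac)
  ultimately have "\<sigma> * (w 1)\<^sup>2 - (C1 - 1) * \<sigma> * Q \<le> (a 1 * w 1 + (\<Sum>j\<in>{2..CARD('n)}. a j * w j))\<^sup>2"
    using square_sum_lower_bound[OF C2_gt, of "a 1 * w 1" "\<Sum>j\<in>{2..CARD('n)}. a j * w j"] by linarith
  then show ?thesis
    unfolding dF du by (simp add: algebra_simps)
qed

definition s where "s = 1 / sqrt \<sigma>"

lemma s_pos: "0 < s" and s_less: "s < 1"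
  using \<sigma>_gt by (auto simp: s_def)

lemma expand:
  assumes "u \<in> D" "v \<in> D"
  shows "dist u v \<le> s * dist (F u) (F v)"
proof -
  have "sqrt (\<sigma> * (dist u v)\<^sup>2) \<le> sqrt ((dist (F u) (F v))\<^sup>2)"
    using expansion[OF assms] by (rule real_sqrt_le_mono)
  then have "sqrt \<sigma> * dist u v \<le> dist (F u) (F v)"
    by (simp add: real_sqrt_mult)
  then show ?thesis
    using \<sigma>_gt by (simp add: s_def pos_le_divide_eq mult.commute)
qed

lemma continuous_F: "continuous_on D F"
proof -
  have "continuous_on D (\<lambda>u. \<Sum>j\<in>{1..CARD('n)}. (F u $ e j) *\<^sub>R ax j)"
  proof (intro continuous_on_sum continuous_on_scaleR continuous_on_const)
    fix j assume j: "j \<in> {1..CARD('n)}"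
    show "continuous_on D (\<lambda>u. F u $ e j)"
    proof (cases "j < CARD('n)")
      case True
      then show ?thesis
        using j \<gamma>_pos by (simp add: F_nth_less continuous_intros)
    next
      case False
      then have "j = CARD('n)" using j by simp
      then show ?thesis
        using psi_cont by (simp add: F_nth_last continuous_intros)
    qed
  qed
  then show ?thesis unfolding vec_expand[symmetric] .
qed

text \<open>The second derivative is continuous, hence bounded on the compact convex image of K
  under \<Gamma>. The Lipschitz constant controls the distortion of the densities.\<close>

lemma p_lipschitz: "\<exists>M\<ge>0. \<forall>u\<in>K. \<forall>v\<in>K. \<bar>p u - p v\<bar> \<le> M * dist u v"
proof -
  obtain f'' where f'': "\<And>x. x \<in> Cube \<Longrightarrow> (dPhi has_derivative blinfun_apply (f'' x)) (at x)"
    and cont: "continuous_on Cube f''"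
    using dPhi unfolding is_dPhi_def by (elim exE conjE) (rule that, rule bspec)
  define CK where "CK = Gam e \<gamma> ` K"
  have "compact CK"
    unfolding CK_def using linear_continuous_on[OF Gam_bounded_linear] compact_K by (rule compact_continuous_image)
  have CK_sub: "CK \<subseteq> Cube" using K_sub by (auto simp: CK_def D_def)
  have "convex CK" unfolding CK_def by (rule convex_linear_image[OF Gam_linear convex_K])
  have "bounded (f'' ` CK)"
    using \<open>compact CK\<close> cont CK_sub by (intro compact_imp_bounded compact_continuous_image) (auto intro: continuous_on_subset)
  then obtain B where B: "\<And>x. x \<in> CK \<Longrightarrow> norm (f'' x) \<le> B" and B0: "0 < B"
    unfolding bounded_pos by blast
  obtain Bg where Bg: "\<And>w. norm (Gam e \<gamma> w) \<le> Bg * norm w" and Bg0: "0 \<le> Bg"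
    using bounded_linear.nonneg_bounded[OF Gam_bounded_linear] by (auto simp: mult.commute)
  have "\<bar>p u - p v\<bar> \<le> B * Bg * dist u v" if u: "u \<in> K" and v: "v \<in> K" for u v
  proof -
    have uv: "Gam e \<gamma> u \<in> CK" "Gam e \<gamma> v \<in> CK" using u v by (auto simp: CK_def)
    have "norm (dPhi (Gam e \<gamma> u) - dPhi (Gam e \<gamma> v)) \<le> B * norm (Gam e \<gamma> u - Gam e \<gamma> v)"
    proof (rule differentiable_bound[OF \<open>convex CK\<close> _ _ uv])
      show "(dPhi has_derivative blinfun_apply (f'' x)) (at x within CK)" if "x \<in> CK" for x
        using f''[of x] that CK_sub has_derivative_at_withinI by blast
      show "onorm (blinfun_apply (f'' x)) \<le> B" if "x \<in> CK" for x
        using B[OF that] by (simp add: norm_blinfun.rep_eq)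
    qed
    also have "\<dots> = B * norm (Gam e \<gamma> (u - v))"
      by (simp add: linear_diff[OF Gam_linear])
    also have "\<dots> \<le> B * (Bg * norm (u - v))"
      using Bg B0 by (intro mult_left_mono) auto
    finally have 1: "norm (dPhi (Gam e \<gamma> u) - dPhi (Gam e \<gamma> v)) \<le> B * Bg * dist u v"
      by (simp add: dist_norm)
    have "\<bar>p u - p v\<bar> = norm ((dPhi (Gam e \<gamma> u) - dPhi (Gam e \<gamma> v)) (ax 1))"
      using u v K_sub by (simp add: p_eq subset_iff blinfun.diff_left)
    also have "\<dots> \<le> norm (dPhi (Gam e \<gamma> u) - dPhi (Gam e \<gamma> v)) * norm (ax 1)"
      by (rule norm_blinfun)
    finally show ?thesis using 1 by simp
  qed
  then show ?thesis using B0 Bg0 by (intro exI[of _ "B * Bg"]) auto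
qed

definition c where "c = sqrt (C1 ^ (CARD('n) - 1) * C2 * \<sigma> ^ CARD('n))"

lemma c_pos: "0 < c"
  using C1_gt C2_gt \<sigma>_gt by (simp add: c_def)

lemma p_ge: "u \<in> D \<Longrightarrow> c \<le> \<bar>p u\<bar>"
  unfolding c_def p_def using d1[of "Gam e \<gamma> u"]
  by (intro real_le_lsqrt) (auto simp: D_def Cube_def real_le_lsqrt intro: real_sqrt_le_iff[THEN iffD1])

end

section \<open>Factorisation of F and change of variables\<close>

lemma prod_Basis_cart: "(\<Prod>b\<in>Basis. f b) = (\<Prod>i\<in>UNIV. f (axis i 1 :: real^'n::finite))"
proof -
  have B: "(Basis :: (real^'n) set) = range (\<lambda>i. axis i 1)"
    by (auto simp: Basis_vec_def)
  have I: "inj (\<lambda>i. axis i 1 :: real^'n)"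
    by (auto simp: inj_on_def axis_eq_axis)
  show ?thesis unfolding B by (subst prod.reindex[OF I]) simp
qed

context delay_map
begin

text \<open>\<open>F = A \<circ> S\<close>, where \<open>S\<close> only changes the first coordinate and \<open>A\<close> is a cyclic permutation of the
  coordinates combined with a rescaling; since \<open>\<omega> = \<gamma>\<^sup>k\<^sup>-\<^sup>1\<close>, \<open>A\<close> preserves volume.\<close>

definition A :: "real^'n \<Rightarrow> real^'n" where
  "A v = mkv e (\<lambda>i. if i < CARD('n) then v $ e (Suc i) / \<gamma> else \<omega> * v $ e 1)"

lemma A_nth_less: "1 \<le> j \<Longrightarrow> j < CARD('n) \<Longrightarrow> A v $ e j = v $ e (Suc j) / \<gamma>"
  by (simp add: A_def)

lemma A_nth_last: "A v $ e CARD('n) = \<omega> * v $ e 1"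
  using k_ge by (simp add: A_def)

lemma A_measurable [measurable]: "A \<in> borel_measurable borel"
proof -
  have "linear A"
  proof (rule linearI)
    show "A (x + y) = A x + A y" for x y
    proof (rule vec_eqI)
      fix j assume j: "j \<in> {1..CARD('n)}"
      show "A (x + y) $ e j = (A x + A y) $ e j"
        using j by (cases "j < CARD('n)") (auto simp: A_nth_less A_nth_last add_divide_distrib distrib_left)
    qed
    show "A (a *\<^sub>R x) = a *\<^sub>R A x" for a x
    proof (rule vec_eqI)
      fix j assume j: "j \<in> {1..CARD('n)}"
      show "A (a *\<^sub>R x) $ e j = (a *\<^sub>R A x) $ e j"
        using j by (cases "j < CARD('n)") (auto simp: A_nth_less A_nth_last)
    qed
  qed
  then show ?thesis
    by (intro borel_measurable_continuous_onI linear_continuous_on) (simp add: linear_conv_bounded_linear)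
qed

lemma inj_A: "inj A"
proof (rule injI)
  fix x y assume eq: "A x = A y"
  show "x = y"
  proof (rule vec_eqI)
    fix j assume j: "j \<in> {1..CARD('n)}"
    show "x $ e j = y $ e j"
    proof (cases "j = 1")
      case True
      then show ?thesis using arg_cong[OF eq, of "\<lambda>v. v $ e CARD('n)"] \<omega>_pos by (simp add: A_nth_last)
    next
      case False
      then have "1 \<le> j - 1" "j - 1 < CARD('n)" "Suc (j - 1) = j" using j by auto
      then show ?thesis using arg_cong[OF eq, of "\<lambda>v. v $ e (j - 1)"] \<gamma>_pos by (simp add: A_nth_less)
    qed
  qed
qed

text \<open>The inverse of A; it gives the corners of preimages of boxes.\<close>

definition unA :: "real^'n \<Rightarrow> real^'n" where
  "unA l = mkv e (\<lambda>j. if j = 1 then l $ e CARD('n) / \<omega> else \<gamma> * l $ e (j - 1))"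

lemma unA_1: "unA l $ e 1 = l $ e CARD('n) / \<omega>"
  using k_ge by (simp add: unA_def)

lemma unA_Suc: "1 \<le> j \<Longrightarrow> j < CARD('n) \<Longrightarrow> unA l $ e (Suc j) = \<gamma> * l $ e j"
  by (simp add: unA_def)

text \<open>With \<open>coords_last\<close> this matches the two ends of the cyclic permutation:
  coordinate 1 on the source side corresponds to coordinate k on the target side.\<close>

lemma coords_shift: "(\<forall>j\<in>{1..CARD('n)}. P j) \<longleftrightarrow> P 1 \<and> (\<forall>j. 1 \<le> j \<and> j < CARD('n) \<longrightarrow> P (Suc j))"
proof (intro iffI conjI ballI)
  fix j assume *: "P 1 \<and> (\<forall>j. 1 \<le> j \<and> j < CARD('n) \<longrightarrow> P (Suc j))" and j: "j \<in> {1..CARD('n)}"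
  show "P j"
  proof (cases "j = 1")
    case False
    then have "1 \<le> j - 1" "j - 1 < CARD('n)" "Suc (j - 1) = j" using j by auto
    then show ?thesis using * by metis
  qed (use * in simp)
qed (use k_ge in auto)

lemma coords_last: "(\<forall>j\<in>{1..CARD('n)}. P j) \<longleftrightarrow> P CARD('n) \<and> (\<forall>j. 1 \<le> j \<and> j < CARD('n) \<longrightarrow> P j)"
  using k_ge by (auto simp: le_less)

lemma A_vimage_box: "A -` box l u = box (unA l) (unA u)"
proof (rule set_eqI)
  fix v
  have "v \<in> A -` box l u \<longleftrightarrow> (\<forall>j\<in>{1..CARD('n)}. l $ e j < A v $ e j \<and> A v $ e j < u $ e j)"
    unfolding vimage_eq mem_box_cart all_coords[of "\<lambda>i. l $ i < A v $ i \<and> A v $ i < u $ i"] ..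
  also have "\<dots> \<longleftrightarrow> (\<forall>j\<in>{1..CARD('n)}. unA l $ e j < v $ e j \<and> v $ e j < unA u $ e j)"
    unfolding coords_last[of "\<lambda>j. l $ e j < A v $ e j \<and> A v $ e j < u $ e j"]
      coords_shift[of "\<lambda>j. unA l $ e j < v $ e j \<and> v $ e j < unA u $ e j"] A_nth_last unA_1
    using \<omega>_pos \<gamma>_pos by (auto simp: A_nth_less unA_Suc field_simps)
  also have "\<dots> \<longleftrightarrow> v \<in> box (unA l) (unA u)"
    unfolding mem_box_cart all_coords[of "\<lambda>i. unA l $ i < v $ i \<and> v $ i < unA u $ i"] ..
  finally show "v \<in> A -` box l u \<longleftrightarrow> v \<in> box (unA l) (unA u)" .
qed

text \<open>Open boxes determine \<open>lborel\<close>. Pulling one back scales one side by 1 /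
  \<omega> and each of the k - 1 others by \<gamma>.\<close>

lemma lborel_A: "lborel = distr lborel borel A"
proof (rule lborel_eqI)
  fix l u :: "real^'n" assume le: "\<And>b. b \<in> Basis \<Longrightarrow> l \<bullet> b \<le> u \<bullet> b"
  have le': "l $ i \<le> u $ i" for i
    using le[of "axis i 1"] by (simp add: inner_axis axis_in_Basis_iff)
  have "unA l $ e j \<le> unA u $ e j" if "j \<in> {1..CARD('n)}" for j
    using that le' \<omega>_pos \<gamma>_pos by (auto simp: unA_def intro!: divide_right_mono)
  then have "\<forall>i. unA l $ i \<le> unA u $ i"
    unfolding all_coords[of "\<lambda>i. unA l $ i \<le> unA u $ i"] by blast
  then have leU: "unA l \<bullet> b \<le> unA u \<bullet> b" if "b \<in> Basis" for b
    using that by (auto simp: Basis_vec_def inner_axis)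
  have split1: "{1..CARD('n)} = insert 1 {2..CARD('n)}" using k_ge by auto
  have splitk: "{1..CARD('n)} = insert CARD('n) {1..CARD('n) - 1}" using k_ge by auto
  have "emeasure (distr lborel borel A) (box l u) = emeasure lborel (box (unA l) (unA u))"
    by (subst emeasure_distr) (auto simp: A_vimage_box)
  also have "\<dots> = ennreal (\<Prod>b\<in>Basis. (unA u - unA l) \<bullet> b)"
    by (rule emeasure_lborel_box[OF leU])
  also have "(\<Prod>b\<in>Basis. (unA u - unA l) \<bullet> b) = (\<Prod>j\<in>{1..CARD('n)}. (unA u - unA l) $ e j)"
    unfolding prod_Basis_cart prod_coords by (simp add: inner_axis)
  also have "\<dots> = ((u - l) $ e CARD('n) / \<omega>) * (\<Prod>j\<in>{2..CARD('n)}. \<gamma> * (u - l) $ e (j - 1))"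
    unfolding split1 by (subst prod.insert)
      (auto simp: unA_1[unfolded One_nat_def] unA_def diff_divide_distrib right_diff_distrib intro!: prod.cong)
  also have "(\<Prod>j\<in>{2..CARD('n)}. \<gamma> * (u - l) $ e (j - 1)) = (\<Prod>j\<in>{1..CARD('n) - 1}. \<gamma> * (u - l) $ e j)"
    by (rule prod.reindex_bij_witness[of _ Suc "\<lambda>j. j - 1"]) (use k_ge in auto)
  also have "\<dots> = \<omega> * (\<Prod>j\<in>{1..CARD('n) - 1}. (u - l) $ e j)"
    by (simp add: prod.distrib \<omega>_def)
  also have "(u - l) $ e CARD('n) / \<omega> * (\<omega> * (\<Prod>j\<in>{1..CARD('n) - 1}. (u - l) $ e j)) = (\<Prod>j\<in>{1..CARD('n)}. (u - l) $ e j)"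
    unfolding splitk using \<omega>_pos k_ge by (subst prod.insert) auto
  also have "\<dots> = (\<Prod>b\<in>Basis. (u - l) \<bullet> b)"
    unfolding prod_Basis_cart prod_coords by (simp add: inner_axis)
  finally show "emeasure (distr lborel borel A) (box l u) = ennreal (\<Prod>b\<in>Basis. (u - l) \<bullet> b)" .
qed simp

definition S where "S u = u + (\<psi> u - u \<bullet> ax 1) *\<^sub>R ax 1"

lemma F_eq: "F u = A (S u)"
proof (rule vec_eqI)
  fix j assume j: "j \<in> {1..CARD('n)}"
  show "F u $ e j = A (S u) $ e j"
  proof (cases "j < CARD('n)")
    case True
    then have "1 \<noteq> Suc j" "1 \<in> {1..CARD('n)}" "Suc j \<in> {1..CARD('n)}" using j k_ge by auto
    then have "S u $ e (Suc j) = u $ e (Suc j)"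
      unfolding S_def by (simp only: vector_add_component vector_scaleR_component ax_nth) simp
    then show ?thesis using j True by (simp add: F_nth_less A_nth_less)
  next
    case False
    then have "j = CARD('n)" using j by simp
    moreover have "S u $ e 1 = \<psi> u"
      using k_ge ax_nth[of 1 1] by (simp add: S_def)
    ultimately show ?thesis by (simp add: F_nth_last A_nth_last)
  qed
qed

lemma p_cont: "continuous_on K p"
proof -
  obtain M where "M \<ge> 0" "\<forall>u\<in>K. \<forall>v\<in>K. \<bar>p u - p v\<bar> \<le> M * dist u v"
    using p_lipschitz by blast
  then have "M-lipschitz_on K p"
    by (intro lipschitz_onI) (auto simp: dist_real_def)
  then show ?thesis by (rule lipschitz_on_continuous_on)
qed

lemma K_fibre:
  assumes "u \<in> K"
  shows "\<exists>a b. a < b \<and> {t. u + t *\<^sub>R ax 1 \<in> K} = {a..b}"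
proof -
  define R where "R = L + \<beta> / 2"
  have R: "0 < R" using L_pos \<beta>_pos by (simp add: R_def)
  have one: "1 \<in> {1..CARD('n)}" using k_ge by auto
  have "u + t *\<^sub>R ax 1 \<in> K \<longleftrightarrow> t \<in> {- R - u $ e 1..R - u $ e 1}" for t
  proof -
    have "u + t *\<^sub>R ax 1 \<in> K \<longleftrightarrow> \<bar>u $ e 1 + t\<bar> \<le> R"
    proof
      assume "u + t *\<^sub>R ax 1 \<in> K"
      then show "\<bar>u $ e 1 + t\<bar> \<le> R"
        using one ax_nth[OF one one] by (auto simp: K_def R_def dest!: bspec[of _ _ 1])
    next
      assume t: "\<bar>u $ e 1 + t\<bar> \<le> R"
      show "u + t *\<^sub>R ax 1 \<in> K"
        unfolding K_def
      proof (intro CollectI ballI)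
        fix j assume j: "j \<in> {1..CARD('n)}"
        show "\<bar>(u + t *\<^sub>R ax 1) $ e j\<bar> \<le> \<gamma> ^ (j - 1) * (L + \<beta> / 2)"
        proof (cases "j = 1")
          case True
          then show ?thesis using t ax_nth[OF one one] by (simp add: R_def)
        next
          case False
          then show ?thesis using assms j ax_nth[OF one j] by (simp add: K_def)
        qed
      qed
    qed
    then show ?thesis by auto
  qed
  then have "{t. u + t *\<^sub>R ax 1 \<in> K} = {- R - u $ e 1..R - u $ e 1}"
    by (intro set_eqI) (simp only: mem_Collect_eq)
  moreover have "- R - u $ e 1 < R - u $ e 1" using R by simp
  ultimately show ?thesis by blast
qed

lemma psi_deriv_ax:
  assumes "u \<in> K"
  shows "((\<lambda>t. \<psi> (u + t *\<^sub>R ax 1)) has_real_derivative p u) (at 0)"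
proof -
  have uD: "u \<in> D" using assms K_sub by blast
  have "((\<lambda>t. u + t *\<^sub>R ax 1) has_derivative (\<lambda>t. t *\<^sub>R ax 1)) (at 0)"
    by (auto intro!: derivative_eq_intros)
  moreover have "(\<psi> has_derivative (\<lambda>w. dPhi (Gam e \<gamma> u) (Gam e \<gamma> w))) (at (u + 0 *\<^sub>R ax 1))"
    using psi_deriv[OF uD] by simp
  ultimately have "((\<lambda>t. \<psi> (u + t *\<^sub>R ax 1)) has_derivative (\<lambda>t. dPhi (Gam e \<gamma> u) (Gam e \<gamma> (t *\<^sub>R ax 1)))) (at 0)"
    by (rule has_derivative_compose)
  also have "(\<lambda>t. dPhi (Gam e \<gamma> u) (Gam e \<gamma> (t *\<^sub>R ax 1))) = (*) (p u)"
    unfolding linear_cmul[OF Gam_linear] Gam_ax1 p_eq[OF uD] blinfun.scaleR_right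
    by (simp add: fun_eq_iff)
  finally show ?thesis by (simp add: has_field_derivative_def)
qed

text \<open>Only S contributes a Jacobian, the derivative p of its one changed coordinate. A
  preserves volume and, being injective, identifies the images of K under S and F.\<close>

lemma change_of_variables:
  assumes [measurable]: "\<phi> \<in> borel_measurable borel"
  shows "(\<integral>\<^sup>+z. \<phi> z * indicator (F ` K) z \<partial>lborel) = (\<integral>\<^sup>+u. \<phi> (F u) * ennreal \<bar>p u\<bar> * indicator K u \<partial>lborel)"
proof -
  have [measurable]: "F ` K \<in> sets borel"
    by (intro borel_compact compact_continuous_image continuous_on_subset[OF continuous_F K_sub] compact_K)
  have "(\<integral>\<^sup>+z. \<phi> z * indicator (F ` K) z \<partial>lborel) = (\<integral>\<^sup>+z. \<phi> z * indicator (F ` K) z \<partial>distr lborel borel A)"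
    by (simp only: lborel_A[symmetric])
  also have "\<dots> = (\<integral>\<^sup>+v. \<phi> (A v) * indicator (F ` K) (A v) \<partial>lborel)"
    by (subst nn_integral_distr) auto
  also have "\<dots> = (\<integral>\<^sup>+v. \<phi> (A v) * indicator (S ` K) v \<partial>lborel)"
  proof -
    have "A v \<in> F ` K \<longleftrightarrow> v \<in> S ` K" for v
      using inj_A by (auto simp: F_eq inj_eq)
    then show ?thesis by (simp add: indicator_def)
  qed
  also have "\<dots> = (\<integral>\<^sup>+u. \<phi> (A (S u)) * ennreal \<bar>p u\<bar> * indicator K u \<partial>lborel)"
    unfolding S_def[abs_def]
  proof (rule nn_integral_graph_shear[where \<phi> = "\<lambda>v. \<phi> (A v)"])
    show "p u \<noteq> 0" if "u \<in> K" for u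
      using p_ge[of u] c_pos that K_sub by auto
  qed (use K_fibre p_cont psi_deriv_ax compact_K continuous_on_subset[OF psi_cont K_sub] in auto)
  finally show ?thesis by (simp only: F_eq)
qed

lemma chart: "\<exists>M. expanding_chart K F (\<lambda>u. \<bar>p u\<bar>) s M c"
proof -
  obtain M where M: "M \<ge> 0" "\<And>u v. u \<in> K \<Longrightarrow> v \<in> K \<Longrightarrow> \<bar>p u - p v\<bar> \<le> M * dist u v"
    using p_lipschitz by blast
  have "expanding_chart K F (\<lambda>u. \<bar>p u\<bar>) s M c"
  proof
    show "K \<in> sets borel" by (rule borel_compact[OF compact_K])
    show "F ` K \<in> sets borel"
      by (intro borel_compact compact_continuous_image continuous_on_subset[OF continuous_F K_sub] compact_K)
    show "\<bar>\<bar>p u\<bar> - \<bar>p v\<bar>\<bar> \<le> M * dist u v" if "u \<in> K" "v \<in> K" for u v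
      using M(2)[OF that] by linarith
    show "dist u v \<le> s * dist (F u) (F v)" if "u \<in> K" "v \<in> K" for u v
      using that K_sub by (intro expand) auto
    show "c \<le> \<bar>p u\<bar>" if "u \<in> K" for u
      using that K_sub p_ge by auto
    show "(\<integral>\<^sup>+z. \<phi> z * indicator (F ` K) z \<partial>lborel) = (\<integral>\<^sup>+y. \<phi> (F y) * ennreal \<bar>p y\<bar> * indicator K y \<partial>lborel)"
      if "\<phi> \<in> borel_measurable borel" for \<phi>
      using that by (rule change_of_variables)
  qed (use M s_pos c_pos in auto)
  then show ?thesis ..
qed

text \<open>By invariance of domain F maps the interior of K to an open set. It contains the compact
  image of \<Omega>, hence a uniform neighbourhood of it.\<close>

lemma near_Omega:
  "\<exists>\<epsilon>1>0. \<forall>x \<epsilon>. \<epsilon> \<le> \<epsilon>1 \<longrightarrow> ball x \<epsilon> \<inter> F ` OmegaS e \<gamma> L \<noteq> {} \<longrightarrow> ball x \<epsilon> \<subseteq> F ` K"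
proof -
  have inj: "inj_on F D"
  proof (rule inj_onI)
    fix u v assume "u \<in> D" "v \<in> D" "F u = F v"
    then show "u = v" using expand[of u v] by simp
  qed
  have sub: "interior K \<subseteq> D" using K_sub interior_subset by blast
  have "open (F ` interior K)"
    by (rule invariance_of_domain) (use continuous_F sub inj in \<open>auto intro: continuous_on_subset inj_on_subset\<close>)
  moreover have "compact (F ` OmegaS e \<gamma> L)"
    using Omega_sub_K sub
    by (intro compact_continuous_image compact_Omega continuous_on_subset[OF continuous_F]) auto
  moreover have "F ` OmegaS e \<gamma> L \<subseteq> F ` interior K" using Omega_sub_K by blast
  ultimately obtain d where d: "d > 0" "(\<Union>x\<in>F ` OmegaS e \<gamma> L. ball x d) \<subseteq> F ` interior K"
    using compact_subset_open_imp_ball_epsilon_subset by metis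
  \<comment> \<open>The neighbourhood is measured from a point y of the image, not from the centre;
    two points of the ball can be almost 2 \<epsilon> apart, hence d / 2.\<close>
  have "ball x \<epsilon> \<subseteq> F ` K" if \<epsilon>: "\<epsilon> \<le> d / 2" and ne: "ball x \<epsilon> \<inter> F ` OmegaS e \<gamma> L \<noteq> {}" for x \<epsilon>
  proof
    fix z assume z: "z \<in> ball x \<epsilon>"
    obtain y where y: "y \<in> ball x \<epsilon>" "y \<in> F ` OmegaS e \<gamma> L" using ne by blast
    have "dist y z \<le> dist x y + dist x z" by (metis dist_commute dist_triangle2)
    then have "z \<in> ball y d" using y z \<epsilon> by simp
    then have "z \<in> F ` interior K" using d(2) y(2) by blast
    then show "z \<in> F ` K" using interior_subset by blast
  qed
  then show ?thesis using d(1) by (intro exI[of _ "d / 2"]) auto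
qed

end

section \<open>The threshold on the expansion rate and the law of the shifts\<close>

text \<open>Log-convexity at the midpoint of a and a + 1, together with Gamma a \<le> a Gamma a =
  Gamma (a + 1) for a \<ge> 1.\<close>

lemma Gamma_half_le:
  fixes a :: real
  assumes "1 \<le> a"
  shows "Gamma (a + 1/2) \<le> Gamma (a + 1)"
proof -
  have pos: "0 < Gamma a" "0 < Gamma (a + 1)" "0 < Gamma (a + 1/2)"
    using assms by (auto intro!: Gamma_real_pos)
  have "(ln \<circ> Gamma) ((1 - 1/2) *\<^sub>R a + (1/2) *\<^sub>R (a + 1)) \<le> (1 - 1/2) * (ln \<circ> Gamma) a + (1/2) * (ln \<circ> Gamma) (a + 1)"
    by (rule convex_onD[OF log_convex_Gamma_real]) (use assms in auto)
  moreover have "(1 - 1/2) *\<^sub>R a + (1/2) *\<^sub>R (a + 1) = a + 1/2" by (simp add: field_simps)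
  ultimately have "ln (Gamma (a + 1/2)) \<le> (ln (Gamma a) + ln (Gamma (a + 1))) / 2"
    by simp
  also have "ln (Gamma a) \<le> ln (Gamma (a + 1))"
  proof -
    have "Gamma (a + 1) = a * Gamma a"
      using assms by (intro Gamma_plus1) (auto elim!: nonpos_Ints_cases)
    then have "Gamma a \<le> Gamma (a + 1)" using assms pos by simp
    then show ?thesis using pos by simp
  qed
  finally have "ln (Gamma (a + 1/2)) \<le> ln (Gamma (a + 1))" by simp
  then show ?thesis using pos by simp
qed

text \<open>With a = k / 2 the ratio is Gamma (a + 1) / (sqrt pi Gamma (a + 1/2)), and the crude
  bounds sqrt pi \<le> 2 \<le> a + 1 suffice.\<close>

lemma unit_ball_vol_ratio:
  assumes "2 \<le> k"
  shows "2 \<le> (real k + 2) * (unit_ball_vol (real (k - 1)) / unit_ball_vol (real k))"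
proof -
  define a where "a = real k / 2"
  have a: "1 \<le> a" using assms by (simp add: a_def)
  have k1: "real (k - 1) = 2 * a - 1" using assms by (simp add: a_def of_nat_diff)
  have pos: "0 < Gamma (a + 1)" "0 < Gamma (a + 1/2)" using a by (auto intro!: Gamma_real_pos)
  have u1: "unit_ball_vol (real (k - 1)) = pi powr (a - 1/2) / Gamma (a + 1/2)"
    unfolding unit_ball_vol_def k1 by (simp add: diff_divide_distrib add.commute)
  have u2: "unit_ball_vol (real k) = pi powr (a - 1/2) * sqrt pi / Gamma (a + 1)"
    unfolding unit_ball_vol_def by (simp add: a_def powr_half_sqrt[symmetric] powr_add[symmetric])
  have ratio: "unit_ball_vol (real (k - 1)) / unit_ball_vol (real k) = Gamma (a + 1) / (sqrt pi * Gamma (a + 1/2))"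
    unfolding u1 u2 using pos by simp
  have le: "2 * (sqrt pi * Gamma (a + 1/2)) \<le> (2 * a + 2) * Gamma (a + 1)"
  proof -
    have "sqrt pi \<le> 2" using pi_less_4 by (intro real_le_lsqrt) auto
    then have "sqrt pi * Gamma (a + 1/2) \<le> (a + 1) * Gamma (a + 1)"
      using Gamma_half_le[OF a] a pos by (intro mult_mono) auto
    then show ?thesis by (simp add: algebra_simps)
  qed
  have k2: "real k + 2 = 2 * a + 2" by (simp add: a_def)
  have "0 < sqrt pi * Gamma (a + 1/2)" using pos by simp
  then show ?thesis
    unfolding ratio k2 using le by (simp only: times_divide_eq_right pos_le_divide_eq)
qed

text \<open>\<open>S_k\<close> is a definite description, so its defining equation has to be solved
  first. In x = sqrt \<sigma> it becomes the quadratic x^2 - (2 + A) x + 1 = 0 with exactly one root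
  x0 > 1; beyond x0 the left side of the original equation is smaller than 1.\<close>

lemma S_k_less:
  assumes k: "2 \<le> k" and \<sigma>: "S_k k (real k + 2) < \<sigma>"
  shows "1 < \<sigma>" and "1 / sqrt \<sigma> + 8 * (1 / sqrt \<sigma>) / (1 - 1 / sqrt \<sigma>) < 1"
proof -
  define R where "R = (real k + 2) * (unit_ball_vol (real (k - 1)) / unit_ball_vol (real k))"
  define A where "A = 4 * R"
  have A: "8 \<le> A" using unit_ball_vol_ratio[OF k] by (simp add: A_def R_def)
  have eta: "eta0 k t (real k + 2) = 1 / sqrt t + A / (sqrt t - 1)" if "1 < t" for t
    using that unfolding eta0_def A_def R_def by (simp add: powr_minus_divide powr_half_sqrt field_simps)
  define q where "q = sqrt ((2 + A)\<^sup>2 - 4)"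
  define x0 where "x0 = ((2 + A) + q) / 2"
  have "0 \<le> (2 + A)\<^sup>2 - 4" using A power_mono[of 2 "2 + A" 2] by simp
  then have q2: "q\<^sup>2 = (2 + A)\<^sup>2 - 4" and q0: "0 \<le> q" by (auto simp: q_def)
  have x01: "1 < x0" using A q0 by (simp add: x0_def)
  have root: "x0\<^sup>2 - (2 + A) * x0 + 1 = 0"
    using q2 by (simp add: x0_def power2_eq_square field_simps)
  have eta_eq: "1 / x + A / (x - 1) = 1 \<longleftrightarrow> x = x0" if "1 < x" for x
  proof -
    have "1 / x + A / (x - 1) = 1 \<longleftrightarrow> (x - 1) + A * x = x * (x - 1)"
      using that by (auto simp: field_simps)
    also have "\<dots> \<longleftrightarrow> x\<^sup>2 - (2 + A) * x + 1 = 0"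
      by (auto simp: power2_eq_square algebra_simps)
    also have "\<dots> \<longleftrightarrow> (x - x0) * (x + x0 - (2 + A)) = 0"
    proof -
      have "x\<^sup>2 - (2 + A) * x + 1 = (x - x0) * (x + x0 - (2 + A)) + (x0\<^sup>2 - (2 + A) * x0 + 1)"
        by (simp add: power2_eq_square algebra_simps)
      then show ?thesis using root by simp
    qed
    \<comment> \<open>The roots have product 1, so a second root could not also exceed 1.\<close>
    also have "\<dots> \<longleftrightarrow> x = x0"
    proof -
      have "x + x0 - (2 + A) \<noteq> 0"
      proof
        assume "x + x0 - (2 + A) = 0"
        then have "x * x0 = (2 + A - x0) * x0" by simp
        also have "\<dots> = 1" using root by (simp add: power2_eq_square algebra_simps)
        finally have "x * x0 = 1" .
        moreover have "1 * 1 < x * x0" using that x01 by (intro mult_strict_mono) auto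
        ultimately show False by simp
      qed
      then show ?thesis by simp
    qed
    finally show ?thesis .
  qed
  have "S_k k (real k + 2) = x0\<^sup>2"
    unfolding S_k_def
  proof (rule the_equality)
    have "1 < x0\<^sup>2" using x01 by (simp add: power2_eq_square less_1_mult)
    then show "x0\<^sup>2 > 1 \<and> eta0 k (x0\<^sup>2) (real k + 2) = 1"
      using eta[of "x0\<^sup>2"] eta_eq[OF x01] x01 by simp
    fix t assume t: "t > 1 \<and> eta0 k t (real k + 2) = 1"
    then have "sqrt t = x0" using eta[of t] eta_eq[of "sqrt t"] by simp
    then show "t = x0\<^sup>2" using t by auto
  qed
  with \<sigma> have lt: "x0\<^sup>2 < \<sigma>" by simp
  then show "1 < \<sigma>" using x01 by (smt (verit) one_less_power pos2)
  have xs: "x0 < sqrt \<sigma>" using lt x01 by (intro real_less_rsqrt) auto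
  define x where "x = sqrt \<sigma>"
  have x: "x0 < x" "1 < x" using xs x01 unfolding x_def by linarith+
  have "8 * (1 / x) / (1 - 1 / x) = 8 / (x - 1)" using x by (simp add: field_simps)
  also have "\<dots> \<le> A / (x - 1)" using x A by (simp add: divide_right_mono)
  also have "\<dots> < A / (x0 - 1)" using x x01 A by (intro divide_strict_left_mono) auto
  finally have "1 / x + 8 * (1 / x) / (1 - 1 / x) < 1 / x0 + A / (x0 - 1)"
    using x x01 by (intro add_strict_mono) (auto simp: frac_less2)
  also have "\<dots> = 1" using eta_eq[OF x01] by simp
  finally show "1 / sqrt \<sigma> + 8 * (1 / sqrt \<sigma>) / (1 - 1 / sqrt \<sigma>) < 1" by (simp add: x_def)
qed

text \<open>Its total mass is infinite when H has integral one, because j runs through all integers;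
  the later arguments rely on its local bound.\<close>

definition shift_measure :: "real \<Rightarrow> real \<Rightarrow> (real \<Rightarrow> real) \<Rightarrow> real measure" where
  "shift_measure L \<omega> H = distr (density lborel (\<lambda>\<theta>. ennreal (H \<theta>)) \<Otimes>\<^sub>M count_space (UNIV :: int set)) borel
     (\<lambda>(\<theta>, j). (2 * real_of_int j * L - \<theta>) * \<omega>)"

text \<open>For fixed \<theta> consecutive shifts are 2 \<omega> L apart, which is exactly the width
  of the open interval.\<close>

lemma at_most_one_shift:
  fixes L \<omega> a \<theta> :: real
  assumes "L > 0" "\<omega> > 0"
    and "\<bar>a - (2 * real_of_int i * L - \<theta>) * \<omega>\<bar> < \<omega> * L" "\<bar>a - (2 * real_of_int j * L - \<theta>) * \<omega>\<bar> < \<omega> * L"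
  shows "i = j"
proof -
  have "\<bar>(2 * real_of_int i * L - \<theta>) * \<omega> - (2 * real_of_int j * L - \<theta>) * \<omega>\<bar> < 2 * (\<omega> * L)"
    using assms(3,4) by linarith
  also have "(2 * real_of_int i * L - \<theta>) * \<omega> - (2 * real_of_int j * L - \<theta>) * \<omega> = real_of_int (i - j) * (2 * (\<omega> * L))"
    by (simp add: algebra_simps)
  finally have "\<bar>real_of_int (i - j)\<bar> * (2 * (\<omega> * L)) < 1 * (2 * (\<omega> * L))"
    using assms(1,2) by (simp add: abs_mult)
  then have "\<bar>real_of_int (i - j)\<bar> < 1"
    using assms(1,2) by (simp only: mult_less_cancel_right_pos mult_pos_pos zero_less_numeral)
  then show "i = j" by linarith
qed

locale density_shift =
  fixes L \<omega> :: real and H :: "real \<Rightarrow> real"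
  assumes L: "L > 0" and \<omega>: "\<omega> > 0"
    and H_nonneg: "\<And>\<theta>. H \<theta> \<ge> 0" and H_int: "integrable lborel H" and H_one: "(\<integral>\<theta>. H \<theta> \<partial>lborel) = 1"
begin

lemma H_meas [measurable]: "H \<in> borel_measurable borel"
  using H_int by auto

lemma nn_integral_H: "(\<integral>\<^sup>+\<theta>. ennreal (H \<theta>) \<partial>lborel) = 1"
  using nn_integral_eq_integral[OF H_int] H_nonneg H_one by simp

lemma sigma_finite_density_H: "sigma_finite_measure (density lborel (\<lambda>\<theta>. ennreal (H \<theta>)))"
proof -
  have "finite_measure (density lborel (\<lambda>\<theta>. ennreal (H \<theta>)))"
    by (rule finite_measureI) (simp add: emeasure_density nn_integral_H)
  then show ?thesis by (simp add: finite_measure_def)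
qed

lemma sets_shift_measure [measurable_cong]: "sets (shift_measure L \<omega> H) = sets borel"
  by (simp add: shift_measure_def)

text \<open>Each \<theta> contributes at most one j, and the \<theta> have total mass one.\<close>

lemma shift_measure_interval: "emeasure (shift_measure L \<omega> H) {t. \<bar>a - t\<bar> < \<omega> * L} \<le> 1"
proof -
  interpret D: sigma_finite_measure "density lborel (\<lambda>\<theta>. ennreal (H \<theta>))"
    by (rule sigma_finite_density_H)
  interpret C: sigma_finite_measure "count_space (UNIV :: int set)"
    by (rule sigma_finite_measure_count_space)
  let ?P = "density lborel (\<lambda>\<theta>. ennreal (H \<theta>)) \<Otimes>\<^sub>M count_space (UNIV :: int set)"
  let ?T = "\<lambda>(\<theta>, j). (2 * real_of_int j * L - \<theta>) * \<omega>"
  let ?I = "indicator {t. \<bar>a - t\<bar> < \<omega> * L} :: real \<Rightarrow> ennreal"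
  have "emeasure (shift_measure L \<omega> H) {t. \<bar>a - t\<bar> < \<omega> * L} = (\<integral>\<^sup>+t. ?I t \<partial>shift_measure L \<omega> H)"
    by (rule nn_integral_indicator[symmetric]) measurable
  also have "\<dots> = (\<integral>\<^sup>+p. ?I (?T p) \<partial>?P)"
    unfolding shift_measure_def by (rule nn_integral_distr) measurable
  also have "\<dots> = (\<integral>\<^sup>+\<theta>. \<integral>\<^sup>+j. ?I (?T (\<theta>, j)) \<partial>count_space UNIV \<partial>density lborel (\<lambda>\<theta>. ennreal (H \<theta>)))"
    by (rule C.nn_integral_fst[symmetric]) measurable
  also have "\<dots> \<le> (\<integral>\<^sup>+\<theta>. 1 \<partial>density lborel (\<lambda>\<theta>. ennreal (H \<theta>)))"
  proof (rule nn_integral_mono)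
    fix \<theta>
    let ?J = "{j. \<bar>a - (2 * real_of_int j * L - \<theta>) * \<omega>\<bar> < \<omega> * L}"
    \<comment> \<open>The singleton serves both cases: if no index qualifies, the description is
      arbitrary and the inclusion is trivial.\<close>
    have "?J \<subseteq> {THE j. j \<in> ?J}"
    proof
      fix j assume j: "j \<in> ?J"
      then have "(THE j. j \<in> ?J) = j"
        using at_most_one_shift[OF L \<omega>] by (intro the_equality) blast+
      then show "j \<in> {THE j. j \<in> ?J}" by simp
    qed
    then have "emeasure (count_space UNIV) ?J \<le> emeasure (count_space UNIV) {THE j. j \<in> ?J}"
      by (rule emeasure_mono) simp
    also have "\<dots> = 1" by simp
    finally have "emeasure (count_space UNIV) ?J \<le> 1" .
    moreover have "(\<integral>\<^sup>+j. ?I (?T (\<theta>, j)) \<partial>count_space UNIV) = (\<integral>\<^sup>+j. indicator ?J j \<partial>count_space UNIV)"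
      by (intro nn_integral_cong) (simp add: indicator_def)
    ultimately show "(\<integral>\<^sup>+j. ?I (?T (\<theta>, j)) \<partial>count_space UNIV) \<le> 1"
      by simp
  qed
  also have "\<dots> = 1"
    by (simp add: emeasure_density nn_integral_H)
  finally show ?thesis .
qed

lemma sigma_finite_shift_measure: "sigma_finite_measure (shift_measure L \<omega> H)"
proof
  let ?A = "range (\<lambda>n :: int. {t. \<bar>real_of_int n * (\<omega> * L) - t\<bar> < \<omega> * L})"
  have b: "0 < \<omega> * L" using L \<omega> by simp
  have "\<exists>n :: int. \<bar>real_of_int n * (\<omega> * L) - t\<bar> < \<omega> * L" for t
  proof -
    have "real_of_int \<lfloor>t / (\<omega> * L)\<rfloor> * (\<omega> * L) \<le> t" "t < (real_of_int \<lfloor>t / (\<omega> * L)\<rfloor> + 1) * (\<omega> * L)"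
      using b by (simp_all add: pos_le_divide_eq[symmetric] pos_divide_less_eq[symmetric])
    then show ?thesis by (intro exI[of _ "\<lfloor>t / (\<omega> * L)\<rfloor>"]) (simp add: algebra_simps abs_less_iff)
  qed
  then have "\<Union>?A = UNIV" by auto
  moreover have "?A \<subseteq> sets borel" by (intro image_subsetI) measurable
  moreover have "\<forall>a\<in>?A. emeasure (shift_measure L \<omega> H) a \<noteq> \<infinity>"
  proof
    fix a assume "a \<in> ?A"
    then have "emeasure (shift_measure L \<omega> H) a \<le> 1" using shift_measure_interval by auto
    then show "emeasure (shift_measure L \<omega> H) a \<noteq> \<infinity>" by (auto simp: top_unique)
  qed
  moreover have "countable ?A" by simp
  ultimately show "\<exists>A. countable A \<and> A \<subseteq> sets (shift_measure L \<omega> H) \<and> \<Union>A = space (shift_measure L \<omega> H) \<and>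
      (\<forall>a\<in>A. emeasure (shift_measure L \<omega> H) a \<noteq> \<infinity>)"
    by (intro exI[of _ ?A]) (auto simp: sets_shift_measure shift_measure_def)
qed

lemma integral_shift_measure:
  fixes \<phi> :: "real \<Rightarrow> real"
  assumes \<phi>: "integrable (shift_measure L \<omega> H) \<phi>"
  shows "integrable lborel (\<lambda>\<theta>. H \<theta> * (\<integral>j. \<phi> ((2 * real_of_int j * L - \<theta>) * \<omega>) \<partial>count_space (UNIV :: int set)))" (is ?I)
    and "(\<integral>t. \<phi> t \<partial>shift_measure L \<omega> H) =
      (\<integral>\<theta>. H \<theta> * (\<integral>j. \<phi> ((2 * real_of_int j * L - \<theta>) * \<omega>) \<partial>count_space (UNIV :: int set)) \<partial>lborel)" (is ?E)
proof -
  interpret D: sigma_finite_measure "density lborel (\<lambda>\<theta>. ennreal (H \<theta>))"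
    by (rule sigma_finite_density_H)
  interpret C: sigma_finite_measure "count_space (UNIV :: int set)"
    by (rule sigma_finite_measure_count_space)
  interpret P: pair_sigma_finite "density lborel (\<lambda>\<theta>. ennreal (H \<theta>))" "count_space (UNIV :: int set)" ..
  let ?P = "density lborel (\<lambda>\<theta>. ennreal (H \<theta>)) \<Otimes>\<^sub>M count_space (UNIV :: int set)"
  let ?T = "\<lambda>(\<theta>, j). (2 * real_of_int j * L - \<theta>) * \<omega>"
  have [measurable]: "\<phi> \<in> borel_measurable borel" using \<phi> by (simp add: shift_measure_def)
  have int: "integrable ?P (\<lambda>p. \<phi> (?T p))"
    using \<phi> unfolding shift_measure_def by (subst (asm) integrable_distr_eq) auto
  have m[measurable]: "(\<lambda>\<theta>. \<integral>j. \<phi> (?T (\<theta>, j)) \<partial>count_space UNIV) \<in> borel_measurable lborel"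
    by measurable
  have i1: "integrable (density lborel (\<lambda>\<theta>. ennreal (H \<theta>))) (\<lambda>\<theta>. \<integral>j. \<phi> (?T (\<theta>, j)) \<partial>count_space UNIV)"
    by (rule P.integrable_fst'[OF int])
  then show ?I
    using H_nonneg by (subst (asm) integrable_density) auto
  have "(\<integral>t. \<phi> t \<partial>shift_measure L \<omega> H) = (\<integral>p. \<phi> (?T p) \<partial>?P)"
    unfolding shift_measure_def by (rule integral_distr) auto
  also have "\<dots> = (\<integral>\<theta>. \<integral>j. \<phi> (?T (\<theta>, j)) \<partial>count_space UNIV \<partial>density lborel (\<lambda>\<theta>. ennreal (H \<theta>)))"
    by (rule P.integral_fst'[OF int, symmetric])
  also have "\<dots> = (\<integral>\<theta>. H \<theta> * (\<integral>j. \<phi> (?T (\<theta>, j)) \<partial>count_space UNIV) \<partial>lborel)"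
    using H_nonneg by (subst integral_density) auto
  finally show ?E by simp
qed

end

section \<open>The averaged Perron--Frobenius operator\<close>

lemma integral_lborel_shift:
  fixes f :: "'a::euclidean_space \<Rightarrow> real"
  assumes [measurable]: "f \<in> borel_measurable borel"
  shows "(\<integral>x. f (x + v) \<partial>lborel) = (\<integral>x. f x \<partial>lborel)"
proof -
  have "(\<integral>x. f x \<partial>lborel) = (\<integral>x. f x \<partial>distr lborel borel ((+) v))"
    by (simp add: lborel_distr_plus)
  also have "\<dots> = (\<integral>x. f (x + v) \<partial>lborel)"
    by (subst integral_distr) (auto simp: add.commute)
  finally show ?thesis ..
qed

text \<open>\<open>chart\<close> only provides some Lipschitz constant; fixing it as M makes the
  chart available as a sublocale.\<close>

locale delay_operator = delay_map e L \<beta> \<sigma> C1 C2 \<gamma> \<Phi>0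
  for e :: "nat \<Rightarrow> 'n::finite" and L \<beta> \<sigma> C1 C2 \<gamma> :: real and \<Phi>0 :: "real^'n \<Rightarrow> real" +
  fixes H :: "real \<Rightarrow> real" and M :: real
  assumes H_nonneg: "\<And>\<theta>. H \<theta> \<ge> 0"
    and H_int: "integrable lborel H" and H_one: "(\<integral>\<theta>. H \<theta> \<partial>lborel) = 1"
    and chart_M: "expanding_chart K F (\<lambda>u. \<bar>p u\<bar>) s M c"
begin

sublocale T: expanding_chart K F "\<lambda>u. \<bar>p u\<bar>" s M c
  by (rule chart_M)

sublocale W: density_shift L \<omega> H
  by unfold_locales (use L_pos \<omega>_pos H_nonneg H_int H_one in auto)

definition \<mu> where "\<mu> = shift_measure L \<omega> H"

abbreviation ek where "ek \<equiv> ax CARD('n)"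

lemma sf: "sigma_finite_measure \<mu>"
  unfolding \<mu>_def by (rule W.sigma_finite_shift_measure)

lemma sets_mu [measurable_cong]: "sets \<mu> = sets borel"
  unfolding \<mu>_def by (simp add: shift_measure_def)

lemma mu_interval: "emeasure \<mu> {t. \<bar>a - t\<bar> < \<omega> * L} \<le> 1"
  unfolding \<mu>_def by (rule W.shift_measure_interval)

text \<open>Members of \<open>V1\<close> vanish off \<Omega> only almost everywhere, while
  \<open>transfer_eosc\<close> needs a pointwise support, and the branches live on the open box. For
  such f this alters f only on a null set.\<close>

definition cut where "cut f u = (f u * indicator (Omega0 e \<gamma> L) u :: real)"

definition h where "h f = T.transfer (cut f)"

definition Pf where "Pf f = fold_strip \<mu> (\<omega> * L) ek (h f)"

lemma Omega0_iff: "u \<in> Omega0 e \<gamma> L \<longleftrightarrow> (\<forall>j\<in>{1..CARD('n)}. \<bar>u $ e j\<bar> < \<gamma> ^ (j - 1) * L)"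
proof -
  have "\<bar>u $ e j\<bar> < \<gamma> ^ (j - 1) * L \<longleftrightarrow> - L < Gam e \<gamma> u $ e j \<and> Gam e \<gamma> u $ e j < L" if "j \<in> {1..CARD('n)}" for j
  proof -
    have "\<bar>Gam e \<gamma> u $ e j\<bar> = \<bar>u $ e j\<bar> / \<gamma> ^ (j - 1)"
      using that \<gamma>_pos by (simp add: abs_mult power_divide)
    then have "\<bar>u $ e j\<bar> < \<gamma> ^ (j - 1) * L \<longleftrightarrow> \<bar>Gam e \<gamma> u $ e j\<bar> < L"
      using \<gamma>_pos by (simp add: pos_divide_less_eq mult.commute)
    then show ?thesis by (simp add: abs_less_iff del: Gam_nth) linarith
  qed
  then show ?thesis by (simp add: Omega0_def del: Gam_nth)
qed

lemma Omega0_eq_box: "Omega0 e \<gamma> L = box (- mkv e (\<lambda>j. \<gamma> ^ (j - 1) * L)) (mkv e (\<lambda>j. \<gamma> ^ (j - 1) * L))"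
proof (rule set_eqI)
  fix u :: "real^'n"
  let ?c = "mkv e (\<lambda>j. \<gamma> ^ (j - 1) * L)"
  show "u \<in> Omega0 e \<gamma> L \<longleftrightarrow> u \<in> box (- ?c) ?c"
    unfolding Omega0_iff mem_box_cart all_coords[of "\<lambda>i. (- ?c) $ i < u $ i \<and> u $ i < ?c $ i"]
    by (auto simp: abs_less_iff)
qed

lemma Omega0_borel [measurable]: "Omega0 e \<gamma> L \<in> sets borel"
  by (simp add: Omega0_eq_box)

lemma OmegaS_borel [measurable]: "OmegaS e \<gamma> L \<in> sets borel"
  by (simp add: OmegaS_eq_cbox)

lemma Omega0_sub: "Omega0 e \<gamma> L \<subseteq> OmegaS e \<gamma> L"
  unfolding Omega0_eq_box OmegaS_eq_cbox by (rule box_subset_cbox)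

lemma Omega0_sub_K: "Omega0 e \<gamma> L \<subseteq> K"
  using Omega0_sub Omega_sub_K interior_subset by blast

lemma AE_Omega: "AE u in lborel. u \<in> OmegaS e \<gamma> L \<longrightarrow> u \<in> Omega0 e \<gamma> L"
proof -
  have "OmegaS e \<gamma> L - Omega0 e \<gamma> L \<in> null_sets lebesgue"
    unfolding negligible_iff_null_sets[symmetric] Omega0_eq_box OmegaS_eq_cbox
    by (rule negligible_frontier_interval)
  then have "OmegaS e \<gamma> L - Omega0 e \<gamma> L \<in> null_sets lborel"
    by (simp add: null_sets_def emeasure_completion)
  then have "AE u in lborel. u \<notin> OmegaS e \<gamma> L - Omega0 e \<gamma> L" by (rule AE_not_in)
  then show ?thesis by eventually_elim auto
qed

lemma cut_measurable [measurable]: "f \<in> borel_measurable borel \<Longrightarrow> cut f \<in> borel_measurable borel"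
  unfolding cut_def by (intro borel_measurable_times borel_measurable_indicator) simp_all

lemma cut_integrable: "integrable lborel f \<Longrightarrow> integrable lborel (cut f)"
  unfolding cut_def by (rule integrable_real_mult_indicator) simp_all

lemma h_integrable: "integrable lborel f \<Longrightarrow> integrable lborel (h f)"
  unfolding h_def by (intro T.integrable_transfer cut_integrable)

lemma nn_integral_Pf_le:
  assumes f: "integrable lborel f"
  shows "(\<integral>\<^sup>+x. ennreal \<bar>Pf f x\<bar> \<partial>lborel) \<le> (\<integral>\<^sup>+x. ennreal \<bar>h f x\<bar> \<partial>lborel)"
proof -
  have "(\<integral>\<^sup>+x. ennreal \<bar>Pf f x\<bar> \<partial>lborel) \<le> (\<integral>\<^sup>+x. \<integral>\<^sup>+t. (if \<bar>x \<bullet> ek\<bar> < \<omega> * L then ennreal \<bar>h f (x + t *\<^sub>R ek)\<bar> else 0) \<partial>\<mu> \<partial>lborel)"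
  proof (rule nn_integral_mono_AE)
    show "AE x in lborel. ennreal \<bar>Pf f x\<bar> \<le> (\<integral>\<^sup>+t. (if \<bar>x \<bullet> ek\<bar> < \<omega> * L then ennreal \<bar>h f (x + t *\<^sub>R ek)\<bar> else 0) \<partial>\<mu>)"
      using AE_integrable_fold[OF sf sets_mu mu_interval norm_ax[of "CARD('n)"] h_integrable[OF f]]
    proof eventually_elim
      case (elim x)
      show ?case
      proof (cases "\<bar>x \<bullet> ek\<bar> < \<omega> * L")
        case True
        then have i: "integrable \<mu> (\<lambda>t. h f (x + t *\<^sub>R ek))" using elim by blast
        have "ennreal \<bar>Pf f x\<bar> = ennreal (norm (\<integral>t. h f (x + t *\<^sub>R ek) \<partial>\<mu>))"
          using True unfolding Pf_def fold_strip_def by simp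
        also have "\<dots> \<le> (\<integral>\<^sup>+t. ennreal (norm (h f (x + t *\<^sub>R ek))) \<partial>\<mu>)"
          by (rule integral_norm_bound_ennreal[OF i])
        finally show ?thesis using True by (simp del: inner_ax)
      next
        case False
        then have "Pf f x = 0" unfolding Pf_def fold_strip_def by (rule if_not_P)
        then show ?thesis by simp
      qed
    qed
  qed
  also have "\<dots> \<le> (\<integral>\<^sup>+x. ennreal \<bar>h f x\<bar> \<partial>lborel)"
    by (rule nn_integral_fold_le[OF sf sets_mu mu_interval norm_ax[of "CARD('n)"] h_integrable[OF f]])
  finally show ?thesis .
qed

lemma Pf_measurable [measurable]: "integrable lborel f \<Longrightarrow> Pf f \<in> borel_measurable borel"
  unfolding Pf_def by (rule borel_measurable_fold_strip[OF sf sets_mu]) (use h_integrable in auto)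

lemma Pf_integrable:
  assumes f: "integrable lborel f"
  shows "integrable lborel (Pf f)"
proof (rule integrableI_bounded)
  show "Pf f \<in> borel_measurable lborel" using Pf_measurable[OF f] by simp
  have "(\<integral>\<^sup>+x. ennreal \<bar>h f x\<bar> \<partial>lborel) < \<infinity>"
    using h_integrable[OF f] by (simp add: integrable_iff_bounded)
  then show "(\<integral>\<^sup>+x. ennreal (norm (Pf f x)) \<partial>lborel) < \<infinity>"
    using nn_integral_Pf_le[OF f] by (auto intro: le_less_trans)
qed

text \<open>Coordinate j < k of F y is the next coordinate of y divided by \<gamma>, so F already
  maps the box into the right range in all coordinates but the last.\<close>

lemma h_zero:
  assumes j: "1 \<le> j" "j < CARD('n)" and x: "\<gamma> ^ (j - 1) * L < \<bar>x $ e j\<bar>"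
  shows "h f x = 0"
proof (cases "x \<in> F ` K")
  case True
  then obtain y where y: "y \<in> K" "x = F y" by blast
  have "y \<notin> Omega0 e \<gamma> L"
  proof
    assume "y \<in> Omega0 e \<gamma> L"
    moreover have "Suc j \<in> {1..CARD('n)}" using j by simp
    ultimately have "\<bar>y $ e (Suc j)\<bar> < \<gamma> ^ (Suc j - 1) * L" unfolding Omega0_iff by blast
    also have "\<gamma> ^ (Suc j - 1) * L = \<gamma> * (\<gamma> ^ (j - 1) * L)"
      using j by (cases j) auto
    finally have "\<bar>x $ e j\<bar> < \<gamma> ^ (j - 1) * L"
      using \<gamma>_pos y F_nth_less[OF j] by (simp add: pos_divide_less_eq mult.commute)
    with x show False by simp
  qed
  then show ?thesis using y by (simp add: h_def T.transfer_def cut_def)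
qed (simp add: h_def T.transfer_def)

text \<open>The last coordinate is confined by the strip, the others by \<open>h_zero\<close>, since
  the translations do not move them.\<close>

lemma Pf_zero:
  assumes "x \<notin> OmegaS e \<gamma> L"
  shows "Pf f x = 0"
proof -
  obtain j where j: "j \<in> {1..CARD('n)}" "\<gamma> ^ (j - 1) * L < \<bar>x $ e j\<bar>"
    using assms by (auto simp: OmegaS_def not_le)
  show ?thesis
  proof (cases "j = CARD('n)")
    case True
    then have "\<not> \<bar>x \<bullet> ek\<bar> < \<omega> * L" using j by (simp add: \<omega>_def)
    then show ?thesis unfolding Pf_def fold_strip_def by (rule if_not_P)
  next
    case False
    then have j': "1 \<le> j" "j < CARD('n)" using j by auto
    have k: "CARD('n) \<in> {1..CARD('n)}" using k_ge by auto
    have "(x + t *\<^sub>R ek) $ e j = x $ e j" for t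
      using ax_nth[OF k j(1)] False by simp
    then have "h f (x + t *\<^sub>R ek) = 0" for t
      using j(2) by (intro h_zero[OF j']) (simp only:)
    then show ?thesis unfolding Pf_def fold_strip_def by simp
  qed
qed

text \<open>The inequalities defining U_j say precisely that the j-th translate of F u lies in the
  open strip, so branch domains need no separate treatment.\<close>

lemma Tpre_iff:
  "u \<in> Tpre e \<gamma> L \<Phi>0 \<theta> Y \<longleftrightarrow> u \<in> Omega0 e \<gamma> L \<and>
    (\<exists>j. F u - ((2 * real_of_int j * L - \<theta>) * \<omega>) *\<^sub>R ek \<in> Y \<inter> {x. \<bar>x \<bullet> ek\<bar> < \<omega> * L})"
proof -
  have k: "CARD('n) \<in> {1..CARD('n)}" using k_ge by auto
  have T: "Tbr e \<gamma> L \<Phi>0 \<theta> j u = F u - ((2 * real_of_int j * L - \<theta>) * \<omega>) *\<^sub>R ek" for j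
    unfolding Tbr_eq by (simp add: left_diff_distrib scaleR_diff_left)
  have "\<bar>(F u - ((2 * real_of_int j * L - \<theta>) * \<omega>) *\<^sub>R ek) \<bullet> ek\<bar> < \<omega> * L \<longleftrightarrow>
      (2 * real_of_int j - 1) * L < \<theta> + \<Phi>0 (Gam e \<gamma> u) \<and> \<theta> + \<Phi>0 (Gam e \<gamma> u) < (2 * real_of_int j + 1) * L" for j
  proof -
    have "(F u - ((2 * real_of_int j * L - \<theta>) * \<omega>) *\<^sub>R ek) \<bullet> ek = \<omega> * (\<theta> + \<Phi>0 (Gam e \<gamma> u) - 2 * real_of_int j * L)"
      using ax_nth[OF k k] by (simp add: F_nth_last \<psi>_def algebra_simps)
    then have "\<bar>(F u - ((2 * real_of_int j * L - \<theta>) * \<omega>) *\<^sub>R ek) \<bullet> ek\<bar> < \<omega> * L \<longleftrightarrow> \<bar>\<theta> + \<Phi>0 (Gam e \<gamma> u) - 2 * real_of_int j * L\<bar> < L"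
      using \<omega>_pos by (simp add: abs_mult)
    also have "\<dots> \<longleftrightarrow> (2 * real_of_int j - 1) * L < \<theta> + \<Phi>0 (Gam e \<gamma> u) \<and> \<theta> + \<Phi>0 (Gam e \<gamma> u) < (2 * real_of_int j + 1) * L"
      by (auto simp: abs_less_iff algebra_simps)
    finally show ?thesis .
  qed
  then show ?thesis
    unfolding Tpre_def Uset_def T Int_iff mem_Collect_eq by (simp only:) blast
qed

text \<open>For fixed \<theta>, translating each summand back puts h at a common point z, and at
  most one j contributes there. The sum over j thus becomes the indicator of \<open>Per\<close>, and
  \<open>integral_transfer\<close> pulls it back to the preimage of Y.\<close>

lemma integral_fold_Tpre:
  assumes f: "integrable lborel f" and Y: "Y \<in> sets borel"
  shows "(\<integral>j. (\<integral>x. indicator (Y \<inter> {x. \<bar>x \<bullet> ek\<bar> < \<omega> * L}) x * h f (x + ((2 * real_of_int j * L - \<theta>) * \<omega>) *\<^sub>R ek) \<partial>lborel) \<partial>count_space UNIV)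
     = (\<integral>u\<in>Tpre e \<gamma> L \<Phi>0 \<theta> Y. f u \<partial>lborel)"
proof -
  interpret C: sigma_finite_measure "count_space (UNIV :: int set)"
    by (rule sigma_finite_measure_count_space)
  interpret X: pair_sigma_finite "lborel :: (real^'n) measure" "count_space (UNIV :: int set)" ..
  have k: "CARD('n) \<in> {1..CARD('n)}" using k_ge by auto
  define Y0 where "Y0 = Y \<inter> {x. \<bar>x \<bullet> ek\<bar> < \<omega> * L}"
  have Y0 [measurable]: "Y0 \<in> sets borel"
    using Y unfolding Y0_def by measurable
  define \<tau> where "\<tau> j = (2 * real_of_int j * L - \<theta>) * \<omega>" for j :: int
  \<comment> \<open>The points that some admissible translation brings into Y within the
    strip.\<close>
  define Per where "Per = (\<Union>j. {z. z - \<tau> j *\<^sub>R ek \<in> Y0})"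
  have Per [measurable]: "Per \<in> sets borel"
    unfolding Per_def by measurable
  have hi: "integrable lborel (h f)" by (rule h_integrable[OF f])
  then have [measurable]: "h f \<in> borel_measurable borel" by auto
  have one: "i = j" if "z - \<tau> i *\<^sub>R ek \<in> Y0" "z - \<tau> j *\<^sub>R ek \<in> Y0" for i j z
  proof -
    have "\<bar>z $ e CARD('n) - \<tau> i\<bar> < \<omega> * L" if "z - \<tau> i *\<^sub>R ek \<in> Y0" for i
      using that ax_nth[OF k k] by (simp add: Y0_def)
    then show ?thesis
      using that unfolding \<tau>_def by (intro at_most_one_shift[OF L_pos \<omega>_pos]) blast+
  qed
  define q where "q z j = indicator Y0 (z - \<tau> j *\<^sub>R ek) * h f z" for z j
  have qm [measurable]: "(\<lambda>(z, j). q z j) \<in> borel_measurable (lborel \<Otimes>\<^sub>M count_space UNIV)"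
    unfolding q_def by measurable
  \<comment> \<open>Off \<open>Per\<close> all terms vanish and any j0 will do.\<close>
  have q_eq: "\<exists>j0. \<forall>j. q z j = (indicator Per z * h f z) * indicator {j0} j" for z
  proof (cases "z \<in> Per")
    case True
    then obtain j0 where j0: "z - \<tau> j0 *\<^sub>R ek \<in> Y0" by (auto simp: Per_def)
    have "q z j = (indicator Per z * h f z) * indicator {j0} j" for j
    proof (cases "j = j0")
      case True
      then show ?thesis using \<open>z \<in> Per\<close> j0 by (simp add: q_def)
    next
      case False
      then have "z - \<tau> j *\<^sub>R ek \<notin> Y0" using one[OF _ j0] by blast
      then show ?thesis using False by (simp add: q_def)
    qed
    then show ?thesis by blast
  next
    case False
    then have "z - \<tau> j *\<^sub>R ek \<notin> Y0" for j by (auto simp: Per_def)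
    then show ?thesis using False by (simp add: q_def)
  qed
  have q_int: "(\<integral>j. q z j \<partial>count_space UNIV) = indicator Per z * h f z" for z
  proof -
    obtain j0 where "\<And>j. q z j = (indicator Per z * h f z) * indicator {j0} j" using q_eq by blast
    then have "(\<integral>j. q z j \<partial>count_space UNIV) = (\<integral>j. (indicator Per z * h f z) * indicator {j0} j \<partial>count_space UNIV)"
      by simp
    also have "\<dots> = indicator Per z * h f z"
      by (subst integral_mult_right_zero) simp
    finally show ?thesis .
  qed
  have q_nn: "(\<integral>\<^sup>+j. ennreal \<bar>q z j\<bar> \<partial>count_space UNIV) \<le> ennreal \<bar>h f z\<bar>" for z
  proof -
    obtain j0 where "\<And>j. q z j = (indicator Per z * h f z) * indicator {j0} j" using q_eq by blast
    then have "ennreal \<bar>q z j\<bar> = ennreal \<bar>indicator Per z * h f z\<bar> * indicator {j0} j" for j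
      by (auto simp: indicator_def)
    then have "(\<integral>\<^sup>+j. ennreal \<bar>q z j\<bar> \<partial>count_space UNIV) = ennreal \<bar>indicator Per z * h f z\<bar>"
      by (simp add: nn_integral_cmult_indicator)
    also have "\<dots> \<le> ennreal \<bar>h f z\<bar>" by (intro ennreal_leI) (auto simp: indicator_def)
    finally show ?thesis .
  qed
  have int: "integrable (lborel \<Otimes>\<^sub>M count_space UNIV) (\<lambda>(z, j). q z j)"
  proof (rule integrableI_bounded[OF qm])
    have "(\<integral>\<^sup>+p. ennreal (norm (case p of (z, j) \<Rightarrow> q z j)) \<partial>(lborel \<Otimes>\<^sub>M count_space UNIV))
        = (\<integral>\<^sup>+z. \<integral>\<^sup>+j. ennreal (norm (case (z, j) of (z, j) \<Rightarrow> q z j)) \<partial>count_space UNIV \<partial>lborel)"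
      by (rule C.nn_integral_fst[symmetric]) measurable
    also have "\<dots> = (\<integral>\<^sup>+z. \<integral>\<^sup>+j. ennreal \<bar>q z j\<bar> \<partial>count_space UNIV \<partial>lborel)" by simp
    also have "\<dots> \<le> (\<integral>\<^sup>+z. ennreal \<bar>h f z\<bar> \<partial>lborel)" by (intro nn_integral_mono q_nn)
    also have "\<dots> < \<infinity>" using hi by (simp add: integrable_iff_bounded)
    finally show "(\<integral>\<^sup>+p. ennreal (norm (case p of (z, j) \<Rightarrow> q z j)) \<partial>(lborel \<Otimes>\<^sub>M count_space UNIV)) < \<infinity>" .
  qed
  have "(\<integral>x. indicator Y0 x * h f (x + \<tau> j *\<^sub>R ek) \<partial>lborel) = (\<integral>z. q z j \<partial>lborel)" for j
  proof -
    have "(\<integral>x. q (x + \<tau> j *\<^sub>R ek) j \<partial>lborel) = (\<integral>z. q z j \<partial>lborel)"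
      unfolding q_def by (rule integral_lborel_shift) measurable
    then show ?thesis by (simp add: q_def)
  qed
  then have "(\<integral>j. (\<integral>x. indicator Y0 x * h f (x + \<tau> j *\<^sub>R ek) \<partial>lborel) \<partial>count_space UNIV) = (\<integral>j. (\<integral>z. q z j \<partial>lborel) \<partial>count_space UNIV)"
    by simp
  also have "\<dots> = (\<integral>z. (\<integral>j. q z j \<partial>count_space UNIV) \<partial>lborel)"
    by (rule X.Fubini_integral[OF int])
  also have "\<dots> = (\<integral>z. T.transfer (cut f) z * indicator Per z \<partial>lborel)"
    unfolding q_int by (simp add: h_def mult.commute)
  also have "\<dots> = (\<integral>y. cut f y * indicator Per (F y) * indicator K y \<partial>lborel)"
  proof (rule T.integral_transfer[OF cut_integrable[OF f] Per])
    have [measurable]: "(\<lambda>y. if y \<in> K then F y else 0) \<in> borel_measurable borel"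
      using continuous_on_subset[OF continuous_F K_sub] by (intro borel_measurable_continuous_on_if) auto
    have [measurable]: "f \<in> borel_measurable borel" using f by auto
    have "(\<lambda>y. cut f y * indicator Per ((\<lambda>y. if y \<in> K then F y else 0) y) * indicator K y) \<in> borel_measurable borel"
      by measurable
    also have "(\<lambda>y. cut f y * indicator Per ((\<lambda>y. if y \<in> K then F y else 0) y) * indicator K y) = (\<lambda>y. cut f y * indicator Per (F y) * indicator K y)"
      by (auto simp: fun_eq_iff indicator_def)
    finally show "(\<lambda>y. cut f y * indicator Per (F y) * indicator K y) \<in> borel_measurable borel" .
  qed
  also have "\<dots> = (\<integral>u\<in>Tpre e \<gamma> L \<Phi>0 \<theta> Y. f u \<partial>lborel)"
    unfolding set_lebesgue_integral_def
  proof (rule Bochner_Integration.integral_cong[OF refl])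
    fix u
    have "u \<in> Tpre e \<gamma> L \<Phi>0 \<theta> Y \<longleftrightarrow> u \<in> Omega0 e \<gamma> L \<and> F u \<in> Per"
      unfolding Tpre_iff Per_def Y0_def \<tau>_def by (simp only: UN_iff UNIV_I mem_Collect_eq) blast
    then show "cut f u * indicator Per (F u) * indicator K u = indicator (Tpre e \<gamma> L \<Phi>0 \<theta> Y) u *\<^sub>R f u"
      using Omega0_sub_K by (auto simp: cut_def indicator_def)
  qed
  finally show ?thesis unfolding Y0_def \<tau>_def .
qed

lemma is_Pf_Pf:
  assumes f: "integrable lborel f"
  shows "is_Pf e \<gamma> L \<Phi>0 H f (Pf f)"
  unfolding is_Pf_def
proof (intro conjI allI impI ballI)
  show "Pf f \<in> borel_measurable lborel" using Pf_measurable[OF f] by simp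
  show "integrable lborel (Pf f)" by (rule Pf_integrable[OF f])
  show "Pf f x = 0" if "x \<notin> OmegaS e \<gamma> L" for x using that by (rule Pf_zero)
  fix Y assume Y': "Y \<in> sets (lborel :: (real^'n) measure)" and sub: "Y \<subseteq> OmegaS e \<gamma> L"
  then have Y [measurable]: "Y \<in> sets borel" by simp
  interpret \<mu>: sigma_finite_measure \<mu> by (rule sf)
  interpret X: pair_sigma_finite "lborel :: (real^'n) measure" \<mu> ..
  define Y0 where "Y0 = Y \<inter> {x. \<bar>x \<bullet> ek\<bar> < \<omega> * L}"
  have Y0 [measurable]: "Y0 \<in> sets borel" unfolding Y0_def by measurable
  have hi: "integrable lborel (h f)" by (rule h_integrable[OF f])
  then have hm [measurable]: "h f \<in> borel_measurable borel" by auto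
  define q where "q x t = indicator Y0 x * h f (x + t *\<^sub>R ek)" for x t
  have qm [measurable]: "(\<lambda>(x, t). q x t) \<in> borel_measurable (lborel \<Otimes>\<^sub>M \<mu>)"
    unfolding q_def by measurable
  have int: "integrable (lborel \<Otimes>\<^sub>M \<mu>) (\<lambda>(x, t). q x t)"
  proof (rule integrableI_bounded[OF qm])
    have "(\<integral>\<^sup>+p. ennreal (norm (case p of (x, t) \<Rightarrow> q x t)) \<partial>(lborel \<Otimes>\<^sub>M \<mu>))
        = (\<integral>\<^sup>+x. \<integral>\<^sup>+t. ennreal (norm (case (x, t) of (x, t) \<Rightarrow> q x t)) \<partial>\<mu> \<partial>lborel)"
      by (rule \<mu>.nn_integral_fst[symmetric]) measurable
    also have "\<dots> \<le> (\<integral>\<^sup>+x. \<integral>\<^sup>+t. (if \<bar>x \<bullet> ek\<bar> < \<omega> * L then ennreal \<bar>h f (x + t *\<^sub>R ek)\<bar> else 0) \<partial>\<mu> \<partial>lborel)"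
      by (intro nn_integral_mono) (auto simp: q_def Y0_def indicator_def)
    also have "\<dots> \<le> (\<integral>\<^sup>+x. ennreal \<bar>h f x\<bar> \<partial>lborel)"
      by (rule nn_integral_fold_le[OF sf sets_mu mu_interval norm_ax[of "CARD('n)"] hi])
    also have "\<dots> < \<infinity>" using hi by (simp add: integrable_iff_bounded)
    finally show "(\<integral>\<^sup>+p. ennreal (norm (case p of (x, t) \<Rightarrow> q x t)) \<partial>(lborel \<Otimes>\<^sub>M \<mu>)) < \<infinity>" .
  qed
  define \<psi>Y where "\<psi>Y t = (\<integral>x. q x t \<partial>lborel)" for t
  have \<psi>Y: "integrable (shift_measure L \<omega> H) \<psi>Y"
    using X.integrable_snd[OF int] unfolding \<psi>Y_def \<mu>_def .
  have inner: "(\<integral>j. \<psi>Y ((2 * real_of_int j * L - \<theta>) * \<omega>) \<partial>count_space UNIV) = (\<integral>u\<in>Tpre e \<gamma> L \<Phi>0 \<theta> Y. f u \<partial>lborel)" for \<theta>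
    unfolding \<psi>Y_def q_def Y0_def by (rule integral_fold_Tpre[OF f Y])
  note shift = W.integral_shift_measure[OF \<psi>Y, unfolded inner]
  show "integrable lborel (\<lambda>\<theta>. H \<theta> * (\<integral>u\<in>Tpre e \<gamma> L \<Phi>0 \<theta> Y. f u \<partial>lborel))"
    by (rule shift(1))
  have "(\<integral>x\<in>Y. Pf f x \<partial>lborel) = (\<integral>x. (\<integral>t. q x t \<partial>\<mu>) \<partial>lborel)"
    unfolding set_lebesgue_integral_def
  proof (rule Bochner_Integration.integral_cong[OF refl])
    fix x
    show "indicator Y x *\<^sub>R Pf f x = (\<integral>t. q x t \<partial>\<mu>)"
      unfolding Pf_def fold_strip_def q_def Y0_def by (auto simp: indicator_def)
  qed
  also have "\<dots> = (\<integral>t. \<psi>Y t \<partial>\<mu>)"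
    unfolding \<psi>Y_def by (rule X.Fubini_integral[OF int, symmetric])
  also have "\<dots> = (\<integral>\<theta>. H \<theta> * (\<integral>u\<in>Tpre e \<gamma> L \<Phi>0 \<theta> Y. f u \<partial>lborel) \<partial>lborel)"
    unfolding \<mu>_def by (rule shift(2))
  finally show "(\<integral>x\<in>Y. Pf f x \<partial>lborel) = (\<integral>\<theta>. H \<theta> * (\<integral>u\<in>Tpre e \<gamma> L \<Phi>0 \<theta> Y. f u \<partial>lborel) \<partial>lborel)" .
qed

end

text \<open>The duality is tested only on subsets of \<Omega>. As both functions vanish outside,
  every Borel set reduces to its part in \<Omega>.\<close>

lemma is_Pf_unique:
  assumes g: "is_Pf e \<gamma> L \<Phi> H f g" and g': "is_Pf e \<gamma> L \<Phi> H f g'"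
    and \<Omega>: "OmegaS e \<gamma> L \<in> sets borel"
  shows "AE x in lborel. g x = g' x"
proof (rule density_unique_real)
  show "integrable lborel g" "integrable lborel g'"
    using g g' by (auto simp: is_Pf_def)
  fix Y :: "(real^'a) set" assume Y: "Y \<in> sets lborel"
  let ?B = "Y \<inter> OmegaS e \<gamma> L"
  have "?B \<in> sets lborel" using Y \<Omega> by simp
  then have "(\<integral>x\<in>?B. g x \<partial>lborel) = (\<integral>x\<in>?B. g' x \<partial>lborel)"
    using g g' by (auto simp: is_Pf_def)
  moreover have "(\<integral>x\<in>?B. k x \<partial>lborel) = (\<integral>x\<in>Y. k x \<partial>lborel)" if "is_Pf e \<gamma> L \<Phi> H f k" for k
    unfolding set_lebesgue_integral_def
    using that by (intro Bochner_Integration.integral_cong) (auto simp: is_Pf_def indicator_def)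
  ultimately show "(\<integral>x\<in>Y. g x \<partial>lborel) = (\<integral>x\<in>Y. g' x \<partial>lborel)"
    using g g' by simp
qed

lemma semi1_eq: "semi1 \<epsilon>0 f = (SUP \<epsilon> \<in> {0<..<\<epsilon>0}. ennreal (1 / \<epsilon>) * (\<integral>\<^sup>+x. eosc f (ball x \<epsilon>) \<partial>lborel))"
  by (simp add: semi1_def eosc_def)

lemma semi1_cong_AE:
  fixes f g :: "'a::euclidean_space \<Rightarrow> real"
  assumes "f \<in> borel_measurable borel" "g \<in> borel_measurable borel" "AE x in lborel. f x = g x"
  shows "semi1 \<epsilon>0 f = semi1 \<epsilon>0 g"
proof -
  have "eosc f (ball x \<epsilon>) = eosc g (ball x \<epsilon>)" for x \<epsilon>
    by (rule eosc_cong_AE[OF assms(1,2) _ assms(3)]) simp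
  then show ?thesis by (simp add: semi1_eq)
qed

lemma nn_integral_eosc_le_semi1:
  assumes "0 < \<epsilon>" "\<epsilon> < \<epsilon>0"
  shows "(\<integral>\<^sup>+x. eosc f (ball x \<epsilon>) \<partial>lborel) \<le> ennreal \<epsilon> * semi1 \<epsilon>0 f"
proof -
  have "ennreal (1 / \<epsilon>) * (\<integral>\<^sup>+x. eosc f (ball x \<epsilon>) \<partial>lborel) \<le> semi1 \<epsilon>0 f"
    unfolding semi1_eq using assms by (intro SUP_upper) auto
  then have "ennreal \<epsilon> * (ennreal (1 / \<epsilon>) * (\<integral>\<^sup>+x. eosc f (ball x \<epsilon>) \<partial>lborel)) \<le> ennreal \<epsilon> * semi1 \<epsilon>0 f"
    by (rule mult_left_mono) simp
  moreover have "ennreal \<epsilon> * ennreal (1 / \<epsilon>) = 1"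
    using assms by (simp add: ennreal_mult'[symmetric])
  ultimately show ?thesis by (simp add: mult.assoc[symmetric])
qed

lemma ennreal_L1norm:
  assumes "integrable lborel f"
  shows "ennreal (L1norm f) = (\<integral>\<^sup>+x. ennreal \<bar>f x\<bar> \<partial>lborel)"
  unfolding L1norm_def using nn_integral_eq_integral[of lborel "\<lambda>x. \<bar>f x\<bar>"] assms by simp

lemma ennreal_collect:
  fixes V N :: ennreal
  assumes "0 \<le> a" "0 \<le> b" "0 \<le> c" "0 \<le> d"
  shows "(ennreal a * V + ennreal b * N) + ennreal c * (N + (ennreal d * V + N)) = ennreal (a + c * d) * V + ennreal (b + 2 * c) * N"
proof -
  have "ennreal (a + c * d) = ennreal a + ennreal c * ennreal d"
    using assms by (simp add: ennreal_mult)
  moreover have "ennreal (b + 2 * c) = ennreal b + (ennreal c + ennreal c)"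
    using assms by (simp only: mult_2 ennreal_plus add_nonneg_nonneg)
  ultimately show ?thesis by (simp add: algebra_simps)
qed

section \<open>The Lasota-Yorke inequality\<close>

context delay_operator
begin

lemma lasota_yorke:
  assumes near: "\<forall>x \<epsilon>. \<epsilon> \<le> \<epsilon>n \<longrightarrow> ball x \<epsilon> \<inter> F ` OmegaS e \<gamma> L \<noteq> {} \<longrightarrow> ball x \<epsilon> \<subseteq> F ` K"
    and \<epsilon>0: "0 < \<epsilon>0" "\<epsilon>0 \<le> s * \<epsilon>n" "\<epsilon>0 \<le> s * (\<omega> * L)" "M / c * \<epsilon>0 \<le> 1 / 18"
    and f: "integrable lborel f" and f0: "AE x in lborel. x \<notin> OmegaS e \<gamma> L \<longrightarrow> f x = 0"
  shows "semi1 \<epsilon>0 (Pf f) \<le> ennreal (s + 8 * s / (1 - s)) * semi1 \<epsilon>0 f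
     + ennreal (2 * (M / c) + 12 * s / ((1 - s) * \<epsilon>0)) * ennreal (L1norm f)"
proof -
  define V where "V = semi1 \<epsilon>0 f"
  define N where "N = ennreal (L1norm f)"
  have fm [measurable]: "f \<in> borel_measurable borel" using f by auto
  have hm [measurable]: "h f \<in> borel_measurable borel" using h_integrable[OF f] by auto
  have Mc: "0 \<le> M / c" using T.M_nonneg c_pos by simp
  have N_eq: "N = (\<integral>\<^sup>+x. ennreal \<bar>f x\<bar> \<partial>lborel)" unfolding N_def by (rule ennreal_L1norm[OF f])
  have cut_eq: "AE x in lborel. cut f x = f x"
    using f0 AE_Omega by eventually_elim (auto simp: cut_def indicator_def)
  have cut_osc: "eosc (cut f) (ball x d) = eosc f (ball x d)" for x d
    by (rule eosc_cong_AE[OF cut_measurable[OF fm] fm _ cut_eq]) simp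
  have cut_N: "(\<integral>\<^sup>+x. ennreal \<bar>cut f x\<bar> \<partial>lborel) = N"
    unfolding N_eq using cut_eq by (intro nn_integral_cong_AE) (auto elim: eventually_mono)
  have hN: "(\<integral>\<^sup>+x. ennreal \<bar>h f x\<bar> \<partial>lborel) \<le> N"
    using T.nn_integral_abs_transfer[OF cut_measurable[OF fm]] unfolding cut_N h_def .
  have trans: "(\<integral>\<^sup>+x. eosc (h f) (ball x d) \<partial>lborel) \<le>
      ennreal (1 + 3 * (M / c * (s * d))) * (\<integral>\<^sup>+x. eosc f (ball x (s * d)) \<partial>lborel) + ennreal (2 * (M / c * (s * d))) * N"
    if d: "0 < d" "d \<le> \<epsilon>n" for d
  proof -
    have "(\<integral>\<^sup>+x. eosc (h f) (ball x d) \<partial>lborel) \<le>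
      ennreal (1 + 3 * (M / c * (s * d))) * (\<integral>\<^sup>+x. eosc (cut f) (ball x (s * d)) \<partial>lborel)
      + ennreal (2 * (M / c * (s * d))) * (\<integral>\<^sup>+x. ennreal \<bar>cut f x\<bar> \<partial>lborel)"
      unfolding h_def
    proof (rule T.transfer_eosc[OF cut_measurable[OF fm] Omega0_sub_K _ d(1)])
      show "cut f y = 0" if "y \<notin> Omega0 e \<gamma> L" for y using that by (simp add: cut_def)
      show "ball x d \<subseteq> F ` K" if "ball x d \<inter> F ` Omega0 e \<gamma> L \<noteq> {}" for x
      proof -
        have "ball x d \<inter> F ` OmegaS e \<gamma> L \<noteq> {}" using that Omega0_sub by blast
        then show ?thesis using near d(2) by blast
      qed
    qed
    then show ?thesis unfolding cut_osc cut_N .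
  qed

  \<comment> \<open>The seminorm sees only radii strictly below \<epsilon>0, so l < 1 is needed for
    s \<rho> < \<epsilon>0. Taking l a third of the way from 1 to s keeps \<rho> - \<epsilon>0 at
    two thirds of its limiting value.\<close>
  define l where "l = (2 + s) / 3"
  define \<rho> where "\<rho> = l * \<epsilon>0 / s"
  have s01: "0 < s" "s < 1" by (rule s_pos, rule s_less)
  have l: "s < l" "l < 1" "l - s = 2 * (1 - s) / 3" "0 < l" using s01 by (simp_all add: l_def field_simps)
  have s\<rho>: "s * \<rho> = l * \<epsilon>0" using s01 by (simp add: \<rho>_def)
  have \<epsilon>0n: "\<epsilon>0 \<le> \<epsilon>n"
  proof -
    have "0 < s * \<epsilon>n" using \<epsilon>0 by linarith
    then have "0 < \<epsilon>n" using s01 by (simp add: zero_less_mult_iff)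
    then have "s * \<epsilon>n \<le> 1 * \<epsilon>n" using s01 by (intro mult_right_mono) auto
    then show ?thesis using \<epsilon>0 by simp
  qed
  have \<rho>_le: "\<rho> \<le> \<epsilon>0 / s"
    using l \<epsilon>0 s01 by (simp add: \<rho>_def divide_right_mono)
  have "\<epsilon>0 / s \<le> \<epsilon>n" "\<epsilon>0 / s \<le> \<omega> * L"
    using \<epsilon>0(2,3) s01 by (simp_all add: pos_divide_le_eq mult.commute)
  then have \<rho>n: "\<rho> \<le> \<epsilon>n" and \<rho>L: "\<rho> \<le> \<omega> * L" using \<rho>_le by linarith+
  have \<rho>0: "0 < \<rho>" using l \<epsilon>0 s01 by (simp add: \<rho>_def)
  \<comment> \<open>4 divided by the lower bound 2 (1 - s) \<epsilon>0 / (3 s) for the half-length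
    r.\<close>
  define \<tau> where "\<tau> = 6 * s / ((1 - s) * \<epsilon>0)"
  have \<tau>0: "0 \<le> \<tau>" using s01 \<epsilon>0 by (simp add: \<tau>_def)
  have \<rho>_diff: "\<epsilon>0 * (2 * (1 - s) / 3) / s = \<rho> - \<epsilon>0"
    using s01 by (simp add: \<rho>_def l_def field_simps)

  \<comment> \<open>The scale \<rho> does not depend on \<epsilon>, so one bound serves all
    \<epsilon>. The 7/6 is 1 + 3 / 18, from the smallness of \<epsilon>0.\<close>
  have X2: "(\<integral>\<^sup>+x. eosc (h f) (ball x \<rho>) \<partial>lborel) \<le> ennreal (7 / 6 * \<epsilon>0) * V + N"
  proof -
    have k: "M / c * (s * \<rho>) \<le> 1 / 18"
      unfolding s\<rho> using mult_left_mono[of "l * \<epsilon>0" \<epsilon>0 "M / c"] Mc l \<epsilon>0 by (smt (verit) mult_le_cancel_right1)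
    have k1: "1 + 3 * (M / c * (s * \<rho>)) \<le> 7 / 6" and k2: "2 * (M / c * (s * \<rho>)) \<le> 1"
      using k by linarith+
    have "(\<integral>\<^sup>+x. eosc f (ball x (s * \<rho>)) \<partial>lborel) \<le> ennreal (l * \<epsilon>0) * V"
      unfolding s\<rho> V_def using l \<epsilon>0 by (intro nn_integral_eosc_le_semi1) auto
    also have "\<dots> \<le> ennreal \<epsilon>0 * V"
      using l \<epsilon>0 by (intro mult_right_mono ennreal_leI) auto
    finally have "ennreal (1 + 3 * (M / c * (s * \<rho>))) * (\<integral>\<^sup>+x. eosc f (ball x (s * \<rho>)) \<partial>lborel) \<le> ennreal (7 / 6) * (ennreal \<epsilon>0 * V)"
      by (intro mult_mono ennreal_leI k1) auto
    also have "\<dots> = ennreal (7 / 6 * \<epsilon>0) * V"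
      using ennreal_mult[of "7 / 6" \<epsilon>0] \<epsilon>0 by (simp add: mult.assoc)
    finally have 1: "ennreal (1 + 3 * (M / c * (s * \<rho>))) * (\<integral>\<^sup>+x. eosc f (ball x (s * \<rho>)) \<partial>lborel) \<le> ennreal (7 / 6 * \<epsilon>0) * V" .
    have "ennreal (2 * (M / c * (s * \<rho>))) * N \<le> ennreal 1 * N"
      by (intro mult_right_mono ennreal_leI k2) auto
    then have "ennreal (2 * (M / c * (s * \<rho>))) * N \<le> N" by simp
    with 1 show ?thesis
      by (intro order_trans[OF trans[OF \<rho>0 \<rho>n]] add_mono)
  qed

  have "ennreal (1 / \<epsilon>) * (\<integral>\<^sup>+x. eosc (Pf f) (ball x \<epsilon>) \<partial>lborel) \<le>
     ennreal (s + 8 * s / (1 - s)) * V + ennreal (2 * (M / c) + 12 * s / ((1 - s) * \<epsilon>0)) * N"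
    if \<epsilon>: "0 < \<epsilon>" "\<epsilon> < \<epsilon>0" for \<epsilon>
  proof -
    \<comment> \<open>Chosen so that r + \<epsilon> is always \<rho>.\<close>
    define r where "r = \<rho> - \<epsilon>"
    have r_ge: "\<epsilon>0 * (2 * (1 - s) / 3) / s \<le> r"
      unfolding \<rho>_diff r_def using \<epsilon> by simp
    moreover have "0 < \<epsilon>0 * (2 * (1 - s) / 3) / s" using s01 \<epsilon>0 by simp
    ultimately have r0: "0 < r" by linarith
    have rL: "r \<le> \<omega> * L" using \<rho>L \<epsilon> by (simp add: r_def)
    have "4 * \<epsilon> / r \<le> 4 * \<epsilon> / (\<epsilon>0 * (2 * (1 - s) / 3) / s)"
      using r_ge \<epsilon> s01 \<epsilon>0 by (intro divide_left_mono mult_pos_pos r0) auto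
    also have "\<dots> = \<epsilon> * \<tau>"
      using s01 \<epsilon>0 by (simp add: \<tau>_def field_simps)
    finally have r_le: "4 * \<epsilon> / r \<le> \<epsilon> * \<tau>" .
    have X1: "(\<integral>\<^sup>+x. eosc (h f) (ball x \<epsilon>) \<partial>lborel) \<le> ennreal (7 / 6 * (s * \<epsilon>)) * V + ennreal (2 * (M / c) * \<epsilon>) * N"
    proof -
      have se: "s * \<epsilon> \<le> \<epsilon>" using s01 \<epsilon> by simp
      have k: "M / c * (s * \<epsilon>) \<le> M / c * \<epsilon>" using Mc se by (rule mult_left_mono[rotated])
      have "M / c * \<epsilon> \<le> M / c * \<epsilon>0" using Mc \<epsilon> by (intro mult_left_mono) auto
      then have k': "M / c * (s * \<epsilon>) \<le> 1 / 18" using k \<epsilon>0(4) by linarith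
      have k1: "1 + 3 * (M / c * (s * \<epsilon>)) \<le> 7 / 6" using k' by linarith
      have k2: "2 * (M / c * (s * \<epsilon>)) \<le> 2 * (M / c) * \<epsilon>" using k by linarith
      have "(\<integral>\<^sup>+x. eosc f (ball x (s * \<epsilon>)) \<partial>lborel) \<le> ennreal (s * \<epsilon>) * V"
        unfolding V_def
      proof (rule nn_integral_eosc_le_semi1)
        show "0 < s * \<epsilon>" using \<epsilon> s01 by simp
        show "s * \<epsilon> < \<epsilon>0" using se \<epsilon> by linarith
      qed
      then have "ennreal (1 + 3 * (M / c * (s * \<epsilon>))) * (\<integral>\<^sup>+x. eosc f (ball x (s * \<epsilon>)) \<partial>lborel) \<le> ennreal (7 / 6) * (ennreal (s * \<epsilon>) * V)"
        by (intro mult_mono ennreal_leI k1) auto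
      also have "\<dots> = ennreal (7 / 6 * (s * \<epsilon>)) * V"
        using ennreal_mult[of "7 / 6" "s * \<epsilon>"] \<epsilon> s01 by (simp add: mult.assoc)
      finally have 1: "ennreal (1 + 3 * (M / c * (s * \<epsilon>))) * (\<integral>\<^sup>+x. eosc f (ball x (s * \<epsilon>)) \<partial>lborel) \<le> ennreal (7 / 6 * (s * \<epsilon>)) * V" .
      have "ennreal (2 * (M / c * (s * \<epsilon>))) * N \<le> ennreal (2 * (M / c) * \<epsilon>) * N"
        by (intro mult_right_mono ennreal_leI k2) auto
      then show ?thesis
        using \<epsilon> \<epsilon>0n by (intro order_trans[OF trans] add_mono 1) linarith+
    qed
    have "(\<integral>\<^sup>+x. eosc (Pf f) (ball x \<epsilon>) \<partial>lborel) \<le> (\<integral>\<^sup>+x. eosc (h f) (ball x \<epsilon>) \<partial>lborel) +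
       ennreal (4 * \<epsilon> / r) * (\<integral>\<^sup>+x. ennreal \<bar>h f x\<bar> + eosc (h f) (ball x (r + \<epsilon>)) \<partial>lborel)"
      unfolding Pf_def
      by (rule fold_strip_eosc[OF sf sets_mu mu_interval norm_ax[of "CARD('n)"] h_integrable[OF f] \<epsilon>(1) r0 rL])
    also have "r + \<epsilon> = \<rho>" by (simp add: r_def)
    also have "(\<integral>\<^sup>+x. ennreal \<bar>h f x\<bar> + eosc (h f) (ball x \<rho>) \<partial>lborel)
        = (\<integral>\<^sup>+x. ennreal \<bar>h f x\<bar> \<partial>lborel) + (\<integral>\<^sup>+x. eosc (h f) (ball x \<rho>) \<partial>lborel)"
      by (rule nn_integral_add) measurable
    also have "(\<integral>\<^sup>+x. eosc (h f) (ball x \<epsilon>) \<partial>lborel) + ennreal (4 * \<epsilon> / r) * \<dots>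
       \<le> (ennreal (7 / 6 * (s * \<epsilon>)) * V + ennreal (2 * (M / c) * \<epsilon>) * N) + ennreal (\<epsilon> * \<tau>) * (N + (ennreal (7 / 6 * \<epsilon>0) * V + N))"
      by (intro add_mono mult_mono X1 X2 hN ennreal_leI r_le) auto
    also have "\<dots> = ennreal (7 / 6 * (s * \<epsilon>) + \<epsilon> * \<tau> * (7 / 6 * \<epsilon>0)) * V + ennreal (2 * (M / c) * \<epsilon> + 2 * (\<epsilon> * \<tau>)) * N"
    proof (rule ennreal_collect)
      show "0 \<le> 2 * (M / c) * \<epsilon>" using Mc \<epsilon> by (intro mult_nonneg_nonneg) auto
    qed (use \<epsilon> \<epsilon>0 s01 \<tau>0 in auto)
    finally have tot: "(\<integral>\<^sup>+x. eosc (Pf f) (ball x \<epsilon>) \<partial>lborel) \<le> \<dots>" .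
    \<comment> \<open>Here 7 is 7/6 times the 6 in \<tau>; the excess s / 6 is absorbed by one s /
      (1 - s).\<close>
    have "1 / \<epsilon> * (7 / 6 * (s * \<epsilon>) + \<epsilon> * \<tau> * (7 / 6 * \<epsilon>0)) = 7 / 6 * s + 7 * s / (1 - s)"
      using \<epsilon> \<epsilon>0 s01 by (simp add: \<tau>_def field_simps)
    also have "\<dots> \<le> s + 8 * s / (1 - s)"
    proof -
      have "s \<le> s / (1 - s)" using s01 by (simp add: pos_le_divide_eq mult_le_cancel_left1)
      then show ?thesis using s01 by simp
    qed
    finally have c1: "1 / \<epsilon> * (7 / 6 * (s * \<epsilon>) + \<epsilon> * \<tau> * (7 / 6 * \<epsilon>0)) \<le> s + 8 * s / (1 - s)" .
    have c2: "1 / \<epsilon> * (2 * (M / c) * \<epsilon> + 2 * (\<epsilon> * \<tau>)) = 2 * (M / c) + 12 * s / ((1 - s) * \<epsilon>0)"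
      using \<epsilon> by (simp add: \<tau>_def distrib_left)
    have "ennreal (1 / \<epsilon>) * (\<integral>\<^sup>+x. eosc (Pf f) (ball x \<epsilon>) \<partial>lborel) \<le>
      ennreal (1 / \<epsilon>) * (ennreal (7 / 6 * (s * \<epsilon>) + \<epsilon> * \<tau> * (7 / 6 * \<epsilon>0)) * V + ennreal (2 * (M / c) * \<epsilon> + 2 * (\<epsilon> * \<tau>)) * N)"
      using tot by (rule mult_left_mono) simp
    also have "\<dots> = ennreal (1 / \<epsilon> * (7 / 6 * (s * \<epsilon>) + \<epsilon> * \<tau> * (7 / 6 * \<epsilon>0))) * V + ennreal (1 / \<epsilon> * (2 * (M / c) * \<epsilon> + 2 * (\<epsilon> * \<tau>))) * N"
    proof -
      have 1: "ennreal (1 / \<epsilon>) * (ennreal u * W) = ennreal (1 / \<epsilon> * u) * W" for u W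
        using \<epsilon> ennreal_mult'[of "1 / \<epsilon>" u] by (simp only: mult.assoc[symmetric]) simp
      show ?thesis unfolding distrib_left 1 ..
    qed
    also have "\<dots> \<le> ennreal (s + 8 * s / (1 - s)) * V + ennreal (2 * (M / c) + 12 * s / ((1 - s) * \<epsilon>0)) * N"
      unfolding c2 by (rule add_mono[OF mult_right_mono[OF ennreal_leI[OF c1]] order_refl]) simp
    finally show ?thesis .
  qed
  then show ?thesis
    unfolding semi1_eq[of _ "Pf f"] V_def N_def by (intro SUP_least) auto
qed

text \<open>By uniqueness g equals \<open>Pf f\<close> almost everywhere, and neither oscillations
  nor norms notice the difference. The additional 1 in the constant pays for the L1 norm of g, which
  is at most that of f.\<close>

lemma operator_bound:
  assumes near: "\<forall>x \<epsilon>. \<epsilon> \<le> \<epsilon>n \<longrightarrow> ball x \<epsilon> \<inter> F ` OmegaS e \<gamma> L \<noteq> {} \<longrightarrow> ball x \<epsilon> \<subseteq> F ` K"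
    and \<epsilon>0: "0 < \<epsilon>0" "\<epsilon>0 \<le> s * \<epsilon>n" "\<epsilon>0 \<le> s * (\<omega> * L)" "M / c * \<epsilon>0 \<le> 1 / 18"
    and f: "V1 \<epsilon>0 (OmegaS e \<gamma> L) f" and g: "is_Pf e \<gamma> L \<Phi>0 H f g"
  shows "V1 \<epsilon>0 (OmegaS e \<gamma> L) g \<and> normV1 \<epsilon>0 g \<le> ennreal (s + 8 * s / (1 - s)) * normV1 \<epsilon>0 f
     + ennreal (2 * (M / c) + 12 * s / ((1 - s) * \<epsilon>0) + 1) * ennreal (L1norm f)"
proof -
  define \<eta> where "\<eta> = s + 8 * s / (1 - s)"
  define C where "C = 2 * (M / c) + 12 * s / ((1 - s) * \<epsilon>0)"
  have C0: "0 \<le> C" using T.M_nonneg c_pos s_pos s_less \<epsilon>0 by (simp add: C_def)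
  have fi: "integrable lborel f" and f0: "AE x in lborel. x \<notin> OmegaS e \<gamma> L \<longrightarrow> f x = 0" and fV: "semi1 \<epsilon>0 f < \<infinity>"
    using f by (auto simp: V1_def)
  have gi: "integrable lborel g" and g0: "\<And>x. x \<notin> OmegaS e \<gamma> L \<Longrightarrow> g x = 0"
    using g by (auto simp: is_Pf_def)
  have fm: "f \<in> borel_measurable borel" and gm: "g \<in> borel_measurable borel" using fi gi by auto
  have eq: "AE x in lborel. g x = Pf f x"
    by (rule is_Pf_unique[OF g is_Pf_Pf[OF fi] OmegaS_borel])
  have "semi1 \<epsilon>0 g = semi1 \<epsilon>0 (Pf f)"
    by (rule semi1_cong_AE[OF gm Pf_measurable[OF fi] eq])
  then have gV: "semi1 \<epsilon>0 g \<le> ennreal \<eta> * semi1 \<epsilon>0 f + ennreal C * ennreal (L1norm f)"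
    using lasota_yorke[OF near \<epsilon>0 fi f0] by (simp add: \<eta>_def C_def)
  also have "\<dots> < \<infinity>"
    using fV by (simp add: ennreal_mult_less_top)
  finally have "semi1 \<epsilon>0 g < \<infinity>" .
  then have 1: "V1 \<epsilon>0 (OmegaS e \<gamma> L) g"
    using gi gm g0 by (simp add: V1_def)
  have "ennreal (L1norm g) = (\<integral>\<^sup>+x. ennreal \<bar>g x\<bar> \<partial>lborel)" by (rule ennreal_L1norm[OF gi])
  also have "\<dots> = (\<integral>\<^sup>+x. ennreal \<bar>Pf f x\<bar> \<partial>lborel)"
    using eq by (intro nn_integral_cong_AE) (auto elim: eventually_mono)
  also have "\<dots> \<le> (\<integral>\<^sup>+x. ennreal \<bar>h f x\<bar> \<partial>lborel)" by (rule nn_integral_Pf_le[OF fi])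
  also have "\<dots> \<le> (\<integral>\<^sup>+x. ennreal \<bar>cut f x\<bar> \<partial>lborel)"
    unfolding h_def by (rule T.nn_integral_abs_transfer[OF cut_measurable[OF fm]])
  also have "\<dots> \<le> (\<integral>\<^sup>+x. ennreal \<bar>f x\<bar> \<partial>lborel)"
    by (intro nn_integral_mono ennreal_leI) (auto simp: cut_def indicator_def)
  also have "\<dots> = ennreal (L1norm f)" by (rule ennreal_L1norm[OF fi, symmetric])
  finally have gN: "ennreal (L1norm g) \<le> ennreal (L1norm f)" .
  have "normV1 \<epsilon>0 g \<le> ennreal (L1norm f) + (ennreal \<eta> * semi1 \<epsilon>0 f + ennreal C * ennreal (L1norm f))"
    unfolding normV1_def using gN gV by (rule add_mono)
  also have "\<dots> = ennreal \<eta> * semi1 \<epsilon>0 f + ennreal (C + 1) * ennreal (L1norm f)"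
  proof -
    have "ennreal (C + 1) = ennreal C + 1" using C0 by simp
    then show ?thesis by (simp add: distrib_right add_ac)
  qed
  also have "\<dots> \<le> ennreal \<eta> * normV1 \<epsilon>0 f + ennreal (C + 1) * ennreal (L1norm f)"
    unfolding normV1_def by (intro add_right_mono mult_left_mono) auto
  finally show ?thesis using 1 by (simp add: \<eta>_def C_def)
qed

end

theorem theorem4p5:
  fixes e :: "nat \<Rightarrow> 'n::finite"
    and L \<beta> \<sigma> C1 C2 \<gamma> :: real
    and \<Phi>0 :: "real^'n \<Rightarrow> real"
    and H :: "real \<Rightarrow> real"
  assumes e_bij: "bij_betw e {1..CARD('n)} UNIV"
    and k_ge: "CARD('n) \<ge> 2"
    and L_pos: "L > 0" and \<beta>_pos: "\<beta> > 0"
    and \<Phi>0_C2: "C2_on \<Phi>0 {x. \<forall>i. -L-\<beta> < x $ i \<and> x $ i < L+\<beta>}"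
    and \<sigma>_gt: "\<sigma> > S_k CARD('n) (real CARD('n) + 2)"
    and C1_gt: "C1 > 1" and C2_gt: "C2 > 1"
    and \<gamma>_pos: "\<gamma> > 0" and \<gamma>_def: "1 / \<gamma>^2 = C1 * \<sigma>"
    and d1: "\<And>x. (\<forall>i. -L-\<beta> < x $ i \<and> x $ i < L+\<beta>) \<Longrightarrow>
               (pderiv_coord e \<Phi>0 1 x)^2 \<ge> C1^(CARD('n) - 1) * C2 * \<sigma>^CARD('n)"
    and dj: "\<And>x j. (\<forall>i. -L-\<beta> < x $ i \<and> x $ i < L+\<beta>) \<Longrightarrow> 2 \<le> j \<Longrightarrow> j \<le> CARD('n) \<Longrightarrow>
               (pderiv_coord e \<Phi>0 j x)^2 \<le> (C1 - 1) * (C2 - 1) / real (CARD('n) - 1) * \<sigma>"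
    and H_nonneg: "\<And>\<theta>. H \<theta> \<ge> 0" and H_meas: "H \<in> borel_measurable lborel"
    and H_int: "integrable lborel H" and H_one: "(\<integral>\<theta>. H \<theta> \<partial>lborel) = 1"
  shows "\<exists>\<epsilon>1>0. \<forall>\<epsilon>0. 0 < \<epsilon>0 \<and> \<epsilon>0 < \<epsilon>1 \<longrightarrow>
           (\<exists>\<eta> C. 0 < \<eta> \<and> \<eta> < 1 \<and> C > 0 \<and>
              (\<forall>f. V1 \<epsilon>0 (OmegaS e \<gamma> L) f \<longrightarrow>
                 (\<exists>g. is_Pf e \<gamma> L \<Phi>0 H f g) \<and>
                 (\<forall>g. is_Pf e \<gamma> L \<Phi>0 H f g \<longrightarrow>
                    V1 \<epsilon>0 (OmegaS e \<gamma> L) g \<and>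
                    normV1 \<epsilon>0 g \<le> ennreal \<eta> * normV1 \<epsilon>0 f + ennreal C * ennreal (L1norm f))))"
proof -
  note \<sigma> = S_k_less[OF k_ge \<sigma>_gt]
  interpret D: delay_map e L \<beta> \<sigma> C1 C2 \<gamma> \<Phi>0
    by unfold_locales (fact e_bij k_ge L_pos \<beta>_pos \<Phi>0_C2 \<sigma>(1) C1_gt C2_gt \<gamma>_pos \<gamma>_def d1 dj)+
  obtain M where M: "expanding_chart D.K D.F (\<lambda>u. \<bar>D.p u\<bar>) D.s M D.c"
    using D.chart by blast
  interpret O: delay_operator e L \<beta> \<sigma> C1 C2 \<gamma> \<Phi>0 H M
    by (rule delay_operator.intro[OF D.delay_map_axioms delay_operator_axioms.intro[OF H_nonneg H_int H_one M]])
  obtain \<epsilon>n where \<epsilon>n: "\<epsilon>n > 0"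
    and near: "\<forall>x \<epsilon>. \<epsilon> \<le> \<epsilon>n \<longrightarrow> ball x \<epsilon> \<inter> D.F ` OmegaS e \<gamma> L \<noteq> {} \<longrightarrow> ball x \<epsilon> \<subseteq> D.F ` D.K"
    using D.near_Omega by blast
  define s c where "s = D.s" and "c = D.c"
  have s: "0 < s" "s < 1" unfolding s_def by (rule D.s_pos, rule D.s_less)
  have Mc: "0 \<le> M / c" using O.T.M_nonneg D.c_pos by (simp add: c_def)
  \<comment> \<open>The three terms guarantee that balls stay in the chart, that the segments are no
    longer than the strip allows, and that the distortion is small. The summand 1 in the last term
    avoids a division by zero when M = 0.\<close>
  define \<epsilon>1 where "\<epsilon>1 = min (s * \<epsilon>n) (min (s * (D.\<omega> * L)) (1 / (18 * (M / c + 1))))"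
  have "0 < \<epsilon>1" using s \<epsilon>n D.\<omega>_pos L_pos Mc by (simp add: \<epsilon>1_def)
  moreover have "\<exists>\<eta> C. 0 < \<eta> \<and> \<eta> < 1 \<and> C > 0 \<and>
              (\<forall>f. V1 \<epsilon>0 (OmegaS e \<gamma> L) f \<longrightarrow>
                 (\<exists>g. is_Pf e \<gamma> L \<Phi>0 H f g) \<and>
                 (\<forall>g. is_Pf e \<gamma> L \<Phi>0 H f g \<longrightarrow>
                    V1 \<epsilon>0 (OmegaS e \<gamma> L) g \<and>
                    normV1 \<epsilon>0 g \<le> ennreal \<eta> * normV1 \<epsilon>0 f + ennreal C * ennreal (L1norm f)))"
    if \<epsilon>0: "0 < \<epsilon>0" "\<epsilon>0 < \<epsilon>1" for \<epsilon>0
  proof -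
    have "M / c * \<epsilon>0 \<le> (M / c + 1) * (1 / (18 * (M / c + 1)))"
      using Mc \<epsilon>0 by (intro mult_mono) (auto simp: \<epsilon>1_def)
    also have "\<dots> = 1 / 18" using Mc by (simp add: add_nonneg_pos)
    finally have small: "M / c * \<epsilon>0 \<le> 1 / 18" .
    have le: "\<epsilon>0 \<le> s * \<epsilon>n" "\<epsilon>0 \<le> s * (D.\<omega> * L)" using \<epsilon>0 by (auto simp: \<epsilon>1_def)
    note bound = O.operator_bound[OF near \<epsilon>0(1) le[unfolded s_def] small[unfolded c_def], folded s_def c_def]
    show ?thesis
    proof (intro exI conjI allI impI)
      show "0 < s + 8 * s / (1 - s)" using s by (simp add: add_pos_pos)
      show "s + 8 * s / (1 - s) < 1" using \<sigma>(2) by (simp add: s_def D.s_def)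
      show "0 < 2 * (M / c) + 12 * s / ((1 - s) * \<epsilon>0) + 1" using Mc s \<epsilon>0 by (intro add_nonneg_pos add_nonneg_nonneg) auto
      fix f assume f: "V1 \<epsilon>0 (OmegaS e \<gamma> L) f"
      then have "integrable lborel f" by (simp add: V1_def)
      then show "is_Pf e \<gamma> L \<Phi>0 H f (O.Pf f)" by (rule O.is_Pf_Pf)
      fix g assume g: "is_Pf e \<gamma> L \<Phi>0 H f g"
      show "V1 \<epsilon>0 (OmegaS e \<gamma> L) g" using bound[OF f g] by blast
      show "normV1 \<epsilon>0 g \<le> ennreal (s + 8 * s / (1 - s)) * normV1 \<epsilon>0 f
        + ennreal (2 * (M / c) + 12 * s / ((1 - s) * \<epsilon>0) + 1) * ennreal (L1norm f)" using bound[OF f g] by blast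
    qed
  qed
  ultimately show ?thesis by blast
qed

end
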